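(* Let $d\ge 2$, $\nu\ge 1$, $s>d/2+1$, let $N>\frac{3\nu}{2}+s+2$ be an integer, and let $f\in\mathcal C^N(\mathbb T^\nu\times\mathbb T^d,\mathbb R^d)$ satisfy $\int_{\mathbb T^\nu\times\mathbb T^d} f(\varphi,x)\,d\varphi\,dx=0$. Let $\omega\in\mathbb R^\nu$ be diophantine, i.e. for some $\gamma\in(0,1)$, $|\omega\cdot\ell|\ge \gamma|\ell|^{-\nu}$ for all $\ell\in\mathbb Z^\nu\setminus\{0\}$. Then there exist $\varepsilon_0=\varepsilon_0(f,s,d,\nu,\gamma)\in(0,1)$ and $C=C(f,s,d,\nu,\gamma)>0$ such that for every $\varepsilon\in(0,\varepsilon_0)$ there exist $U\in\mathcal C^1(\mathbb T^\nu,H^s(\mathbb T^d,\mathbb R^d))$ and $P\in\mathcal C^0(\mathbb T^\nu,H^s(\mathbb T^d,\mathbb R))$ with $$\int_{\mathbb T^\nu\times\mathbb T^d}U(\varphi,x)\,d\varphi\,dx=0,\qquad \int_{\mathbb T^d}P(\varphi,x)\,dx=0\quad\forall\varphi\in\mathbb T^\nu,$$ such that $(u_\omega(t,x),p_\omega(t,x)):=(U(\omega t,x),P(\omega t,x))$ solves the forced Navier-Stokes equation $$\partial_t u-\Delta u+u\cdot\nabla u+\nabla p=\varepsilon f(\omega t,x),\qquad \operatorname{div}u=0,$$ and $$\|U\|_{\mathcal C^1_\varphi H^s_x}\le C\varepsilon,\qquad \|P\|_{\mathcal C^0_\varphi H^s_x}\le C\varepsilon .$$ Moreover, if $f$ has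 zero space average, i.e. $\int_{\mathbb T^d}f(\varphi,x)\,dx=0$ for all $\varphi\in\mathbb T^\nu$, then the same statement holds for every frequency vector $\omega\in\mathbb R^\nu$ (no diophantine condition, and constants $\varepsilon_0,C$ depending only on $f,s,d,\nu$), and in addition $U$ satisfies $\int_{\mathbb T^d}U(\varphi,x)\,dx=0$ for all $\varphi\in\mathbb T^\nu$.
   Context: $\mathbb T=\mathbb R/2\pi\mathbb Z$. $u\cdot\nabla u$ is the vector field with components $u\cdot\nabla u_i$, $i=1,\dots,d$. For $u\in L^2(\mathbb T^d,\mathbb R^n)$, $\widehat u(\xi)=(2\pi)^{-d}\int_{\mathbb T^d}u(x)e^{-ix\cdot\xi}dx$, and $H^s(\mathbb T^d,\mathbb R^n)$ is the Sobolev space with norm $\|u\|_{H^s_x}=\big(\sum_{\xi\in\mathbb Z^d}\langle\xi\rangle^{2s}|\widehat u(\xi)|^2\big)^{1/2}$, $\langle\xi\rangle=\max\{1,|\xi|\}$. For a Banach space $X$, $\mathcal C^0(\mathbb T^\nu,X)$ and $\mathcal C^1(\mathbb T^\nu,X)$ are the spaces of continuous, resp. continuously differentiable, functions $\mathbb T^\nu\to X$, with $\|U\|_{\mathcal C^0_\varphi X}=\sup_\varphi\|U(\varphi)\|_X$ and $\|U\|_{\mathcal C^1_\varphi X}$ the maximum of the sup-norms of $U$ and of its first order partial derivatives in $\varphi$. $\mathcal C^N(\mathbb T^\nu\times\mathbb T^d,\mathbb R^d)$ is the space of $N$-times continuously differentiable functions. *)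

theory Defs
  imports "HOL-Analysis.Analysis"
begin

text \<open>
  A function on the torus of dimension \<open>CARD('d)\<close> is a function on \<open>real ^ 'd\<close> that is
  \<open>2 * pi\<close>-periodic in every coordinate; integrals over the torus are integrals over
  \<open>torus_cell\<close>. Elements of Sobolev spaces are represented by functions, and two functions
  stand for the same element if they agree almost everywhere.
\<close>

definition torus_periodic :: "(real ^ 'd \<Rightarrow> 'b) \<Rightarrow> bool" where
  "torus_periodic u \<longleftrightarrow> (\<forall>x j. u (x + (2 * pi) *\<^sub>R axis j 1) = u x)"

definition torus_cell :: "(real ^ 'd) set" where
  "torus_cell = cbox 0 (\<chi> i. 2 * pi)"

fun C_k :: "nat \<Rightarrow> ('a::euclidean_space \<Rightarrow> 'b::real_normed_vector) \<Rightarrow> bool" where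
  "C_k 0 f \<longleftrightarrow> continuous_on UNIV f"
| "C_k (Suc k) f \<longleftrightarrow>
     (\<forall>x. f differentiable (at x)) \<and> (\<forall>v. C_k k (\<lambda>x. frechet_derivative f (at x) v))"

abbreviation real_vec :: "int ^ 'd \<Rightarrow> real ^ 'd" where
  "real_vec \<xi> \<equiv> (\<chi> i. real_of_int (\<xi> $ i))"


subsection \<open>Sobolev spaces on the torus\<close>

definition fourier_coeff :: "(real ^ 'd \<Rightarrow> real) \<Rightarrow> int ^ 'd \<Rightarrow> complex" where
  "fourier_coeff v \<xi> =
     (LINT x:torus_cell|lborel. complex_of_real (v x) * exp (- \<i> * complex_of_real (x \<bullet> real_vec \<xi>)))
       / (2 * pi) ^ CARD('d)"

definition japanese :: "int ^ 'd \<Rightarrow> real" where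
  "japanese \<xi> = max 1 (norm (real_vec \<xi>))"

text \<open>
  The sum over \<open>Basis\<close> is the squared length of the vector of Fourier coefficients of the
  components. The codomain is a Euclidean space so that \<open>real ^ 'n\<close> and \<open>real\<close> are both covered.
\<close>

definition sobolev_density :: "real \<Rightarrow> (real ^ 'd \<Rightarrow> 'b::euclidean_space) \<Rightarrow> int ^ 'd \<Rightarrow> real" where
  "sobolev_density s u \<xi> =
     japanese \<xi> powr (2 * s) * (\<Sum>b\<in>Basis. (cmod (fourier_coeff (\<lambda>x. u x \<bullet> b) \<xi>))\<^sup>2)"

definition sobolev :: "real \<Rightarrow> (real ^ 'd \<Rightarrow> 'b::euclidean_space) set" where
  "sobolev s = {u. torus_periodic u \<and> u \<in> borel_measurable borel \<and>
     set_integrable lborel torus_cell (\<lambda>x. (norm (u x))\<^sup>2) \<and>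
     sobolev_density s u summable_on UNIV}"

definition sobolev_norm :: "real \<Rightarrow> (real ^ 'd \<Rightarrow> 'b::euclidean_space) \<Rightarrow> real" where
  "sobolev_norm s u = sqrt (\<Sum>\<^sub>\<infinity>\<xi>. sobolev_density s u \<xi>)"


subsection \<open>Continuous and continuously differentiable maps into a Sobolev space\<close>

definition C0_sobolev :: "real \<Rightarrow> (real ^ 'v \<Rightarrow> real ^ 'd \<Rightarrow> 'b::euclidean_space) \<Rightarrow> bool" where
  "C0_sobolev s U \<longleftrightarrow> torus_periodic U \<and> (\<forall>\<phi>. U \<phi> \<in> sobolev s) \<and>
     (\<forall>\<phi>. ((\<lambda>\<psi>. sobolev_norm s (\<lambda>x. U \<psi> x - U \<phi> x)) \<longlongrightarrow> 0) (at \<phi>))"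

definition C0_norm :: "real \<Rightarrow> (real ^ 'v \<Rightarrow> real ^ 'd \<Rightarrow> 'b::euclidean_space) \<Rightarrow> real" where
  "C0_norm s U = (SUP \<phi>. sobolev_norm s (U \<phi>))"

text \<open>Derivative of a curve in the Sobolev space, as a limit of difference quotients in its norm.\<close>

definition has_sobolev_deriv ::
    "real \<Rightarrow> (real \<Rightarrow> real ^ 'd \<Rightarrow> 'b::euclidean_space) \<Rightarrow> (real ^ 'd \<Rightarrow> 'b) \<Rightarrow> real \<Rightarrow> bool" where
  "has_sobolev_deriv s w w' t \<longleftrightarrow> w' \<in> sobolev s \<and>
     ((\<lambda>h. sobolev_norm s (\<lambda>x. (w (t + h) x - w t x) /\<^sub>R h - w' x)) \<longlongrightarrow> 0) (at 0)"

text \<open>The choice below is between functions that agree almost everywhere.\<close>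

definition sobolev_pderiv ::
    "real \<Rightarrow> 'v \<Rightarrow> (real ^ 'v \<Rightarrow> real ^ 'd \<Rightarrow> 'b::euclidean_space) \<Rightarrow> real ^ 'v \<Rightarrow> real ^ 'd \<Rightarrow> 'b" where
  "sobolev_pderiv s j U \<phi> = (SOME V. has_sobolev_deriv s (\<lambda>h. U (\<phi> + h *\<^sub>R axis j 1)) V 0)"

definition C1_sobolev :: "real \<Rightarrow> (real ^ 'v \<Rightarrow> real ^ 'd \<Rightarrow> 'b::euclidean_space) \<Rightarrow> bool" where
  "C1_sobolev s U \<longleftrightarrow> C0_sobolev s U \<and>
     (\<forall>j. (\<forall>\<phi>. \<exists>V. has_sobolev_deriv s (\<lambda>h. U (\<phi> + h *\<^sub>R axis j 1)) V 0) \<and>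
          C0_sobolev s (sobolev_pderiv s j U))"

definition C1_norm :: "real \<Rightarrow> (real ^ 'v \<Rightarrow> real ^ 'd \<Rightarrow> 'b::euclidean_space) \<Rightarrow> real" where
  "C1_norm s U = Max (insert (C0_norm s U) (range (\<lambda>j. C0_norm s (sobolev_pderiv s j U))))"


subsection \<open>The forced Navier-Stokes equation\<close>

definition has_weak_pderiv :: "'d \<Rightarrow> (real ^ 'd \<Rightarrow> real) \<Rightarrow> (real ^ 'd \<Rightarrow> real) \<Rightarrow> bool" where
  "has_weak_pderiv j v w \<longleftrightarrow>
     torus_periodic v \<and> v \<in> borel_measurable borel \<and> set_integrable lborel torus_cell v \<and>
     torus_periodic w \<and> w \<in> borel_measurable borel \<and> set_integrable lborel torus_cell w \<and>
     (\<forall>\<theta> :: real ^ 'd \<Rightarrow> real. torus_periodic \<theta> \<and> (\<forall>k. C_k k \<theta>) \<longrightarrow>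
        (LINT x:torus_cell|lborel. v x * frechet_derivative \<theta> (at x) (axis j 1)) =
        - (LINT x:torus_cell|lborel. w x * \<theta> x))"

text \<open>
  Strong solutions, global in time, with forcing \<open>g\<close>: at every time the equations hold almost
  everywhere in space. The time derivative \<open>ut\<close> is taken in the Sobolev space of order \<open>s\<close>; the
  space derivatives \<open>Du i j\<close> (of the \<open>i\<close>-th component in direction \<open>j\<close>), \<open>D2u i j\<close> (twice in
  direction \<open>j\<close>) and \<open>Dp i\<close> are weak derivatives.
\<close>

definition navier_stokes_solution ::
    "real \<Rightarrow> (real \<Rightarrow> real ^ 'd \<Rightarrow> real ^ 'd) \<Rightarrow> (real \<Rightarrow> real ^ 'd \<Rightarrow> real) \<Rightarrow>
     (real \<Rightarrow> real ^ 'd \<Rightarrow> real ^ 'd) \<Rightarrow> bool" where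
  "navier_stokes_solution s u p g \<longleftrightarrow> (\<forall>t. \<exists>ut Du D2u Dp.
     has_sobolev_deriv s u ut t \<and>
     (\<forall>i j. has_weak_pderiv j (\<lambda>x. u t x $ i) (Du i j)) \<and>
     (\<forall>i j. has_weak_pderiv j (Du i j) (D2u i j)) \<and>
     (\<forall>i. has_weak_pderiv i (p t) (Dp i)) \<and>
     (AE x in lborel. \<forall>i.
        ut x $ i - (\<Sum>j\<in>UNIV. D2u i j x) + (\<Sum>j\<in>UNIV. u t x $ j * Du i j x) + Dp i x = g t x $ i) \<and>
     (AE x in lborel. (\<Sum>i\<in>UNIV. Du i i x) = 0))"


definition diophantine :: "real \<Rightarrow> real ^ 'v \<Rightarrow> bool" where
  "diophantine \<gamma> \<omega> \<longleftrightarrow>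
     (\<forall>l :: int ^ 'v. l \<noteq> 0 \<longrightarrow>
        \<bar>\<omega> \<bullet> real_vec l\<bar> \<ge> \<gamma> * norm (real_vec l) powr (- real CARD('v)))"

end

theory Submission
  imports Defs
begin

text \<open>
  For the Fourier coefficients \<open>A (l, \<xi>)\<close> of \<open>U\<close> the equation reads
  \<open>(\<i> \<omega> \<bullet> l + |\<xi>|\<^sup>2) A + \<i> \<xi> \<bullet> (A * A) + \<i> \<xi> P = \<epsilon> f\<close> with \<open>\<xi> \<bullet> A = 0\<close>. Where \<open>\<xi> \<noteq> 0\<close> the symbol
  is at least \<open>|\<xi>|\<^sup>2\<close>, whatever \<open>\<omega>\<close> is, so its inverse gains two space derivatives and the nonlinear term
  costs one: after the Leray projection, Picard iteration converges in the weighted \<open>\<ell>\<^sup>2\<close> space with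
  weight \<open>\<langle>l\<rangle>\<^sup>\<rho> \<langle>\<xi>\<rangle>\<^bsup>s + 1\<^esup>\<close>, which is an algebra under convolution because \<open>\<rho> > \<nu> / 2\<close> and
  \<open>s + 1 > d / 2\<close>. Small divisors \<open>\<omega> \<bullet> l\<close> occur only at \<open>\<xi> = 0\<close>, where the nonlinear term vanishes, and
  there the diophantine condition costs \<open>\<nu>\<close> derivatives of the space average of \<open>f\<close>. The choice
  \<open>\<rho> = \<nu> / 2 + 5 / 2\<close> makes \<open>\<langle>l\<rangle>\<^sup>2 A\<close> summable in \<open>l\<close>, so that difference quotients of \<open>U\<close> in \<open>\<phi>\<close>
  converge in the Sobolev norm with a linear rate; and \<open>s - 1 > d / 2\<close> makes the series of \<open>U\<close> with its first
  two space derivatives, and of \<open>P\<close> with its first ones, absolutely convergent, so that the equation holds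
  pointwise.
\<close>

subsection \<open>Periodic functions on a Euclidean space\<close>

text \<open>The smallness of \<epsilon> controls only the nonlinearity, and \<omega> matters only
  through the linear problem at \<xi> = 0. Hence \<open>\<epsilon>0\<close> and \<open>C\<close> are
  fixed before \<omega> is given, from a bound \<open>B'\<close> on the linear solution there: a
  multiple of 1/\<gamma> in the diophantine case, and 0 for zero space average. This gives both
  halves of the theorem from one construction. The statement speaks of functions modulo null sets,
  of Lebesgue integrals and of derivatives picked by \<open>SOME\<close>. All of this is reduced to
  Fourier coefficients: the constructed fields are sums of absolutely convergent series, hence
  continuous, and a chosen derivative is known only through its coefficients, which are all that a
  Sobolev norm sees. Conversely, the forcing must be recovered from its coefficients; this needs
  completeness of the exponentials, which comes from the Stone-Weierstrass theorem. Reality of the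
  solution is the symmetry of the coefficients under the reflection of frequencies, carried through
  the iteration as a closed condition. Everything is set up over a general Euclidean space, because
  both the space torus and the product torus occur.\<close>

definition periodic :: "('a::euclidean_space \<Rightarrow> 'b) \<Rightarrow> bool" where
  "periodic g \<longleftrightarrow> (\<forall>x. \<forall>b\<in>Basis. g (x + (2 * pi) *\<^sub>R b) = g x)"

abbreviation cell :: "'a::euclidean_space set" where
  "cell \<equiv> cbox 0 ((2 * pi) *\<^sub>R One)"

text \<open>The slab of the translated cell beyond the face at 2 pi is, by periodicity, the slab
  missing at 0. With \<open>h\<close> at most one period, each box has to be split only
  once.\<close>

lemma integral_cell_translate:
  fixes g :: "'a::euclidean_space \<Rightarrow> 'b::euclidean_space"
  assumes cont: "continuous_on UNIV g" and per: "periodic g" and b: "b \<in> Basis"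
    and h: "0 \<le> h" "h \<le> 2 * pi"
  shows "integral cell (\<lambda>x. g (x + h *\<^sub>R b)) = integral cell g"
proof -
  let ?M = "(2 * pi) *\<^sub>R One :: 'a"
  \<comment> \<open>The cell with its side in direction \<open>b\<close> replaced by the interval
    from \<open>l\<close> to \<open>u\<close>.\<close>
  let ?B = "\<lambda>l u. cbox (l *\<^sub>R b) (?M + (u - 2 * pi) *\<^sub>R b) :: 'a set"
  have int: "g integrable_on cbox l u" for l u
    by (intro integrable_continuous continuous_on_subset[OF cont]) auto
  have mem: "x \<in> ?B l u \<longleftrightarrow> (l \<le> x \<bullet> b \<and> x \<bullet> b \<le> u) \<and> (\<forall>i\<in>Basis - {b}. 0 \<le> x \<bullet> i \<and> x \<bullet> i \<le> 2 * pi)" for x l u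
  proof -
    have "x \<in> ?B l u \<longleftrightarrow> (\<forall>i\<in>insert b (Basis - {b}). (l *\<^sub>R b) \<bullet> i \<le> x \<bullet> i \<and> x \<bullet> i \<le> (?M + (u - 2 * pi) *\<^sub>R b) \<bullet> i)"
      using b by (simp add: mem_box insert_absorb)
    also have "\<dots> \<longleftrightarrow> (l \<le> x \<bullet> b \<and> x \<bullet> b \<le> u) \<and> (\<forall>i\<in>Basis - {b}. 0 \<le> x \<bullet> i \<and> x \<bullet> i \<le> 2 * pi)"
      using b by (auto simp: inner_simps inner_Basis)
    finally show ?thesis .
  qed
  have split: "integral (?B l u) g = integral (?B l m) g + integral (?B m u) g" if "l \<le> m" "m \<le> u" for l m u
  proof -
    have "?B l u \<inter> {x. x \<bullet> b \<le> m} = ?B l m" "?B l u \<inter> {x. x \<bullet> b \<ge> m} = ?B m u"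
      using that by (auto simp: mem)
    then show ?thesis
      using integral_split[OF int b, of "l *\<^sub>R b" "?M + (u - 2 * pi) *\<^sub>R b" m] by simp
  qed
  have shift: "integral (?B l u) (\<lambda>x. g (x + t *\<^sub>R b)) = integral (?B (l + t) (u + t)) g" for l u t
  proof -
    have "cbox ((l + t) *\<^sub>R b - t *\<^sub>R b) ((?M + (u + t - 2 * pi) *\<^sub>R b) - t *\<^sub>R b) = ?B l u"
      by (simp add: algebra_simps)
    then show ?thesis
      using integral_shift_cbox[of "(l + t) *\<^sub>R b" "t *\<^sub>R b" "?M + (u + t - 2 * pi) *\<^sub>R b" g] by simp
  qed
  have "integral cell (\<lambda>x. g (x + h *\<^sub>R b)) = integral (?B h (2 * pi + h)) g"
    using shift[of 0 "2 * pi" h] by simp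
  also have "\<dots> = integral (?B h (2 * pi)) g + integral (?B (2 * pi) (2 * pi + h)) g"
    using h by (intro split) auto
  also have "integral (?B (2 * pi) (2 * pi + h)) g = integral (?B 0 h) (\<lambda>x. g (x + (2 * pi) *\<^sub>R b))"
    using shift[of 0 h "2 * pi"] by (simp add: add.commute)
  also have "(\<lambda>x. g (x + (2 * pi) *\<^sub>R b)) = g"
    using per b by (auto simp: periodic_def)
  also have "integral (?B h (2 * pi)) g + integral (?B 0 h) g = integral (?B 0 (2 * pi)) g"
    using split[of 0 h "2 * pi"] h by simp
  finally show ?thesis by simp
qed

text \<open>By translation invariance the integral of \<open>g (x + h *\<^sub>R b)\<close> is
  constant in \<open>h\<close>, while the Leibniz rule gives it the derivative
  \<open>integral cell g'\<close> at 0. A one-sided derivative on [0, 1] is enough, and 1 \<le> 2 pi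
  keeps the translations in range.\<close>

lemma integral_cell_derivative:
  fixes g :: "'a::euclidean_space \<Rightarrow> 'b::euclidean_space"
  assumes cont: "continuous_on UNIV g" "continuous_on UNIV g'" and per: "periodic g" and b: "b \<in> Basis"
    and deriv: "\<And>x. ((\<lambda>h. g (x + h *\<^sub>R b)) has_vector_derivative g' x) (at 0)"
  shows "integral cell g' = 0"
proof -
  have shifted: "((\<lambda>h. g (x + h *\<^sub>R b)) has_vector_derivative g' (x + t *\<^sub>R b)) (at t within {0..1})" for x t
  proof -
    have "((\<lambda>h. g ((x + t *\<^sub>R b) + h *\<^sub>R b)) has_vector_derivative g' (x + t *\<^sub>R b)) (at (t - t))"
      using deriv[of "x + t *\<^sub>R b"] by simp
    then have "(((\<lambda>h. g ((x + t *\<^sub>R b) + h *\<^sub>R b)) \<circ> (\<lambda>h. h - t)) has_vector_derivative 1 *\<^sub>R g' (x + t *\<^sub>R b)) (at t)"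
      by (intro vector_diff_chain_at) (auto intro!: derivative_eq_intros)
    then show ?thesis
      by (auto simp: o_def algebra_simps intro: has_vector_derivative_at_within)
  qed
  have "((\<lambda>h. integral cell (\<lambda>x. g (x + h *\<^sub>R b))) has_vector_derivative integral cell (\<lambda>x. g' (x + 0 *\<^sub>R b)))
      (at 0 within {0..1})"
  proof (rule leibniz_rule_vector_derivative)
    show "continuous_on ({0..1::real} \<times> cell) (\<lambda>(h, x). g' (x + h *\<^sub>R b))"
      unfolding split_beta by (intro continuous_intros continuous_on_compose2[OF cont(2)]) auto
    show "(\<lambda>x. g (x + h *\<^sub>R b)) integrable_on cell" for h
      by (intro integrable_continuous continuous_intros continuous_on_compose2[OF cont(1)]) auto
  qed (use shifted in auto)
  then have 1: "((\<lambda>h. integral cell (\<lambda>x. g (x + h *\<^sub>R b))) has_vector_derivative integral cell g') (at 0 within {0..1})"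
    by simp
  have eq: "integral cell g = integral cell (\<lambda>x. g (x + h *\<^sub>R b))" if "h \<in> {0..1}" for h
  proof -
    have "1 \<le> 2 * pi" using pi_gt3 by simp
    then show ?thesis
      using that by (intro integral_cell_translate[symmetric] cont per b) auto
  qed
  have "((\<lambda>h. integral cell g) has_vector_derivative integral cell g') (at (0::real) within {0..1})"
    by (rule has_vector_derivative_transform[OF _ _ 1]) (use eq in auto)
  moreover have "((\<lambda>h. integral cell g) has_vector_derivative 0) (at (0::real) within {0..1})"
    by (rule has_vector_derivative_const)
  ultimately show ?thesis
    using vector_derivative_unique_within[of "0::real" "{0..1}"]
    by (metis at_within_Icc_at_right trivial_limit_at_right_real zero_less_one)
qed

section \<open>Exponentials and Fourier coefficients of continuous functions\<close>

definition lattice :: "'a::euclidean_space set" where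
  "lattice = {k. \<forall>b\<in>Basis. k \<bullet> b \<in> \<int>}"

lemma lattice_0 [simp]: "0 \<in> lattice"
  by (simp add: lattice_def)

lemma lattice_add: "k \<in> lattice \<Longrightarrow> l \<in> lattice \<Longrightarrow> k + l \<in> lattice"
  by (simp add: lattice_def inner_add_left)

lemma lattice_uminus: "k \<in> lattice \<Longrightarrow> - k \<in> lattice"
  by (simp add: lattice_def)

lemma lattice_diff: "k \<in> lattice \<Longrightarrow> l \<in> lattice \<Longrightarrow> k - l \<in> lattice"
  by (simp add: lattice_def inner_diff_left)

lemma lattice_Basis: "b \<in> Basis \<Longrightarrow> b \<in> lattice"
  by (auto simp: lattice_def inner_Basis)

lemma periodic_cis:
  assumes "k \<in> lattice" shows "periodic (\<lambda>x. cis (k \<bullet> x))"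
proof -
  have "cis (k \<bullet> (x + (2 * pi) *\<^sub>R b)) = cis (k \<bullet> x)" if "b \<in> Basis" for x b
  proof -
    have "cis (k \<bullet> (x + (2 * pi) *\<^sub>R b)) = cis (k \<bullet> x) * cis (2 * pi * (k \<bullet> b))"
      by (simp add: inner_simps cis_mult)
    then show ?thesis
      using assms that by (simp add: lattice_def)
  qed
  then show ?thesis by (simp add: periodic_def)
qed

lemma measure_cell: "measure lborel (cell :: 'a::euclidean_space set) = (2 * pi) ^ DIM('a)"
  by (subst content_cbox') (auto simp: box_ne_empty)

text \<open>For k \<noteq> 0 some basis vector has k \<bullet> b \<noteq> 0, and then a nonzero
  multiple of the exponential is a derivative in direction \<open>b\<close>, whose integral
  vanishes.\<close>

lemma integral_cis:
  fixes k :: "'a::euclidean_space"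
  assumes k: "k \<in> lattice"
  shows "integral cell (\<lambda>x. cis (k \<bullet> x)) = (if k = 0 then (2 * pi) ^ DIM('a) else 0)"
proof (cases "k = 0")
  case True
  then show ?thesis by (simp add: measure_cell scaleR_conv_of_real)
next
  case False
  then obtain b where b: "b \<in> Basis" "k \<bullet> b \<noteq> 0"
    by (metis euclidean_all_zero_iff)
  have "((\<lambda>h. cis (k \<bullet> (x + h *\<^sub>R b))) has_vector_derivative \<i> * (k \<bullet> b) * cis (k \<bullet> x)) (at 0)" for x
    unfolding has_vector_derivative_def
    by (auto intro!: derivative_eq_intros simp: inner_simps scaleR_conv_of_real algebra_simps fun_eq_iff)
  then have "integral cell (\<lambda>x. \<i> * (k \<bullet> b) * cis (k \<bullet> x)) = 0"
    using b by (intro integral_cell_derivative[OF _ _ periodic_cis[OF k]]) (auto intro!: continuous_intros)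
  then show ?thesis
    using b False by simp
qed

definition fcoef :: "('a::euclidean_space \<Rightarrow> complex) \<Rightarrow> 'a \<Rightarrow> complex" where
  "fcoef g k = integral cell (\<lambda>x. g x * cis (- (k \<bullet> x))) / (2 * pi) ^ DIM('a)"

lemma integral_cell_by_parts:
  fixes g :: "'a::euclidean_space \<Rightarrow> complex"
  assumes cont: "continuous_on UNIV g" "continuous_on UNIV g'" and per: "periodic g" and b: "b \<in> Basis"
    and deriv: "\<And>x. ((\<lambda>h. g (x + h *\<^sub>R b)) has_vector_derivative g' x) (at 0)" and k: "k \<in> lattice"
  shows "integral cell (\<lambda>x. g' x * cis (k \<bullet> x)) = - \<i> * (k \<bullet> b) * integral cell (\<lambda>x. g x * cis (k \<bullet> x))"
proof -
  have int: "h integrable_on cell" if "continuous_on UNIV h" for h :: "'a \<Rightarrow> complex"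
    by (intro integrable_continuous continuous_on_subset[OF that]) auto
  have "((\<lambda>h. cis (k \<bullet> (x + h *\<^sub>R b))) has_vector_derivative \<i> * (k \<bullet> b) * cis (k \<bullet> x)) (at 0)" for x
    unfolding has_vector_derivative_def
    by (auto intro!: derivative_eq_intros simp: inner_simps scaleR_conv_of_real algebra_simps fun_eq_iff)
  from has_vector_derivative_mult[OF deriv this]
  have "integral cell (\<lambda>x. g x * (\<i> * (k \<bullet> b) * cis (k \<bullet> x)) + g' x * cis (k \<bullet> x)) = 0"
    using periodic_cis[OF k] per
    by (intro integral_cell_derivative[where b = b and g = "\<lambda>x. g x * cis (k \<bullet> x)"])
       (auto intro!: continuous_intros cont b simp: periodic_def)
  also have "integral cell (\<lambda>x. g x * (\<i> * (k \<bullet> b) * cis (k \<bullet> x)) + g' x * cis (k \<bullet> x)) =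
      integral cell (\<lambda>x. \<i> * (k \<bullet> b) * (g x * cis (k \<bullet> x))) + integral cell (\<lambda>x. g' x * cis (k \<bullet> x))"
    by (subst integral_add[symmetric], (intro int continuous_intros cont)+) (simp add: mult_ac)
  finally show ?thesis
    by (simp add: add_eq_0_iff2)
qed

lemma fcoef_derivative:
  fixes g :: "'a::euclidean_space \<Rightarrow> complex"
  assumes "continuous_on UNIV g" "continuous_on UNIV g'" "periodic g" "b \<in> Basis"
    and "\<And>x. ((\<lambda>h. g (x + h *\<^sub>R b)) has_vector_derivative g' x) (at 0)" and "k \<in> lattice"
  shows "fcoef g' k = \<i> * (k \<bullet> b) * fcoef g k"
  using integral_cell_by_parts[OF assms(1-5) lattice_uminus[OF assms(6)]]
  by (simp add: fcoef_def)

text \<open>The integral of |g - p|^2 is nonnegative, where \<open>p\<close> is the Fourier sum of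
  \<open>g\<close> over \<open>F\<close>. By orthogonality the mixed term and the integral of |p|^2
  both equal (2 pi)^n times the left-hand side, n being the dimension.\<close>

lemma Bessel:
  fixes g :: "'a::euclidean_space \<Rightarrow> complex"
  assumes cont: "continuous_on UNIV g" and F: "finite F" "F \<subseteq> lattice"
  shows "(\<Sum>k\<in>F. (cmod (fcoef g k))\<^sup>2) \<le> integral cell (\<lambda>x. (cmod (g x))\<^sup>2) / (2 * pi) ^ DIM('a)"
proof -
  define L :: real where "L = (2 * pi) ^ DIM('a)"
  have L: "L > 0" by (simp add: L_def)
  define p where "p = (\<lambda>x. \<Sum>k\<in>F. fcoef g k * cis (k \<bullet> x))"
  have int: "h integrable_on cell" if "continuous_on UNIV h" for h :: "'a \<Rightarrow> complex"
    by (intro integrable_continuous continuous_on_subset[OF that]) auto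
  have contp: "continuous_on UNIV p"
    unfolding p_def by (intro continuous_intros)
  have gp: "integral cell (\<lambda>x. g x * cnj (p x)) = L * (\<Sum>k\<in>F. (cmod (fcoef g k))\<^sup>2)"
  proof -
    have "integral cell (\<lambda>x. g x * cnj (p x)) = integral cell (\<lambda>x. \<Sum>k\<in>F. cnj (fcoef g k) * (g x * cis (- (k \<bullet> x))))"
      unfolding p_def by (simp add: cis_cnj sum_distrib_left mult_ac)
    also have "\<dots> = (\<Sum>k\<in>F. cnj (fcoef g k) * integral cell (\<lambda>x. g x * cis (- (k \<bullet> x))))"
      using F by (subst integral_sum) (auto intro!: int continuous_intros cont)
    also have "\<dots> = (\<Sum>k\<in>F. L * (fcoef g k * cnj (fcoef g k)))"
      using L by (intro sum.cong refl) (simp add: fcoef_def L_def)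
    finally show ?thesis
      by (simp add: complex_norm_square[symmetric] sum_distrib_left)
  qed
  have pp: "integral cell (\<lambda>x. p x * cnj (p x)) = L * (\<Sum>k\<in>F. (cmod (fcoef g k))\<^sup>2)"
  proof -
    have cis_diff: "cis ((j - k) \<bullet> x) = cis (j \<bullet> x) * cnj (cis (k \<bullet> x))" for j k x
      by (simp add: inner_diff_left cis_cnj cis_mult)
    have eq: "p x * cnj (p x) = (\<Sum>j\<in>F. \<Sum>k\<in>F. fcoef g j * cnj (fcoef g k) * cis ((j - k) \<bullet> x))" for x
      unfolding p_def cnj_sum sum_product by (intro sum.cong refl) (simp only: cis_diff complex_cnj_mult mult_ac)
    have "integral cell (\<lambda>x. p x * cnj (p x)) =
        integral cell (\<lambda>x. \<Sum>j\<in>F. \<Sum>k\<in>F. fcoef g j * cnj (fcoef g k) * cis ((j - k) \<bullet> x))"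
      by (simp only: eq)
    also have "\<dots> = (\<Sum>j\<in>F. integral cell (\<lambda>x. \<Sum>k\<in>F. fcoef g j * cnj (fcoef g k) * cis ((j - k) \<bullet> x)))"
      by (intro integral_sum F int continuous_intros)
    also have "\<dots> = (\<Sum>j\<in>F. \<Sum>k\<in>F. integral cell (\<lambda>x. fcoef g j * cnj (fcoef g k) * cis ((j - k) \<bullet> x)))"
      by (intro sum.cong refl integral_sum F int continuous_intros)
    also have "\<dots> = (\<Sum>j\<in>F. \<Sum>k\<in>F. fcoef g j * cnj (fcoef g k) * integral cell (\<lambda>x. cis ((j - k) \<bullet> x)))"
      by simp
    also have "\<dots> = (\<Sum>j\<in>F. \<Sum>k\<in>F. fcoef g j * cnj (fcoef g k) * (if k = j then L else 0))"
      using F by (intro sum.cong refl) (subst integral_cis, auto intro!: lattice_diff simp: L_def)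
    also have "\<dots> = (\<Sum>j\<in>F. L * (fcoef g j * cnj (fcoef g j)))"
      using F by (simp add: if_distrib cong: if_cong) (simp add: mult_ac)
    finally show ?thesis
      by (simp add: complex_norm_square[symmetric] sum_distrib_left)
  qed
  have intr: "h integrable_on cell" if "continuous_on UNIV h" for h :: "'a \<Rightarrow> real"
    by (intro integrable_continuous continuous_on_subset[OF that]) auto
  have eq: "(cmod (g x - p x))\<^sup>2 = (cmod (g x))\<^sup>2 - 2 * Re (g x * cnj (p x)) + Re (p x * cnj (p x))" for x
    unfolding cmod_power2 by (simp add: power2_eq_square algebra_simps)
  have a: "(\<lambda>x. (cmod (g x))\<^sup>2) integrable_on cell" and b: "(\<lambda>x. 2 * Re (g x * cnj (p x))) integrable_on cell"
    and c: "(\<lambda>x. Re (p x * cnj (p x))) integrable_on cell"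
    by (intro intr continuous_intros cont contp)+
  have "0 \<le> integral cell (\<lambda>x. (cmod (g x - p x))\<^sup>2)"
    by (intro integral_nonneg intr continuous_intros cont contp) auto
  also have "\<dots> = integral cell (\<lambda>x. (cmod (g x))\<^sup>2) - 2 * integral cell (\<lambda>x. Re (g x * cnj (p x)))
      + integral cell (\<lambda>x. Re (p x * cnj (p x)))"
    by (simp only: eq integral_add[OF integrable_diff[OF a b] c] integral_diff[OF a b] integral_mult_right)
  also have "integral cell (\<lambda>x. Re (g x * cnj (p x))) = L * (\<Sum>k\<in>F. (cmod (fcoef g k))\<^sup>2)"
    using integral_linear[OF int bounded_linear_Re, of "\<lambda>x. g x * cnj (p x)"] gp
    by (simp add: o_def continuous_intros cont contp)
  also have "integral cell (\<lambda>x. Re (p x * cnj (p x))) = L * (\<Sum>k\<in>F. (cmod (fcoef g k))\<^sup>2)"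
    using integral_linear[OF int bounded_linear_Re, of "\<lambda>x. p x * cnj (p x)"] pp
    by (simp add: o_def continuous_intros cont contp)
  finally show ?thesis
    using L by (simp add: field_simps L_def)
qed

section \<open>Completeness of the trigonometric system\<close>

lemma periodic_translate:
  assumes "periodic g" and "finite F" "F \<subseteq> Basis"
  shows "g (x + (\<Sum>b\<in>F. (2 * pi * of_int (n b)) *\<^sub>R b)) = g x"
  using assms(2,3)
proof (induction F arbitrary: x rule: finite_induct)
  case (insert b F)
  have nat: "g (y + (2 * pi * real m) *\<^sub>R b) = g y" for m y
  proof (induction m)
    case (Suc m)
    have "g (y + (2 * pi * real (Suc m)) *\<^sub>R b) = g ((y + (2 * pi * real m) *\<^sub>R b) + (2 * pi) *\<^sub>R b)"
      by (simp add: algebra_simps)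
    also have "\<dots> = g y"
      using assms(1) insert.prems Suc.IH unfolding periodic_def by auto
    finally show ?case .
  qed simp
  have int: "g (y + (2 * pi * of_int m) *\<^sub>R b) = g y" for m y
  proof (cases m)
    case (nonneg k)
    then show ?thesis using nat[of y k] by simp
  next
    case (neg k)
    have "y + (2 * pi * of_int m) *\<^sub>R b + (2 * pi * real (Suc k)) *\<^sub>R b = y"
      by (simp add: neg algebra_simps flip: scaleR_add_left)
    then show ?thesis
      using nat[of "y + (2 * pi * of_int m) *\<^sub>R b" "Suc k"] by metis
  qed
  have split: "x + (\<Sum>b\<in>insert b F. (2 * pi * of_int (n b)) *\<^sub>R b) =
      (x + (2 * pi * of_int (n b)) *\<^sub>R b) + (\<Sum>b\<in>F. (2 * pi * of_int (n b)) *\<^sub>R b)"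
    using insert.hyps by (simp add: algebra_simps)
  show ?case
    unfolding split using insert.IH[of "x + (2 * pi * of_int (n b)) *\<^sub>R b"] insert.prems int[of x "n b"] by simp
qed simp

lemma periodic_eqI:
  fixes g :: "'a::euclidean_space \<Rightarrow> 'b"
  assumes "periodic g" and "\<And>b. b \<in> Basis \<Longrightarrow> \<exists>n::int. y \<bullet> b = x \<bullet> b + 2 * pi * of_int n"
  shows "g y = g x"
proof -
  obtain n :: "'a \<Rightarrow> int" where n: "\<And>b. b \<in> Basis \<Longrightarrow> y \<bullet> b = x \<bullet> b + 2 * pi * of_int (n b)"
    using assms(2) by metis
  have "y = x + (\<Sum>b\<in>Basis. (2 * pi * of_int (n b)) *\<^sub>R b)"
    by (rule euclidean_eqI)
       (simp add: n inner_add_left inner_sum_left inner_Basis if_distrib cong: if_cong)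
  then show ?thesis
    using periodic_translate[OF assms(1) finite_Basis order_refl] by simp
qed

lemma periodic_cell_representative:
  fixes x :: "'a::euclidean_space"
  obtains y where "y \<in> cell" and "\<And>g :: 'a \<Rightarrow> 'b. periodic g \<Longrightarrow> g y = g x"
proof
  let ?y = "\<Sum>b\<in>Basis. (2 * pi * frac (x \<bullet> b / (2 * pi))) *\<^sub>R b"
  have y: "?y \<bullet> b = 2 * pi * frac (x \<bullet> b / (2 * pi))" if "b \<in> Basis" for b
    using that by (simp add: inner_sum_left inner_Basis if_distrib cong: if_cong)
  show "?y \<in> cell"
    using frac_lt_1[THEN less_imp_le] by (auto simp: mem_box y)
  show "g ?y = g x" if "periodic g" for g :: "'a \<Rightarrow> 'b"
  proof (rule periodic_eqI[OF that])
    fix b :: 'a assume "b \<in> Basis"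
    then show "\<exists>n::int. ?y \<bullet> b = x \<bullet> b + 2 * pi * of_int n"
      by (intro exI[of _ "- \<lfloor>x \<bullet> b / (2 * pi)\<rfloor>"]) (simp add: y frac_def field_simps)
  qed
qed

text \<open>Closure rules instead of finite families of coefficients: continuity, orthogonality and
  stability under products become rule inductions without bookkeeping of frequencies.\<close>

inductive trig :: "('a::euclidean_space \<Rightarrow> complex) \<Rightarrow> bool" where
  wave: "k \<in> lattice \<Longrightarrow> trig (\<lambda>x. cis (k \<bullet> x))"
| scale: "trig p \<Longrightarrow> trig (\<lambda>x. c * p x)"
| add: "trig p \<Longrightarrow> trig q \<Longrightarrow> trig (\<lambda>x. p x + q x)"

lemma trig_const: "trig (\<lambda>x. c)"
  using trig.scale[OF trig.wave[OF lattice_0], of c] by simp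

lemma trig_sum: "(\<And>i. i \<in> I \<Longrightarrow> trig (p i)) \<Longrightarrow> trig (\<lambda>x. \<Sum>i\<in>I. p i x)"
  by (induction I rule: infinite_finite_induct) (auto intro: trig_const trig.add)

lemma trig_mult:
  assumes "trig p" "trig q" shows "trig (\<lambda>x. p x * q x)"
  using assms
proof (induction p rule: trig.induct)
  case (wave k)
  from \<open>trig q\<close> show ?case
  proof (induction q rule: trig.induct)
    case (wave l)
    show ?case
      using trig.wave[OF lattice_add[OF \<open>k \<in> lattice\<close> wave]] by (simp add: cis_mult inner_add_left)
  next
    case (scale p c)
    then show ?case using trig.scale[of "\<lambda>x. cis (k \<bullet> x) * p x" c] by (simp add: mult_ac)
  next
    case (add p q)
    then show ?case using trig.add[of "\<lambda>x. cis (k \<bullet> x) * p x"] by (simp add: distrib_left)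
  qed
next
  case (scale p c)
  then show ?case using trig.scale[of "\<lambda>x. p x * q x" c] by (simp add: mult_ac)
next
  case (add p p')
  then show ?case using trig.add[of "\<lambda>x. p x * q x"] by (simp add: distrib_right)
qed

lemma continuous_trig: "trig p \<Longrightarrow> continuous_on UNIV p"
  by (induction rule: trig.induct) (auto intro!: continuous_intros)

lemma trig_orthogonal:
  assumes "trig p" and cont: "continuous_on UNIV g" and 0: "\<And>k. k \<in> lattice \<Longrightarrow> fcoef g k = 0"
  shows "integral cell (\<lambda>x. g x * p x) = 0"
  using assms(1)
proof (induction rule: trig.induct)
  case (wave k)
  then show ?case
    using 0[OF lattice_uminus[OF wave]] by (simp add: fcoef_def)
next
  case (scale p c)
  then show ?case by (simp add: mult.left_commute[of _ c])
next
  case (add p q)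
  have int: "(\<lambda>x. g x * h x) integrable_on cell" if "trig h" for h
    by (intro integrable_continuous continuous_intros continuous_on_subset[OF cont]
          continuous_on_subset[OF continuous_trig[OF that]]) auto
  show ?case
    using add by (simp add: distrib_left integral_add int)
qed

text \<open>The torus is realised as the image of the cell under \<open>x \<mapsto> (cos x, sin x)\<close>, taken in each coordinate.\<close>

definition circles :: "'a::euclidean_space \<Rightarrow> 'a \<times> 'a" where
  "circles x = (\<Sum>b\<in>Basis. cos (x \<bullet> b) *\<^sub>R b, \<Sum>b\<in>Basis. sin (x \<bullet> b) *\<^sub>R b)"

text \<open>The coordinates of \<open>circles x\<close> are cosines and sines, each a combination of
  two exponentials. A linear functional is a combination of coordinates, and products are covered by
  \<open>trig_mult\<close>.\<close>

lemma trig_polynomial_circles: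
  assumes "real_polynomial_function q"
  shows "trig (\<lambda>x :: 'a::euclidean_space. complex_of_real (q (circles x)))"
  using assms
proof (induction rule: real_polynomial_function.induct)
  case (linear f)
  then interpret f: bounded_linear f .
  have wave: "trig (\<lambda>x :: 'a. cis (b \<bullet> x))" "trig (\<lambda>x :: 'a. cis (- b \<bullet> x))" if "b \<in> Basis" for b
    by (fact trig.wave[OF lattice_Basis[OF that]], fact trig.wave[OF lattice_uminus[OF lattice_Basis[OF that]]])
  have cos: "trig (\<lambda>x :: 'a. complex_of_real (cos (x \<bullet> b)))" if "b \<in> Basis" for b
  proof -
    have "trig (\<lambda>x :: 'a. (1/2) * (cis (b \<bullet> x) + cis (- b \<bullet> x)))"
      using wave[OF that] by (intro trig.scale trig.add)
    also have "(\<lambda>x :: 'a. (1/2) * (cis (b \<bullet> x) + cis (- b \<bullet> x))) = (\<lambda>x. complex_of_real (cos (x \<bullet> b)))"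
      by (auto simp: complex_eq_iff inner_commute)
    finally show ?thesis .
  qed
  have sin: "trig (\<lambda>x :: 'a. complex_of_real (sin (x \<bullet> b)))" if "b \<in> Basis" for b
  proof -
    have "trig (\<lambda>x :: 'a. (- \<i>/2) * (cis (b \<bullet> x) + (- 1) * cis (- b \<bullet> x)))"
      using wave[OF that] by (intro trig.scale trig.add)
    also have "(\<lambda>x :: 'a. (- \<i>/2) * (cis (b \<bullet> x) + (- 1) * cis (- b \<bullet> x))) = (\<lambda>x. complex_of_real (sin (x \<bullet> b)))"
      by (auto simp: complex_eq_iff inner_commute)
    finally show ?thesis .
  qed
  have "complex_of_real (f (circles x)) = (\<Sum>b\<in>Basis. complex_of_real (f (b, 0)) * complex_of_real (cos (x \<bullet> b)))
      + (\<Sum>b\<in>Basis. complex_of_real (f (0, b)) * complex_of_real (sin (x \<bullet> b)))" for x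
  proof -
    have "circles x = (\<Sum>b\<in>Basis. cos (x \<bullet> b) *\<^sub>R (b, 0)) + (\<Sum>b\<in>Basis. sin (x \<bullet> b) *\<^sub>R (0, b))"
      by (simp add: circles_def prod_eq_iff fst_sum snd_sum)
    then have "f (circles x) = (\<Sum>b\<in>Basis. cos (x \<bullet> b) * f (b, 0)) + (\<Sum>b\<in>Basis. sin (x \<bullet> b) * f (0, b))"
      by (simp only: f.add f.sum f.scaleR real_scaleR_def)
    then show ?thesis
      by (simp add: mult.commute)
  qed
  then show ?case
    by (simp, intro trig.add trig_sum trig.scale cos sin)
qed (simp_all add: trig_const trig.add trig_mult)

text \<open>\<open>g\<close> factors through \<open>circles\<close> as a continuous function on a
  compact set, where a polynomial \<open>q\<close> approximates it within \<open>e\<close>. Since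
  \<open>g\<close> is orthogonal to \<open>q (circles x)\<close>, the integral of g^2 equals that of
  g (g - q), which is at most \<open>e\<close> times the integral of |g|.\<close>

theorem fcoef_eq_0_imp_zero:
  fixes g :: "'a::euclidean_space \<Rightarrow> real"
  assumes cont: "continuous_on UNIV g" and per: "periodic g"
    and 0: "\<And>k. k \<in> lattice \<Longrightarrow> fcoef (\<lambda>x. complex_of_real (g x)) k = 0"
  shows "g x = 0"
proof -
  have contc: "continuous_on cell g" by (rule continuous_on_subset[OF cont]) auto
  have contE: "continuous_on UNIV (circles :: 'a \<Rightarrow> _)"
    unfolding circles_def by (intro continuous_intros)
  define K where "K = circles ` (cell :: 'a set)"
  have K: "compact K"
    unfolding K_def by (intro compact_continuous_image continuous_on_subset[OF contE]) auto
  \<comment> \<open>\<open>g\<close> read on the image of \<open>circles\<close>. The choice of the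
    preimage does not matter, because points with the same image differ by periods.\<close>
  define G where "G z = g (SOME y. y \<in> cell \<and> circles y = z)" for z
  have same: "g y = g z" if "circles y = circles z" for y z
  proof (rule periodic_eqI[OF per])
    fix b :: 'a assume b: "b \<in> Basis"
    have "sin (y \<bullet> b) = sin (z \<bullet> b) \<and> cos (y \<bullet> b) = cos (z \<bullet> b)"
      using arg_cong[OF that, of "\<lambda>w. snd w \<bullet> b"] arg_cong[OF that, of "\<lambda>w. fst w \<bullet> b"] b
      by (simp add: circles_def inner_sum_left inner_Basis if_distrib cong: if_cong)
    then show "\<exists>n::int. y \<bullet> b = z \<bullet> b + 2 * pi * of_int n"
      by (simp add: sin_cos_eq_iff)
  qed
  have G: "G (circles y) = g y" if "y \<in> cell" for y
  proof -
    have "\<exists>y'. y' \<in> cell \<and> circles y' = circles y" using that by blast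
    from someI_ex[OF this] show ?thesis
      unfolding G_def by (intro same) blast
  qed
  \<comment> \<open>Closed map argument: the preimage of a closed set under \<open>G\<close> is the
    image under \<open>circles\<close> of a compact part of the cell.\<close>
  have "continuous_on K G"
    unfolding continuous_on_closed_vimage[OF compact_imp_closed[OF K]]
  proof safe
    fix B :: "real set" assume "closed B"
    have eq: "G -` B \<inter> K = circles ` (g -` B \<inter> cell)"
      using G by (auto simp: K_def)
    have "closed (g -` B \<inter> cell)"
      using continuous_on_closed_vimage[OF closed_cbox] contc \<open>closed B\<close> by blast
    then have "closed (circles ` (g -` B \<inter> cell))"
      by (intro compact_imp_closed compact_continuous_image continuous_on_subset[OF contE])
         (auto simp: compact_eq_bounded_closed intro: bounded_subset[OF bounded_cbox])
    then show "closed (G -` B \<inter> K)" unfolding eq .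
  qed
  have int: "h integrable_on cell" if "continuous_on UNIV h" for h :: "'a \<Rightarrow> real"
    by (intro integrable_continuous continuous_on_subset[OF that]) auto
  have le: "integral cell (\<lambda>x. (g x)\<^sup>2) \<le> e * integral cell (\<lambda>x. \<bar>g x\<bar>)" if "e > 0" for e
  proof -
    obtain q where q: "real_polynomial_function q" "\<And>z. z \<in> K \<Longrightarrow> \<bar>G z - q z\<bar> < e"
      using Stone_Weierstrass_real_polynomial_function[OF K \<open>continuous_on K G\<close> \<open>e > 0\<close>] by metis
    have contq: "continuous_on UNIV (\<lambda>x :: 'a. q (circles x))"
      using continuous_on_Re[OF continuous_trig[OF trig_polynomial_circles[OF q(1)]]] by simp
    have "complex_of_real (integral cell (\<lambda>x. g x * q (circles x))) =
        integral cell (\<lambda>x. complex_of_real (g x) * complex_of_real (q (circles x)))"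
      using integral_linear[OF int bounded_linear_of_real[where 'a = complex], of "\<lambda>x. g x * q (circles x)"]
      by (simp add: o_def continuous_intros cont contq)
    also have "\<dots> = 0"
      using q(1) by (intro trig_orthogonal trig_polynomial_circles 0) (auto intro!: continuous_intros cont)
    finally have "integral cell (\<lambda>x. g x * q (circles x)) = 0"
      by simp
    then have "integral cell (\<lambda>x. (g x)\<^sup>2) = integral cell (\<lambda>x. (g x)\<^sup>2 - g x * q (circles x))"
      by (subst integral_diff) (auto intro!: int continuous_intros cont contq)
    also have "\<dots> \<le> integral cell (\<lambda>x. e * \<bar>g x\<bar>)"
    proof (rule integral_le)
      fix x :: 'a assume x: "x \<in> cell"
      have "(g x)\<^sup>2 - g x * q (circles x) \<le> \<bar>g x\<bar> * \<bar>g x - q (circles x)\<bar>"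
        by (simp add: abs_mult[symmetric] power2_eq_square algebra_simps)
      also have "\<dots> \<le> \<bar>g x\<bar> * e"
        using q(2)[of "circles x"] G[OF x] x by (intro mult_left_mono) (auto simp: K_def)
      finally show "(g x)\<^sup>2 - g x * q (circles x) \<le> e * \<bar>g x\<bar>" by (simp add: mult.commute)
    qed (auto intro!: int continuous_intros cont contq)
    finally show ?thesis by simp
  qed
  have "integral cell (\<lambda>x. (g x)\<^sup>2) \<le> 0"
  proof (rule field_le_epsilon)
    fix e :: real assume "e > 0"
    let ?I = "integral cell (\<lambda>x. \<bar>g x\<bar>)"
    have "?I \<ge> 0" by (intro integral_nonneg int continuous_intros cont) auto
    \<comment> \<open>The summand 1 keeps the quotient meaningful when the integral
      \<open>?I\<close> is 0.\<close>
    then have "e / (?I + 1) * ?I \<le> e" "0 < e / (?I + 1)"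
      using \<open>e > 0\<close> by (auto simp: field_simps)
    then show "integral cell (\<lambda>x. (g x)\<^sup>2) \<le> 0 + e"
      using le[of "e / (?I + 1)"] by linarith
  qed
  moreover have "0 \<le> integral cell (\<lambda>x. (g x)\<^sup>2)"
    by (intro integral_nonneg int continuous_intros cont) auto
  ultimately have "integral cell (\<lambda>x. (g x)\<^sup>2) = 0" by simp
  then have "g y = 0" if "y \<in> cell" for y
    using that integral_cbox_eq_0_iff[of 0 "(2 * pi) *\<^sub>R One" "\<lambda>x. (g x)\<^sup>2"] contc
    by (auto simp: box_ne_empty continuous_on_power)
  then show ?thesis
    using periodic_cell_representative[of x] per by metis
qed

subsection \<open>Square-summable sequences\<close>

text \<open>Bounds the l2 norm through finite partial sums, so that no summability has to be carried
  along and bounds pass to pointwise limits.\<close>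

definition l2_bound :: "('k \<Rightarrow> real) \<Rightarrow> real \<Rightarrow> bool" where
  "l2_bound a R \<longleftrightarrow> (\<forall>F. finite F \<longrightarrow> L2_set a F \<le> R)"

lemma l2_boundI: "(\<And>F. finite F \<Longrightarrow> L2_set a F \<le> R) \<Longrightarrow> l2_bound a R"
  by (simp add: l2_bound_def)

lemma l2_boundD: "l2_bound a R \<Longrightarrow> finite F \<Longrightarrow> L2_set a F \<le> R"
  by (simp add: l2_bound_def)

lemma l2_bound_nonneg: "l2_bound a R \<Longrightarrow> 0 \<le> R"
  using l2_boundD[of a R "{}"] by simp

lemma l2_bound_point: "l2_bound a R \<Longrightarrow> \<bar>a k\<bar> \<le> R"
  using l2_boundD[of a R "{k}"] by (simp add: L2_set_def)

lemma l2_bound_mono: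
  assumes "l2_bound b R" and "\<And>k. \<bar>a k\<bar> \<le> b k" and "R \<le> S"
  shows "l2_bound a S"
proof (rule l2_boundI)
  fix F :: "'a set" assume "finite F"
  have "L2_set a F = L2_set (\<lambda>k. \<bar>a k\<bar>) F" by (simp add: L2_set_def)
  also have "\<dots> \<le> L2_set b F" by (rule L2_set_mono) (use assms in auto)
  also have "\<dots> \<le> S" using l2_boundD[OF assms(1) \<open>finite F\<close>] assms(3) by simp
  finally show "L2_set a F \<le> S" .
qed

lemma l2_bound_add:
  assumes "l2_bound a R" "l2_bound b S" shows "l2_bound (\<lambda>k. a k + b k) (R + S)"
proof (rule l2_boundI)
  fix F :: "'a set" assume F: "finite F"
  have "L2_set (\<lambda>k. a k + b k) F \<le> L2_set a F + L2_set b F" by (rule L2_set_triangle_ineq)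
  then show "L2_set (\<lambda>k. a k + b k) F \<le> R + S"
    using l2_boundD[OF assms(1) F] l2_boundD[OF assms(2) F] by simp
qed

lemma l2_bound_zero: "0 \<le> R \<Longrightarrow> l2_bound (\<lambda>k. 0) R"
  by (simp add: l2_bound_def L2_set_def)

lemma l2_bound_sum:
  assumes "finite I" "\<And>i. i \<in> I \<Longrightarrow> l2_bound (a i) (R i)"
  shows "l2_bound (\<lambda>k. \<Sum>i\<in>I. a i k) (\<Sum>i\<in>I. R i)"
  using assms by (induction I rule: finite_induct) (auto intro: l2_bound_add l2_bound_zero)

lemma l2_bound_scale:
  assumes "l2_bound a R" shows "l2_bound (\<lambda>k. c * a k) (\<bar>c\<bar> * R)"
proof (rule l2_boundI)
  fix F :: "'a set" assume F: "finite F"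
  have "L2_set (\<lambda>k. c * a k) F = \<bar>c\<bar> * L2_set a F"
    by (simp add: L2_set_def power_mult_distrib sum_distrib_left[symmetric] real_sqrt_mult)
  then show "L2_set (\<lambda>k. c * a k) F \<le> \<bar>c\<bar> * R"
    using l2_boundD[OF assms F] by (simp add: mult_left_mono)
qed

lemma l2_bound_inj:
  assumes "l2_bound a R" and "inj h" shows "l2_bound (\<lambda>k. a (h k)) R"
proof (rule l2_boundI)
  fix F :: "'b set" assume F: "finite F"
  have "L2_set (\<lambda>k. a (h k)) F = L2_set a (h ` F)"
    unfolding L2_set_def using assms(2) by (subst sum.reindex) (auto simp: inj_on_def)
  then show "L2_set (\<lambda>k. a (h k)) F \<le> R"
    using l2_boundD[OF assms(1), of "h ` F"] F by simp
qed

text \<open>Fatou's lemma for sequences: a partial norm sees finitely many indices, so pointwise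
  convergence is enough.\<close>

lemma l2_bound_limit:
  assumes "\<And>n. l2_bound (A n) R" and lim: "\<And>k. (\<lambda>n. A n k) \<longlonglongrightarrow> a k"
  shows "l2_bound a R"
proof (rule l2_boundI)
  fix F :: "'a set" assume F: "finite F"
  have "(\<lambda>n. L2_set (A n) F) \<longlonglongrightarrow> L2_set a F"
    unfolding L2_set_def by (intro tendsto_intros lim)
  then show "L2_set a F \<le> R"
    using l2_boundD[OF assms(1) F] by (intro LIMSEQ_le_const2) auto
qed

lemma sum_square_le_iff_L2_set:
  assumes "0 \<le> R" shows "(\<Sum>k\<in>F. (a k)\<^sup>2) \<le> R\<^sup>2 \<longleftrightarrow> L2_set a F \<le> R"
  using assms unfolding L2_set_def
  by (metis abs_of_nonneg real_sqrt_abs real_sqrt_le_iff)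

lemma nonneg_summable_infsum_le:
  fixes f :: "'k \<Rightarrow> real"
  assumes "\<And>k. 0 \<le> f k" and "\<And>F. finite F \<Longrightarrow> sum f F \<le> B"
  shows "f summable_on UNIV" and "infsum f UNIV \<le> B"
proof -
  show "f summable_on UNIV"
    by (rule nonneg_bdd_above_summable_on) (use assms in \<open>auto intro!: bdd_aboveI2\<close>)
  then show "infsum f UNIV \<le> B"
    by (rule infsum_le_finite_sums) (use assms in auto)
qed

lemma l2_bound_square_summable:
  assumes "l2_bound a R"
  shows "(\<lambda>k. (a k)\<^sup>2) summable_on UNIV" and "(\<Sum>\<^sub>\<infinity>k. (a k)\<^sup>2) \<le> R\<^sup>2"
proof -
  have "(\<Sum>k\<in>F. (a k)\<^sup>2) \<le> R\<^sup>2" if "finite F" for F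
    using l2_boundD[OF assms that] l2_bound_nonneg[OF assms] by (simp add: sum_square_le_iff_L2_set)
  then show "(\<lambda>k. (a k)\<^sup>2) summable_on UNIV" "(\<Sum>\<^sub>\<infinity>k. (a k)\<^sup>2) \<le> R\<^sup>2"
    using nonneg_summable_infsum_le[of "\<lambda>k. (a k)\<^sup>2" "R\<^sup>2"] by simp_all
qed

lemma summable_on_finite_sum:
  fixes f :: "'i \<Rightarrow> 'k \<Rightarrow> 'b::{topological_comm_monoid_add, t2_space}"
  assumes "finite I" "\<And>i. i \<in> I \<Longrightarrow> f i summable_on A"
  shows "(\<lambda>k. \<Sum>i\<in>I. f i k) summable_on A"
    and "(\<Sum>\<^sub>\<infinity>k\<in>A. \<Sum>i\<in>I. f i k) = (\<Sum>i\<in>I. infsum (f i) A)"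
  using assms by (induction I rule: finite_induct) (auto simp: summable_on_add infsum_add)

lemma l2_Cauchy_Schwarz:
  assumes "l2_bound a R" "l2_bound b S" and le: "\<And>k. 0 \<le> f k" "\<And>k. f k \<le> \<bar>a k\<bar> * \<bar>b k\<bar>"
  shows "f summable_on UNIV" and "infsum f UNIV \<le> R * S"
proof -
  have "sum f F \<le> R * S" if "finite F" for F
  proof -
    have "sum f F \<le> (\<Sum>k\<in>F. \<bar>a k\<bar> * \<bar>b k\<bar>)" by (intro sum_mono le)
    also have "\<dots> \<le> L2_set a F * L2_set b F" by (rule L2_set_mult_ineq)
    also have "\<dots> \<le> R * S"
      using l2_boundD[OF assms(1) that] l2_boundD[OF assms(2) that] l2_bound_nonneg[OF assms(1)]
      by (intro mult_mono) auto
    finally show ?thesis .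
  qed
  then show "f summable_on UNIV" "infsum f UNIV \<le> R * S"
    using nonneg_summable_infsum_le[of f] le(1) by auto
qed

lemma l2_bound_product:
  assumes "l2_bound a R" "l2_bound b S"
  shows "l2_bound (\<lambda>(x, y). a x * b y) (R * S)"
proof (rule l2_boundI)
  fix F :: "('a \<times> 'b) set" assume F: "finite F"
  \<comment> \<open>\<open>F\<close> is enlarged to the product of its projections, over which the
    sum of squares factors.\<close>
  have "(\<Sum>k\<in>F. (case k of (x, y) \<Rightarrow> a x * b y)\<^sup>2) \<le> (\<Sum>k\<in>fst ` F \<times> snd ` F. (case k of (x, y) \<Rightarrow> a x * b y)\<^sup>2)"
    using F by (intro sum_mono2) (auto simp: rev_image_eqI)
  also have "\<dots> = (\<Sum>x\<in>fst ` F. (a x)\<^sup>2) * (\<Sum>y\<in>snd ` F. (b y)\<^sup>2)"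
    by (simp add: sum_product sum.cartesian_product power_mult_distrib split_beta)
  also have "\<dots> \<le> R\<^sup>2 * S\<^sup>2"
    using F l2_boundD[OF assms(1)] l2_boundD[OF assms(2)] l2_bound_nonneg[OF assms(1)] l2_bound_nonneg[OF assms(2)]
    by (intro mult_mono) (auto simp: sum_square_le_iff_L2_set intro!: sum_nonneg)
  finally show "L2_set (\<lambda>(x, y). a x * b y) F \<le> R * S"
    using l2_bound_nonneg[OF assms(1)] l2_bound_nonneg[OF assms(2)]
    by (simp add: power_mult_distrib[symmetric] sum_square_le_iff_L2_set)
qed

text \<open>
  The condition on \<open>W\<close> makes the weighted space an algebra: by the Cauchy-Schwarz inequality the
  weighted convolution at \<open>k\<close> is at most \<open>M\<close> times the norm of \<open>j \<mapsto> W j * a j * W (k - j) * b (k - j)\<close>.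
\<close>

lemma weighted_convolution:
  fixes W a b :: "'k::ab_group_add \<Rightarrow> real"
  assumes W: "\<And>k. W k > 0" and K: "\<And>k. l2_bound (\<lambda>j. W k / (W j * W (k - j))) M"
    and a: "l2_bound (\<lambda>k. W k * a k) R" and b: "l2_bound (\<lambda>k. W k * b k) S"
    and nonneg: "\<And>k. 0 \<le> a k" "\<And>k. 0 \<le> b k"
  shows "(\<lambda>j. a j * b (k - j)) summable_on UNIV"
    and "l2_bound (\<lambda>k. W k * (\<Sum>\<^sub>\<infinity>j. a j * b (k - j))) (M * R * S)"
proof -
  define q where "q = (\<lambda>k j. (W j * a j) * (W (k - j) * b (k - j)))"
  have "R \<ge> 0" "S \<ge> 0" "M \<ge> 0"
    using a b K l2_bound_nonneg by blast+
  have b2: "(\<Sum>k\<in>F. (W (k - j) * b (k - j))\<^sup>2) \<le> S\<^sup>2" if "finite F" for F j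
  proof -
    have "l2_bound (\<lambda>k. W (k - j) * b (k - j)) S"
      by (rule l2_bound_inj[OF b]) (auto simp: inj_on_def)
    then show ?thesis
      using l2_boundD that \<open>S \<ge> 0\<close> by (auto simp: sum_square_le_iff_L2_set)
  qed
  have q: "l2_bound (q k) (R * S)" for k
  proof (rule l2_bound_mono)
    show "l2_bound (\<lambda>j. S * (W j * a j)) (R * S)"
      using l2_bound_scale[OF a, of S] \<open>S \<ge> 0\<close> by (simp add: mult.commute)
    show "\<bar>q k j\<bar> \<le> S * (W j * a j)" for j
    proof -
      have "\<bar>W (k - j) * b (k - j)\<bar> \<le> S"
        by (rule l2_bound_point[OF b])
      then have "\<bar>W j * a j\<bar> * \<bar>W (k - j) * b (k - j)\<bar> \<le> \<bar>W j * a j\<bar> * S"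
        by (rule mult_left_mono) simp
      then show ?thesis using W[of j] nonneg(1)[of j] by (simp add: q_def abs_mult mult_ac)
    qed
  qed simp
  have qsum: "(\<lambda>j. (q k j)\<^sup>2) summable_on UNIV" for k
    using l2_bound_square_summable(1)[OF q] .
  have ab: "W k * (a j * b (k - j)) = W k / (W j * W (k - j)) * q k j" for k j
    using W[of j] W[of "k - j"] by (simp add: q_def field_simps)
  have fin: "(\<Sum>j\<in>F. W k * (a j * b (k - j))) \<le> M * sqrt (\<Sum>\<^sub>\<infinity>j. (q k j)\<^sup>2)" if "finite F" for F k
  proof -
    have "(\<Sum>j\<in>F. W k * (a j * b (k - j))) \<le> (\<Sum>j\<in>F. \<bar>W k / (W j * W (k - j))\<bar> * \<bar>q k j\<bar>)"
      unfolding ab abs_mult[symmetric] by (intro sum_mono) (rule abs_ge_self)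
    also have "\<dots> \<le> L2_set (\<lambda>j. W k / (W j * W (k - j))) F * L2_set (q k) F"
      by (rule L2_set_mult_ineq)
    also have "\<dots> \<le> M * sqrt (\<Sum>\<^sub>\<infinity>j. (q k j)\<^sup>2)"
    proof (rule mult_mono)
      show "L2_set (q k) F \<le> sqrt (\<Sum>\<^sub>\<infinity>j. (q k j)\<^sup>2)"
        unfolding L2_set_def using qsum that by (auto intro: finite_sum_le_infsum)
    qed (use l2_boundD[OF K that] \<open>M \<ge> 0\<close> in auto)
    finally show ?thesis .
  qed
  have nn: "0 \<le> W k * (a j * b (k - j))" for k j
    using W[of k] nonneg by simp
  note conv = nonneg_summable_infsum_le[of "\<lambda>j. W k * (a j * b (k - j))" for k, OF nn fin]
  have summ: "(\<lambda>j. a j * b (k - j)) summable_on UNIV" for k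
    using conv(1)[of k] W[of k] by (simp add: summable_on_cmult_right')
  then show "(\<lambda>j. a j * b (k - j)) summable_on UNIV" .
  have le: "(W k * (\<Sum>\<^sub>\<infinity>j. a j * b (k - j)))\<^sup>2 \<le> M\<^sup>2 * (\<Sum>\<^sub>\<infinity>j. (q k j)\<^sup>2)" for k
  proof -
    have "W k * (\<Sum>\<^sub>\<infinity>j. a j * b (k - j)) \<le> M * sqrt (\<Sum>\<^sub>\<infinity>j. (q k j)\<^sup>2)"
      using conv(2)[of k] by (simp add: infsum_cmult_right summ)
    moreover have "0 \<le> W k * (\<Sum>\<^sub>\<infinity>j. a j * b (k - j))"
      using W[of k] nonneg by (intro mult_nonneg_nonneg infsum_nonneg) (auto simp: less_imp_le)
    ultimately have "(W k * (\<Sum>\<^sub>\<infinity>j. a j * b (k - j)))\<^sup>2 \<le> (M * sqrt (\<Sum>\<^sub>\<infinity>j. (q k j)\<^sup>2))\<^sup>2"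
      by (rule power_mono)
    then show ?thesis
      by (simp add: power_mult_distrib infsum_nonneg)
  qed
  show "l2_bound (\<lambda>k. W k * (\<Sum>\<^sub>\<infinity>j. a j * b (k - j))) (M * R * S)"
  proof (rule l2_boundI)
    fix F :: "'k set" assume F: "finite F"
    have "(\<Sum>k\<in>F. (W k * (\<Sum>\<^sub>\<infinity>j. a j * b (k - j)))\<^sup>2) \<le> (\<Sum>k\<in>F. M\<^sup>2 * (\<Sum>\<^sub>\<infinity>j. (q k j)\<^sup>2))"
      by (intro sum_mono le)
    \<comment> \<open>The order of summation is exchanged: for fixed \<open>j\<close> the sum over
      \<open>k\<close> only shifts \<open>b\<close> and costs S^2, and what remains is the weighted
      norm of \<open>a\<close>.\<close>
    also have "\<dots> = M\<^sup>2 * (\<Sum>\<^sub>\<infinity>j. \<Sum>k\<in>F. (q k j)\<^sup>2)"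
      by (subst summable_on_finite_sum(2)[OF F qsum]) (simp add: sum_distrib_left)
    also have "\<dots> \<le> M\<^sup>2 * (R\<^sup>2 * S\<^sup>2)"
    proof (rule mult_left_mono)
      have le: "(\<Sum>k\<in>F. (q k j)\<^sup>2) \<le> (W j * a j)\<^sup>2 * S\<^sup>2" for j
      proof -
        have "(\<Sum>k\<in>F. (q k j)\<^sup>2) = (W j * a j)\<^sup>2 * (\<Sum>k\<in>F. (W (k - j) * b (k - j))\<^sup>2)"
          by (simp add: q_def power_mult_distrib sum_distrib_left)
        then show ?thesis
          using b2[OF F, of j] by (simp add: mult_left_mono)
      qed
      have "(\<Sum>\<^sub>\<infinity>j. \<Sum>k\<in>F. (q k j)\<^sup>2) \<le> (\<Sum>\<^sub>\<infinity>j. (W j * a j)\<^sup>2 * S\<^sup>2)"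
        by (intro infsum_mono le summable_on_finite_sum(1) F summable_on_cmult_left qsum l2_bound_square_summable(1)[OF a])
      also have "\<dots> = (\<Sum>\<^sub>\<infinity>j. (W j * a j)\<^sup>2) * S\<^sup>2"
        by (intro infsum_cmult_left l2_bound_square_summable(1)[OF a])
      also have "\<dots> \<le> R\<^sup>2 * S\<^sup>2"
        by (intro mult_right_mono l2_bound_square_summable(2)[OF a]) auto
      finally show "(\<Sum>\<^sub>\<infinity>j. \<Sum>k\<in>F. (q k j)\<^sup>2) \<le> R\<^sup>2 * S\<^sup>2" .
    qed simp
    finally have "(\<Sum>k\<in>F. (W k * (\<Sum>\<^sub>\<infinity>j. a j * b (k - j)))\<^sup>2) \<le> (M * R * S)\<^sup>2"
      by (simp add: power_mult_distrib mult.assoc)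
    then show "L2_set (\<lambda>k. W k * (\<Sum>\<^sub>\<infinity>j. a j * b (k - j))) F \<le> M * R * S"
      by (subst (asm) sum_square_le_iff_L2_set) (use \<open>M \<ge> 0\<close> \<open>R \<ge> 0\<close> \<open>S \<ge> 0\<close> in auto)
  qed
qed

section \<open>Weights on the integer lattice\<close>

lemma japanese_ge_1: "1 \<le> japanese k"
  by (simp add: japanese_def)

lemma japanese_pos [simp]: "0 < japanese k"
  using japanese_ge_1[of k] by linarith

lemma japanese_nonneg [simp]: "0 \<le> japanese k"
  by (rule less_imp_le) simp

lemma japanese_neq_0 [simp]: "japanese k \<noteq> 0"
  using japanese_pos[of k] by linarith

lemma real_vec_simps:
  "real_vec (k + l) = real_vec k + real_vec l" "real_vec (k - l) = real_vec k - real_vec l"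
  "real_vec (- k) = - real_vec k" "real_vec 0 = 0"
  by (simp_all add: vec_eq_iff)

lemma japanese_triangle: "japanese k \<le> japanese j + japanese (k - j)"
proof -
  have "norm (real_vec k) \<le> norm (real_vec j) + norm (real_vec (k - j))"
    using norm_triangle_ineq[of "real_vec j" "real_vec (k - j)"] by (simp only: real_vec_simps) (simp only: add_diff_eq add_diff_cancel_left')
  then show ?thesis unfolding japanese_def by linarith
qed

lemma summable_int_powr:
  assumes "q > 1"
  shows "(\<lambda>t::int. max 1 \<bar>real_of_int t\<bar> powr (- q)) summable_on UNIV"
proof -
  let ?f = "\<lambda>t::int. max 1 \<bar>real_of_int t\<bar> powr (- q)"
  have "summable (\<lambda>n. real n powr (- q))"
    using assms by (simp add: summable_real_powr_iff)
  then have "summable (\<lambda>n. max 1 \<bar>real n\<bar> powr (- q))"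
    by (subst (asm) summable_Suc_iff[symmetric], subst summable_Suc_iff[symmetric]) simp
  then have nat: "(\<lambda>n. max 1 \<bar>real n\<bar> powr (- q)) summable_on UNIV"
    by (intro norm_summable_imp_summable_on) simp
  have "?f summable_on range int"
    using nat by (subst summable_on_reindex) (auto simp: o_def)
  moreover have "?f summable_on range (\<lambda>n. - int n)"
    using nat by (subst summable_on_reindex) (auto simp: o_def inj_on_def)
  ultimately have "?f summable_on (range int \<union> range (\<lambda>n. - int n))"
    by (rule summable_on_union)
  also have "range int \<union> range (\<lambda>n. - int n) = UNIV"
    by (auto simp: image_iff) (metis int_cases2)
  finally show ?thesis .
qed

text \<open>\<open>japanese k\<close> dominates \<open>max 1\<close> of each |k_i|. Splitting the
  exponent 2p into n equal parts q = 2p/n > 1 bounds the square by a product of one-dimensional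
  terms, each of which is summable over the integers.\<close>

lemma l2_bound_japanese:
  assumes "real CARD('n) < 2 * p"
  obtains M where "l2_bound (\<lambda>k :: int ^ 'n. japanese k powr (- p)) M"
proof -
  define q where "q = 2 * p / real CARD('n)"
  let ?f = "\<lambda>t::int. max 1 \<bar>real_of_int t\<bar> powr (- q)"
  define S where "S = infsum ?f UNIV"
  have q: "q > 1" using assms by (simp add: q_def field_simps)
  have S: "S \<ge> 0" unfolding S_def by (intro infsum_nonneg) auto
  have point: "(japanese k powr (- p))\<^sup>2 \<le> (\<Prod>i\<in>UNIV. ?f (k $ i))" for k :: "int ^ 'n"
  proof -
    have "(\<Prod>i\<in>(UNIV :: 'n set). japanese k powr (- q)) \<le> (\<Prod>i\<in>UNIV. ?f (k $ i))"
    proof (intro prod_mono conjI)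
      fix i :: 'n
      have "\<bar>real_of_int (k $ i)\<bar> \<le> norm (real_vec k)"
        using component_le_norm_cart[of "real_vec k" i] by simp
      then show "japanese k powr (- q) \<le> ?f (k $ i)"
        using q by (intro powr_mono2') (auto simp: japanese_def)
    qed auto
    moreover have "(\<Prod>i\<in>(UNIV :: 'n set). japanese k powr (- q)) = (japanese k powr (- p))\<^sup>2"
      by (simp add: powr_power q_def)
    ultimately show ?thesis by simp
  qed
  have "L2_set (\<lambda>k :: int ^ 'n. japanese k powr (- p)) F \<le> sqrt (S ^ CARD('n))" if F: "finite F" for F
  proof -
    define T where "T = (\<Union>i. (\<lambda>k. k $ i) ` F)"
    have T: "finite T" using F by (simp add: T_def)
    have "(\<Sum>k\<in>F. (japanese k powr (- p))\<^sup>2) \<le> (\<Sum>k\<in>F. \<Prod>i\<in>UNIV. ?f (k $ i))"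
      by (intro sum_mono point)
    \<comment> \<open>\<open>F\<close> is enlarged to a cube with side \<open>T\<close>, where the
      sum of products is a product of sums.\<close>
    also have "\<dots> \<le> (\<Sum>k\<in>vec_lambda ` (\<Pi>\<^sub>E i\<in>(UNIV :: 'n set). T). \<Prod>i\<in>UNIV. ?f (k $ i))"
    proof (rule sum_mono2)
      show "F \<subseteq> vec_lambda ` (\<Pi>\<^sub>E i\<in>(UNIV :: 'n set). T)"
      proof
        fix k assume "k \<in> F"
        then have "vec_nth k \<in> (\<Pi>\<^sub>E i\<in>(UNIV :: 'n set). T)" by (auto simp: T_def)
        then show "k \<in> vec_lambda ` (\<Pi>\<^sub>E i\<in>(UNIV :: 'n set). T)"
          by (metis image_eqI vec_nth_inverse)
      qed
    qed (use T in \<open>auto intro!: finite_imageI finite_PiE prod_nonneg\<close>)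
    also have "\<dots> = (\<Sum>k\<in>(\<Pi>\<^sub>E i\<in>(UNIV :: 'n set). T). \<Prod>i\<in>UNIV. ?f (k i))"
      by (subst sum.reindex) (auto simp: inj_on_def vec_lambda_inject)
    also have "\<dots> = (\<Prod>i\<in>(UNIV :: 'n set). \<Sum>t\<in>T. ?f t)"
      using T by (subst prod_sum_PiE) auto
    also have "\<dots> \<le> S ^ CARD('n)"
      unfolding S_def using finite_sum_le_infsum[OF summable_int_powr[OF q] T]
      by (auto intro!: power_mono sum_nonneg)
    finally show ?thesis
      by (simp add: L2_set_def)
  qed
  then show ?thesis
    using that l2_boundI by blast
qed

text \<open>\<open>japanese k\<close> is at most twice the larger of \<open>japanese j\<close> and
  \<open>japanese (k - j)\<close>, so its p-th power is at most 2^p times the sum of theirs.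
  Dividing leaves two copies of the square-summable weight, one of them reflected by j to k - j;
  this makes the bound uniform in \<open>k\<close>.\<close>

lemma japanese_kernel:
  assumes "l2_bound (\<lambda>k :: int ^ 'n. japanese k powr (- p)) M" and "p \<ge> 0"
  shows "l2_bound (\<lambda>j :: int ^ 'n. japanese k powr p / (japanese j powr p * japanese (k - j) powr p)) (2 powr p * (M + M))"
proof (rule l2_bound_mono)
  show "l2_bound (\<lambda>j :: int ^ 'n. 2 powr p * (japanese j powr (- p) + japanese (k - j) powr (- p))) (2 powr p * (M + M))"
    using l2_bound_scale[OF l2_bound_add[OF assms(1) l2_bound_inj[OF assms(1), of "\<lambda>j. k - j"]], of "2 powr p"]
    by (simp add: inj_on_def)
  fix j :: "int ^ 'n"
  let ?a = "japanese k" and ?b = "japanese j" and ?c = "japanese (k - j)"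
  have "?a powr p \<le> (2 * max ?b ?c) powr p"
    using japanese_triangle[of k j] assms(2) by (intro powr_mono2) (auto simp: less_imp_le)
  also have "\<dots> = 2 powr p * max ?b ?c powr p"
    by (rule powr_mult)
  also have "max ?b ?c powr p \<le> ?b powr p + ?c powr p"
    by (auto simp: max_def)
  finally have "?a powr p \<le> 2 powr p * (?b powr p + ?c powr p)" by simp
  then have "?a powr p / (?b powr p * ?c powr p) \<le> 2 powr p * (?b powr p + ?c powr p) / (?b powr p * ?c powr p)"
    by (intro divide_right_mono) auto
  also have "\<dots> = 2 powr p * (?b powr (- p) + ?c powr (- p))"
    by (simp add: powr_minus field_simps)
  finally show "\<bar>?a powr p / (?b powr p * ?c powr p)\<bar> \<le> 2 powr p * (?b powr (- p) + ?c powr (- p))"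
    by simp
qed simp

type_synonym ('v, 'd) freq = "(int ^ 'v) \<times> (int ^ 'd)"

definition weight :: "real \<Rightarrow> real \<Rightarrow> ('v::finite, 'd::finite) freq \<Rightarrow> real" where
  "weight \<rho> \<sigma> k = japanese (fst k) powr \<rho> * japanese (snd k) powr \<sigma>"

lemma weight_pos [simp]: "0 < weight \<rho> \<sigma> k"
  by (simp add: weight_def)

lemma weight_nonneg [simp]: "0 \<le> weight \<rho> \<sigma> k"
  by (rule less_imp_le) simp

lemma weight_add: "weight \<rho> \<sigma> k * weight \<rho>' \<sigma>' k = weight (\<rho> + \<rho>') (\<sigma> + \<sigma>') k"
  by (simp add: weight_def powr_add)

lemma weight_mono: "\<rho> \<le> \<rho>' \<Longrightarrow> \<sigma> \<le> \<sigma>' \<Longrightarrow> weight \<rho> \<sigma> k \<le> weight \<rho>' \<sigma>' k"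
  unfolding weight_def by (intro mult_mono powr_mono japanese_ge_1) auto

lemma l2_bound_weight:
  assumes "real CARD('v) < 2 * \<rho>" "real CARD('d) < 2 * \<sigma>"
  obtains M where "l2_bound (weight (- \<rho>) (- \<sigma>) :: ('v::finite, 'd::finite) freq \<Rightarrow> real) M"
proof -
  obtain M1 where "l2_bound (\<lambda>k :: int ^ 'v. japanese k powr (- \<rho>)) M1"
    using l2_bound_japanese assms(1) by blast
  moreover obtain M2 where "l2_bound (\<lambda>k :: int ^ 'd. japanese k powr (- \<sigma>)) M2"
    using l2_bound_japanese assms(2) by blast
  ultimately have "l2_bound (\<lambda>(l :: int ^ 'v, k :: int ^ 'd). japanese l powr (- \<rho>) * japanese k powr (- \<sigma>)) (M1 * M2)"
    by (rule l2_bound_product)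
  then show ?thesis
    by (intro that[of "M1 * M2"]) (simp add: weight_def[abs_def] case_prod_unfold)
qed

text \<open>The kernel is the product of the kernels in the two frequency variables, so each
  exponent only has to exceed half of its own dimension.\<close>

lemma weight_kernel:
  assumes "real CARD('v) < 2 * \<rho>" "real CARD('d) < 2 * \<sigma>"
  obtains M where "\<And>k :: ('v::finite, 'd::finite) freq. l2_bound (\<lambda>j. weight \<rho> \<sigma> k / (weight \<rho> \<sigma> j * weight \<rho> \<sigma> (k - j))) M"
proof -
  obtain M1 where M1: "l2_bound (\<lambda>k :: int ^ 'v. japanese k powr (- \<rho>)) M1"
    using l2_bound_japanese assms(1) by blast
  obtain M2 where M2: "l2_bound (\<lambda>k :: int ^ 'd. japanese k powr (- \<sigma>)) M2"
    using l2_bound_japanese assms(2) by blast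
  have "\<rho> \<ge> 0" "\<sigma> \<ge> 0" using assms by (auto intro: less_imp_le order.strict_trans1[rotated])
  from l2_bound_product[OF japanese_kernel[OF M1 \<open>\<rho> \<ge> 0\<close>] japanese_kernel[OF M2 \<open>\<sigma> \<ge> 0\<close>]]
  show ?thesis
    by (intro that) (simp add: weight_def case_prod_unfold mult_ac)
qed

text \<open>The contraction principle on a ball of weighted l2, with iterates starting at 0 and
  converging coefficientwise. The norm is represented by its upper bounds, whence the quantified
  \<delta> in the contraction hypothesis. \<open>Q\<close> is any property that \<open>T\<close>
  preserves on the ball and that survives coefficientwise limits; it will be the reality of the
  field.\<close>

lemma picard_l2:
  fixes T :: "('k \<Rightarrow> 'b::banach) \<Rightarrow> 'k \<Rightarrow> 'b" and W :: "'k \<Rightarrow> real"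
  assumes W: "\<And>k. 0 < W k" and R: "0 \<le> R"
    and ball: "\<And>A. l2_bound (\<lambda>k. W k * norm (A k)) R \<Longrightarrow> l2_bound (\<lambda>k. W k * norm (T A k)) R"
    and contraction: "\<And>A B \<delta>. l2_bound (\<lambda>k. W k * norm (A k)) R \<Longrightarrow> l2_bound (\<lambda>k. W k * norm (B k)) R \<Longrightarrow>
      l2_bound (\<lambda>k. W k * norm (A k - B k)) \<delta> \<Longrightarrow> l2_bound (\<lambda>k. W k * norm (T A k - T B k)) (\<delta> / 2)"
    and Q: "Q (\<lambda>k. 0)" "\<And>A. l2_bound (\<lambda>k. W k * norm (A k)) R \<Longrightarrow> Q A \<Longrightarrow> Q (T A)"
      "\<And>X A. (\<And>n. Q (X n)) \<Longrightarrow> (\<And>k. (\<lambda>n. X n k) \<longlonglongrightarrow> A k) \<Longrightarrow> Q A"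
  obtains A where "l2_bound (\<lambda>k. W k * norm (A k)) R" "T A = A" "Q A"
proof -
  define X where "X n = (T ^^ n) (\<lambda>k. 0)" for n
  have X_Suc: "X (Suc n) = T (X n)" for n by (simp add: X_def)
  have XR: "l2_bound (\<lambda>k. W k * norm (X n k)) R" for n
    by (induction n) (auto simp: X_Suc ball, simp add: X_def R l2_bound_zero)
  have XQ: "Q (X n)" for n
    by (induction n) (auto simp: X_Suc Q XR, simp add: X_def Q)
  have step: "l2_bound (\<lambda>k. W k * norm (X (Suc n) k - X n k)) (R / 2 ^ n)" for n
  proof (induction n)
    case 0
    then show ?case using XR[of 1] by (simp add: X_def)
  next
    case (Suc n)
    then show ?case
      using contraction[OF XR XR Suc.IH] by (simp add: X_Suc mult.commute)
  qed
  have far: "l2_bound (\<lambda>k. W k * norm (X (n + m) k - X n k)) (2 * R / 2 ^ n)" for n m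
  proof -
    have 1: "l2_bound (\<lambda>k. W k * norm (X (n + m) k - X n k)) (\<Sum>i<m. R / 2 ^ (n + i))"
    proof (induction m)
      case (Suc m)
      show ?case
      proof (rule l2_bound_mono[OF l2_bound_add[OF Suc.IH step[of "n + m"]]])
        fix k
        have "norm (X (n + Suc m) k - X n k) \<le> norm (X (n + m) k - X n k) + norm (X (Suc (n + m)) k - X (n + m) k)"
          using norm_triangle_ineq[of "X (n + m) k - X n k" "X (Suc (n + m)) k - X (n + m) k"] by simp
        then have "W k * norm (X (n + Suc m) k - X n k) \<le>
            W k * (norm (X (n + m) k - X n k) + norm (X (Suc (n + m)) k - X (n + m) k))"
          by (rule mult_left_mono) (simp add: W less_imp_le)
        then show "\<bar>W k * norm (X (n + Suc m) k - X n k)\<bar> \<le>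
            W k * norm (X (n + m) k - X n k) + W k * norm (X (Suc (n + m)) k - X (n + m) k)"
          using W[of k] by (simp add: abs_mult distrib_left)
      qed simp
    qed (simp add: l2_bound_zero)
    have 2: "(\<Sum>i<m. R / 2 ^ (n + i)) \<le> 2 * R / 2 ^ n"
    proof -
      have "(\<Sum>i<m. R / 2 ^ (n + i)) = R / 2 ^ n * (\<Sum>i<m. (1/2) ^ i)"
        unfolding sum_distrib_left by (intro sum.cong refl) (simp add: power_add power_divide)
      also have "(\<Sum>i<m. (1/2) ^ i) \<le> (2 :: real)"
        by (simp add: sum_gp_strict)
      then have "R / 2 ^ n * (\<Sum>i<m. (1/2) ^ i) \<le> R / 2 ^ n * 2"
        using R by (intro mult_left_mono) auto
      finally show ?thesis by (simp add: mult.commute)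
    qed
    show ?thesis
      by (rule l2_bound_mono[OF 1 _ 2]) (use W in \<open>auto simp: abs_mult less_imp_le\<close>)
  qed
  have tend: "(\<lambda>n. c / 2 ^ n) \<longlonglongrightarrow> 0" for c :: real
    by (rule LIMSEQ_divide_realpow_zero) simp
  have "convergent (\<lambda>n. X n k)" for k
  proof -
    have "Cauchy (\<lambda>n. X n k)"
    proof (rule metric_CauchyI)
      fix e :: real assume "e > 0"
      then have "\<forall>\<^sub>F n in sequentially. 2 * R / W k / 2 ^ n < e"
        using order_tendstoD(2)[OF tend] by blast
      then obtain N where N: "\<And>n. n \<ge> N \<Longrightarrow> 2 * R / W k / 2 ^ n < e"
        by (auto simp: eventually_sequentially)
      have "dist (X (n + m) k) (X n k) < e" if "n \<ge> N" for n m
      proof -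
        have "W k * norm (X (n + m) k - X n k) \<le> 2 * R / 2 ^ n"
          using l2_bound_point[OF far, of k n m] W[of k] by (simp add: abs_mult)
        then have "norm (X (n + m) k - X n k) \<le> 2 * R / W k / 2 ^ n"
          using W[of k] by (simp add: field_simps)
        then show ?thesis using N[OF that] by (simp add: dist_norm)
      qed
      then show "\<exists>M. \<forall>m\<ge>M. \<forall>n\<ge>M. dist (X m k) (X n k) < e"
        by (metis dist_commute le_Suc_ex nle_le)
    qed
    then show ?thesis by (rule Cauchy_convergent)
  qed
  then obtain A where A: "\<And>k. (\<lambda>n. X n k) \<longlonglongrightarrow> A k"
    unfolding convergent_def by metis
  have AR: "l2_bound (\<lambda>k. W k * norm (A k)) R"
    by (rule l2_bound_limit[where A = "\<lambda>n k. W k * norm (X n k)", OF XR]) (intro tendsto_intros A)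
  have close: "l2_bound (\<lambda>k. W k * norm (A k - X n k)) (2 * R / 2 ^ n)" for n
  proof (rule l2_bound_limit[where A = "\<lambda>m k. W k * norm (X (n + m) k - X n k)", OF far])
    show "(\<lambda>m. W k * norm (X (n + m) k - X n k)) \<longlonglongrightarrow> W k * norm (A k - X n k)" for k
      using LIMSEQ_ignore_initial_segment[OF A, of n k] by (intro tendsto_intros) (simp add: add.commute)
  qed
  \<comment> \<open>The iterates tend to \<open>A\<close>, and also to \<open>T A\<close>, since
    \<open>T\<close> halves the distance between \<open>A\<close> and \<open>X n\<close>.\<close>
  have "T A k = A k" for k
  proof -
    have "(\<lambda>n. X (Suc n) k) \<longlonglongrightarrow> T A k"
    proof (rule LIM_zero_cancel, rule Lim_null_comparison)
      show "\<forall>\<^sub>F n in sequentially. norm (X (Suc n) k - T A k) \<le> R / W k / 2 ^ n"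
      proof (rule always_eventually, rule allI)
        fix n
        have "W k * norm (T A k - X (Suc n) k) \<le> R / 2 ^ n"
          using l2_bound_point[OF contraction[OF AR XR close], of k n] W[of k] by (simp add: abs_mult X_Suc)
        then show "norm (X (Suc n) k - T A k) \<le> R / W k / 2 ^ n"
          using W[of k] by (simp add: field_simps norm_minus_commute)
      qed
    qed (rule tend)
    moreover have "(\<lambda>n. X (Suc n) k) \<longlonglongrightarrow> A k"
      using A by (rule LIMSEQ_Suc)
    ultimately show ?thesis by (rule LIMSEQ_unique)
  qed
  then have "T A = A" by auto
  then show ?thesis by (rule that[OF AR _ Q(3)[OF XQ A]])
qed

subsection \<open>The equation for the Fourier coefficients\<close>

definition xi_dot :: "int ^ 'd \<Rightarrow> complex ^ 'd \<Rightarrow> complex" where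
  "xi_dot \<xi> v = (\<Sum>j\<in>UNIV. of_int (\<xi> $ j) * v $ j)"

definition cvec :: "int ^ 'd \<Rightarrow> complex ^ 'd" where
  "cvec \<xi> = (\<chi> j. of_int (\<xi> $ j))"

definition vcnj :: "complex ^ 'd \<Rightarrow> complex ^ 'd" where
  "vcnj v = (\<chi> j. cnj (v $ j))"

text \<open>The Fourier symbol of the projection onto divergence-free fields. At \<xi> = 0 the
  division by zero makes it the identity, as it should be on constant fields.\<close>

definition leray :: "int ^ 'd \<Rightarrow> complex ^ 'd \<Rightarrow> complex ^ 'd" where
  "leray \<xi> v = v - (xi_dot \<xi> v / of_real ((norm (real_vec \<xi>))\<^sup>2)) *s cvec \<xi>"

text \<open>The symbol of \<omega> \<bullet> \<partial>_\<phi> - \<Delta>, that is, of the heat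
  operator acting on functions of the form U(\<omega>t, x).\<close>

definition heat_symbol :: "real ^ 'v \<Rightarrow> ('v::finite, 'd::finite) freq \<Rightarrow> complex" where
  "heat_symbol \<omega> k = \<i> * of_real (\<omega> \<bullet> real_vec (fst k)) + of_real ((norm (real_vec (snd k)))\<^sup>2)"

text \<open>Up to the factor \<open>\<i>\<close>, the coefficients of div (a \<otimes> b), which
  equals a \<bullet> \<nabla>b for divergence-free \<open>a\<close>. Using the output frequency
  \<open>snd k\<close> instead of \<open>snd (k - j)\<close> puts the lost derivative outside the
  sum and makes the term vanish at \<xi> = 0.\<close>

definition conv :: "(('v::finite, 'd::finite) freq \<Rightarrow> complex ^ 'd) \<Rightarrow> (('v, 'd) freq \<Rightarrow> complex ^ 'd) \<Rightarrow> ('v, 'd) freq \<Rightarrow> complex ^ 'd" where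
  "conv A B k = (\<Sum>\<^sub>\<infinity>j. xi_dot (snd k) (A j) *s B (k - j))"

lemma norm_smult_vec: "norm (c *s v) = cmod c * norm (v :: complex ^ 'd)"
  by (simp add: norm_vec_def norm_mult L2_set_right_distrib)

lemma norm_cvec: "norm (cvec \<xi>) = norm (real_vec \<xi>)"
  by (simp add: norm_vec_def cvec_def)

lemma xi_dot_add: "xi_dot \<xi> (v + w) = xi_dot \<xi> v + xi_dot \<xi> w"
  by (simp add: xi_dot_def distrib_left sum.distrib)

lemma xi_dot_diff: "xi_dot \<xi> (v - w) = xi_dot \<xi> v - xi_dot \<xi> w"
  by (simp add: xi_dot_def right_diff_distrib sum_subtractf)

lemma xi_dot_smult: "xi_dot \<xi> (c *s v) = c * xi_dot \<xi> v"
  by (simp add: xi_dot_def sum_distrib_left mult_ac)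

lemma xi_dot_0 [simp]: "xi_dot 0 v = 0"
  by (simp add: xi_dot_def)

lemma xi_dot_cvec: "xi_dot \<xi> (cvec \<xi>) = of_real ((norm (real_vec \<xi>))\<^sup>2)"
  by (simp add: xi_dot_def cvec_def norm_vec_def L2_set_def sum_nonneg power2_eq_square)

lemma norm_xi_dot: "cmod (xi_dot \<xi> v) \<le> norm (real_vec \<xi>) * norm v"
proof -
  have "cmod (xi_dot \<xi> v) \<le> (\<Sum>j\<in>UNIV. \<bar>norm (real_vec \<xi> $ j)\<bar> * \<bar>norm (v $ j)\<bar>)"
    unfolding xi_dot_def by (rule sum_norm_le) (simp add: norm_mult)
  also have "\<dots> \<le> norm (real_vec \<xi>) * norm v"
    unfolding norm_vec_def by (rule L2_set_mult_ineq)
  finally show ?thesis .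
qed

lemma real_vec_eq_0_iff [simp]: "real_vec \<xi> = 0 \<longleftrightarrow> \<xi> = 0"
  by (simp add: vec_eq_iff)

lemma norm_real_vec_ge_1: "\<xi> \<noteq> 0 \<Longrightarrow> 1 \<le> norm (real_vec \<xi>)"
proof -
  assume "\<xi> \<noteq> 0"
  then obtain i where "\<xi> $ i \<noteq> 0" by (auto simp: vec_eq_iff)
  then have "1 \<le> \<bar>real_vec \<xi> $ i\<bar>" by simp
  then show ?thesis using component_le_norm_cart[of "real_vec \<xi>" i] by linarith
qed

lemma japanese_eq_norm: "\<xi> \<noteq> 0 \<Longrightarrow> japanese \<xi> = norm (real_vec \<xi>)"
  using norm_real_vec_ge_1[of \<xi>] by (simp add: japanese_def)

text \<open>The removed component has norm at most that of \<open>v\<close>, and the triangle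
  inequality gives the factor 2. The sharp constant 1 would only improve later constants.\<close>

lemma norm_leray: "norm (leray \<xi> v) \<le> 2 * norm v"
proof (cases "\<xi> = 0")
  case False
  then have n: "norm (real_vec \<xi>) > 0" by simp
  have "norm ((xi_dot \<xi> v / of_real ((norm (real_vec \<xi>))\<^sup>2)) *s cvec \<xi>) = cmod (xi_dot \<xi> v) / norm (real_vec \<xi>)"
    using n by (simp add: norm_smult_vec norm_cvec norm_divide norm_power) (simp add: power2_eq_square)
  also have "\<dots> \<le> norm v"
    using norm_xi_dot[of \<xi> v] n by (simp add: divide_le_eq mult.commute)
  finally show ?thesis
    unfolding leray_def
    using norm_triangle_ineq4[of v "(xi_dot \<xi> v / of_real ((norm (real_vec \<xi>))\<^sup>2)) *s cvec \<xi>"] by linarith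
qed (simp add: leray_def)

lemma xi_dot_leray: "xi_dot \<xi> (leray \<xi> v) = 0"
  by (cases "\<xi> = 0") (simp_all add: leray_def xi_dot_diff xi_dot_smult xi_dot_cvec)

lemma leray_diff: "leray \<xi> (v - w) = leray \<xi> v - leray \<xi> w"
  by (simp add: leray_def xi_dot_diff diff_divide_distrib vector_sub_rdistrib)

lemma leray_add: "leray \<xi> (v + w) = leray \<xi> v + leray \<xi> w"
  by (simp add: leray_def xi_dot_add add_divide_distrib vector_sadd_rdistrib)

lemma leray_smult: "leray \<xi> (c *s v) = c *s leray \<xi> v"
  by (simp add: leray_def xi_dot_smult vector_ssub_ldistrib)

lemma leray_vcnj: "leray (- \<xi>) (vcnj v) = vcnj (leray \<xi> v)"
proof -
  have "norm (real_vec (- \<xi>)) = norm (real_vec \<xi>)"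
    by (simp only: real_vec_simps norm_minus_cancel)
  then show ?thesis
    by (simp add: leray_def vcnj_def xi_dot_def cvec_def vec_eq_iff sum_negf)
qed

lemma norm_heat_symbol: "(norm (real_vec (snd k)))\<^sup>2 \<le> cmod (heat_symbol \<omega> k)"
  using abs_Re_le_cmod[of "heat_symbol \<omega> k"] by (simp add: heat_symbol_def)

lemma heat_symbol_uminus: "heat_symbol \<omega> (- k) = cnj (heat_symbol \<omega> k)"
  unfolding heat_symbol_def fst_uminus snd_uminus real_vec_simps norm_minus_cancel by simp

lemma conv_zero: "snd k = 0 \<Longrightarrow> conv A B k = 0"
  by (simp add: conv_def)

text \<open>The nonlinear estimates use the weight only through the kernel bound that makes weighted
  l2 an algebra. The solution is built with \<open>weight \<rho> (s + 1)\<close>.\<close>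

locale convolution_algebra =
  fixes W :: "('v::finite, 'd::finite) freq \<Rightarrow> real" and M :: real
  assumes W_pos: "0 < W k"
    and kernel: "l2_bound (\<lambda>j. W k / (W j * W (k - j))) M"
begin

abbreviation bnd :: "(('v, 'd) freq \<Rightarrow> complex ^ 'd) \<Rightarrow> real \<Rightarrow> bool" where
  "bnd A R \<equiv> l2_bound (\<lambda>k. W k * norm (A k)) R"

lemmas norm_convolution = weighted_convolution[OF W_pos kernel, where a = "\<lambda>k. norm (A k)" and b = "\<lambda>k. norm (B k)" for A B,
    OF _ _ norm_ge_zero norm_ge_zero]

lemma conv_term_le:
  "norm (xi_dot (snd k) (A j) *s B (k - j)) \<le> norm (real_vec (snd k)) * (norm (A j) * norm (B (k - j)))"
  using mult_right_mono[OF norm_xi_dot[of "snd k" "A j"] norm_ge_zero[of "B (k - j)"]]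
  by (simp add: norm_smult_vec mult.assoc)

lemma conv_summable:
  assumes "bnd A R" "bnd B S"
  shows "(\<lambda>j. norm (xi_dot (snd k) (A j) *s B (k - j))) summable_on UNIV"
  by (rule Infinite_Sum.abs_summable_on_comparison_test'[OF summable_on_cmult_right[OF norm_convolution(1)[OF assms]]])
     (rule conv_term_le)

lemma norm_conv_le:
  assumes "bnd A R" "bnd B S"
  shows "norm (conv A B k) \<le> norm (real_vec (snd k)) * (\<Sum>\<^sub>\<infinity>j. norm (A j) * norm (B (k - j)))"
proof -
  have "norm (conv A B k) \<le> (\<Sum>\<^sub>\<infinity>j. norm (xi_dot (snd k) (A j) *s B (k - j)))"
    unfolding conv_def by (rule norm_infsum_bound[OF conv_summable[OF assms]])
  also have "\<dots> \<le> (\<Sum>\<^sub>\<infinity>j. norm (real_vec (snd k)) * (norm (A j) * norm (B (k - j))))"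
    by (intro infsum_mono conv_summable[OF assms] summable_on_cmult_right norm_convolution(1)[OF assms] conv_term_le)
  also have "\<dots> = norm (real_vec (snd k)) * (\<Sum>\<^sub>\<infinity>j. norm (A j) * norm (B (k - j)))"
    by (rule infsum_cmult_right')
  finally show ?thesis .
qed

lemma conv_diff:
  assumes A: "bnd A R" and B: "bnd B S" and D: "bnd (\<lambda>k. A k - B k) \<delta>"
  shows "conv A A k - conv B B k = conv A (\<lambda>k. A k - B k) k + conv (\<lambda>k. A k - B k) B k"
proof -
  note summ = abs_summable_summable[OF conv_summable]
  have "conv A (\<lambda>k. A k - B k) k + conv (\<lambda>k. A k - B k) B k + conv B B k = conv A A k"
    unfolding conv_def
    by (subst infsum_add[symmetric], (intro summ[OF A D] summ[OF D B] summ[OF B B] summable_on_add)+)+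
       (simp add: xi_dot_diff vec_eq_iff algebra_simps)
  then show ?thesis by (metis add_diff_cancel_right')
qed

definition quad :: "real ^ 'v \<Rightarrow> (('v, 'd) freq \<Rightarrow> complex ^ 'd) \<Rightarrow> (('v, 'd) freq \<Rightarrow> complex ^ 'd) \<Rightarrow> ('v, 'd) freq \<Rightarrow> complex ^ 'd" where
  "quad \<omega> A B k = (\<i> / heat_symbol \<omega> k) *s leray (snd k) (conv A B k)"

text \<open>Where \<xi> \<noteq> 0 the factor |\<xi>| of the convolution is absorbed by the symbol,
  since |\<xi>| \<le> |\<xi>|^2; at \<xi> = 0 the convolution vanishes, so no small divisor enters.
  The factor 2 is that of \<open>norm_leray\<close>.\<close>

lemma quad_bound:
  assumes "bnd A R" "bnd B S"
  shows "bnd (quad \<omega> A B) (2 * (M * R * S))"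
proof (rule l2_bound_mono[OF l2_bound_scale[OF norm_convolution(2)[OF assms], of 2]])
  fix k
  let ?S = "\<Sum>\<^sub>\<infinity>j. norm (A j) * norm (B (k - j))"
  have "?S \<ge> 0" by (intro infsum_nonneg) simp
  have "norm (quad \<omega> A B k) \<le> 2 * ?S"
  proof (cases "snd k = 0")
    case True
    then show ?thesis using \<open>?S \<ge> 0\<close> by (simp add: quad_def conv_zero leray_def)
  next
    case False
    let ?n = "norm (real_vec (snd k))"
    have n: "1 \<le> ?n" using norm_real_vec_ge_1[OF False] .
    have "?n \<le> ?n\<^sup>2" using mult_left_mono[OF n, of ?n] by (simp add: power2_eq_square)
    with n norm_heat_symbol[of k \<omega>] have h: "0 < cmod (heat_symbol \<omega> k)" "?n \<le> cmod (heat_symbol \<omega> k)" by linarith+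
    have "norm (quad \<omega> A B k) \<le> (1 / cmod (heat_symbol \<omega> k)) * (2 * (?n * ?S))"
      unfolding quad_def norm_smult_vec norm_divide norm_ii
      by (rule mult_left_mono[OF order_trans[OF norm_leray]]) (use norm_conv_le[OF assms, of k] in auto)
    also have "\<dots> \<le> (1 / ?n) * (2 * (?n * ?S))"
    proof (rule mult_right_mono)
      show "1 / cmod (heat_symbol \<omega> k) \<le> 1 / ?n"
        using n h by (intro divide_left_mono mult_pos_pos) linarith+
    qed (use \<open>?S \<ge> 0\<close> in simp)
    also have "\<dots> = 2 * ?S" using False by simp
    finally show ?thesis .
  qed
  then have "W k * norm (quad \<omega> A B k) \<le> W k * (2 * ?S)"
    using W_pos[of k] by (intro mult_left_mono) auto
  then show "\<bar>W k * norm (quad \<omega> A B k)\<bar> \<le> 2 * (W k * ?S)"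
    using W_pos[of k] by (simp add: abs_mult)
qed simp

text \<open>Reflect the summation index. The sign comes from the frequency in \<open>xi_dot\<close>;
  the factor \<open>\<i>\<close> in the equation turns it into the symmetry of a real field.\<close>

lemma conv_vcnj:
  assumes A: "bnd A R" and sym: "\<And>k. A (- k) = vcnj (A k)"
  shows "conv A A (- k) = - vcnj (conv A A k)"
proof -
  have bl: "bounded_linear vcnj"
    unfolding vcnj_def
    by (intro bounded_linear_intros linear_conv_bounded_linear[THEN iffD1] linearI)
       (simp_all add: vec_eq_iff)
  have "conv A A (- k) = (\<Sum>\<^sub>\<infinity>j. xi_dot (snd (- k)) (A (- j)) *s A (- k - (- j)))"
    unfolding conv_def by (rule infsum_reindex_bij_betw[symmetric]) (auto intro: bij_uminus)
  also have "\<dots> = (\<Sum>\<^sub>\<infinity>j. - vcnj (xi_dot (snd k) (A j) *s A (k - j)))"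
  proof (rule infsum_cong)
    fix j
    have "A (- k - - j) = vcnj (A (k - j))"
      using sym[of "k - j"] by simp
    then show "xi_dot (snd (- k)) (A (- j)) *s A (- k - - j) = - vcnj (xi_dot (snd k) (A j) *s A (k - j))"
      by (simp add: sym vcnj_def xi_dot_def vec_eq_iff sum_negf)
  qed
  also have "\<dots> = - vcnj (conv A A k)"
    unfolding conv_def infsum_uminus
    using has_sum_bounded_linear[OF bl has_sum_infsum[OF abs_summable_summable[OF conv_summable[OF A A]]], of k]
    by (simp add: o_def infsumI)
  finally show ?thesis .
qed

text \<open>
  The symbol may vanish where \<open>\<xi> = 0\<close>. Division by zero then sets the coefficient of \<open>A\<close> to \<open>0\<close>, which
  solves the equation since \<open>F\<close> is assumed to vanish there.
\<close>

theorem stationary_coefficients: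
  fixes F :: "('v, 'd) freq \<Rightarrow> complex ^ 'd" and \<omega> :: "real ^ 'v"
  assumes lin: "bnd (\<lambda>k. (1 / heat_symbol \<omega> k) *s leray (snd k) (F k)) R"
    and small: "16 * (M * R) \<le> 1"
    and sym: "\<And>k. F (- k) = vcnj (F k)"
    and res: "\<And>k. heat_symbol \<omega> k = 0 \<Longrightarrow> F k = 0"
  obtains A P where "bnd A (2 * R)" "\<And>k. A (- k) = vcnj (A k)" "\<And>k. P (- k) = cnj (P k)"
    "\<And>k. xi_dot (snd k) (A k) = 0"
    "\<And>k. heat_symbol \<omega> k *s A k + \<i> *s conv A A k + (\<i> * P k) *s cvec (snd k) = F k"
    "\<And>k. snd k = 0 \<Longrightarrow> A k = (1 / heat_symbol \<omega> k) *s F k" "\<And>k. snd k = 0 \<Longrightarrow> P k = 0"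
    "\<And>k. cmod (P k) * norm (real_vec (snd k)) \<le> norm (F k) + norm (conv A A k)"
proof -
  \<comment> \<open>A fixed point solves the projected equation; the pressure is recovered
    afterwards from what the projection discards.\<close>
  define T where "T A k = (1 / heat_symbol \<omega> k) *s leray (snd k) (F k - \<i> *s conv A A k)" for A k
  have T: "T A k = (1 / heat_symbol \<omega> k) *s leray (snd k) (F k) - quad \<omega> A A k" for A k
    by (simp add: T_def quad_def leray_diff leray_smult vec_eq_iff diff_divide_distrib)
  have R: "0 \<le> R" using l2_bound_nonneg[OF lin] .
  have diff: "quad \<omega> A A k - quad \<omega> B B k = quad \<omega> A (\<lambda>k. A k - B k) k + quad \<omega> (\<lambda>k. A k - B k) B k"
    if "bnd A S" "bnd B S'" "bnd (\<lambda>k. A k - B k) \<delta>" for A B S S' \<delta> k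
  proof -
    have "leray (snd k) (conv A A k) - leray (snd k) (conv B B k) =
        leray (snd k) (conv A (\<lambda>k. A k - B k) k) + leray (snd k) (conv (\<lambda>k. A k - B k) B k)"
      by (simp only: leray_diff[symmetric] leray_add[symmetric] conv_diff[OF that])
    then show ?thesis
      unfolding quad_def vector_ssub_ldistrib[symmetric] vector_add_ldistrib[symmetric] by simp
  qed
  obtain A where A: "bnd A (2 * R)" "T A = A" "\<forall>k. A (- k) = vcnj (A k)"
  proof (rule picard_l2[where W = W and R = "2 * R" and T = T and Q = "\<lambda>A. \<forall>k. A (- k) = vcnj (A k)"])
    fix A assume A: "bnd A (2 * R)"
    show "bnd (T A) (2 * R)"
    proof (rule l2_bound_mono[OF l2_bound_add[OF lin quad_bound[OF A A]]])
      fix k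
      show "\<bar>W k * norm (T A k)\<bar> \<le> W k * norm ((1 / heat_symbol \<omega> k) *s leray (snd k) (F k)) + W k * norm (quad \<omega> A A k)"
        using mult_left_mono[OF norm_triangle_ineq4[of "(1 / heat_symbol \<omega> k) *s leray (snd k) (F k)" "quad \<omega> A A k"], of "W k"]
          W_pos[of k] by (simp add: T abs_mult distrib_left)
      \<comment> \<open>The quadratic part is at most 8 M R^2, and \<open>small\<close> bounds this
        by R / 2.\<close>
      show "R + 2 * (M * (2 * R) * (2 * R)) \<le> 2 * R"
        using mult_right_mono[OF small R] R by (simp add: algebra_simps)
    qed
    show "\<forall>k. T A (- k) = vcnj (T A k)" if "\<forall>k. A (- k) = vcnj (A k)"
    proof
      fix k
      have "F (- k) - \<i> *s conv A A (- k) = vcnj (F k - \<i> *s conv A A k)"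
        using conv_vcnj[OF A, of k] that sym[of k] by (simp add: vcnj_def vec_eq_iff)
      then show "T A (- k) = vcnj (T A k)"
        by (simp add: T_def heat_symbol_uminus leray_vcnj) (simp add: vcnj_def vec_eq_iff)
    qed
  next
    fix A B \<delta> assume AB: "bnd A (2 * R)" "bnd B (2 * R)" "bnd (\<lambda>k. A k - B k) \<delta>"
    show "bnd (\<lambda>k. T A k - T B k) (\<delta> / 2)"
    proof (rule l2_bound_mono[OF l2_bound_add[OF quad_bound[OF AB(1,3)] quad_bound[OF AB(3,2)]]])
      fix k
      have "T A k - T B k = - (quad \<omega> A (\<lambda>k. A k - B k) k + quad \<omega> (\<lambda>k. A k - B k) B k)"
        unfolding T diff[OF AB, of k, symmetric] by simp
      then have "norm (T A k - T B k) \<le> norm (quad \<omega> A (\<lambda>k. A k - B k) k) + norm (quad \<omega> (\<lambda>k. A k - B k) B k)"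
        by (simp only: norm_minus_cancel norm_triangle_ineq)
      then show "\<bar>W k * norm (T A k - T B k)\<bar> \<le> W k * norm (quad \<omega> A (\<lambda>k. A k - B k) k) + W k * norm (quad \<omega> (\<lambda>k. A k - B k) B k)"
        using W_pos[of k] by (simp add: abs_mult flip: distrib_left)
      have "\<delta> \<ge> 0" using l2_bound_nonneg[OF AB(3)] .
      \<comment> \<open>Both terms together give 8 M R \<delta>. Halving the distance is what fixes
        the constant 16 in \<open>small\<close>.\<close>
      then show "2 * (M * (2 * R) * \<delta>) + 2 * (M * \<delta> * (2 * R)) \<le> \<delta> / 2"
        using mult_right_mono[OF small, of \<delta>] by (simp add: algebra_simps)
    qed
  next
    fix X :: "nat \<Rightarrow> ('v, 'd) freq \<Rightarrow> complex ^ 'd" and A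
    assume X: "\<And>n. \<forall>k. X n (- k) = vcnj (X n k)" and lim: "\<And>k. (\<lambda>n. X n k) \<longlonglongrightarrow> A k"
    show "\<forall>k. A (- k) = vcnj (A k)"
    proof
      fix k
      have "(\<lambda>n. X n (- k)) \<longlonglongrightarrow> vcnj (A k)"
        unfolding X[rule_format] vcnj_def by (intro tendsto_intros lim)
      then show "A (- k) = vcnj (A k)"
        using lim LIMSEQ_unique by blast
    qed
  qed (use R W_pos in \<open>auto simp: vcnj_def vec_eq_iff\<close>)
  have fp: "A k = (1 / heat_symbol \<omega> k) *s leray (snd k) (F k - \<i> *s conv A A k)" for k
    using arg_cong[OF A(2), of "\<lambda>X. X k"] by (simp only: T_def)
  \<comment> \<open>The component along \<xi> that \<open>leray\<close> removes is the coefficient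
    of the pressure gradient. At \<xi> = 0 the division by zero yields 0, so the pressure has zero
    average.\<close>
  define P where "P k = xi_dot (snd k) (F k - \<i> *s conv A A k) / (\<i> * of_real ((norm (real_vec (snd k)))\<^sup>2))" for k
  show ?thesis
  proof (rule that[of A P])
    fix k
    show "A (- k) = vcnj (A k)" using A(3) by blast
    have neg: "F (- k) - \<i> *s conv A A (- k) = vcnj (F k - \<i> *s conv A A k)"
      using conv_vcnj[OF A(1), of k] A(3) sym[of k] by (simp add: vcnj_def vec_eq_iff)
    have "norm (real_vec (snd (- k))) = norm (real_vec (snd k))"
      by (simp only: snd_uminus real_vec_simps norm_minus_cancel)
    moreover have "xi_dot (snd (- k)) (vcnj v) = - cnj (xi_dot (snd k) v)" for v
      by (simp add: xi_dot_def vcnj_def sum_negf)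
    ultimately show "P (- k) = cnj (P k)"
      unfolding P_def neg by simp
    show "xi_dot (snd k) (A k) = 0"
      by (subst fp) (simp add: xi_dot_smult xi_dot_leray)
    show "heat_symbol \<omega> k *s A k + \<i> *s conv A A k + (\<i> * P k) *s cvec (snd k) = F k"
    proof (cases "heat_symbol \<omega> k = 0")
      case True
      then have "snd k = 0" using norm_heat_symbol[of k \<omega>] by simp
      with True res[OF True] show ?thesis by (simp add: conv_zero cvec_def P_def vec_eq_iff)
    next
      case False
      have "heat_symbol \<omega> k *s A k = leray (snd k) (F k - \<i> *s conv A A k)"
        by (subst fp) (use False in \<open>simp add: vec_eq_iff\<close>)
      then show ?thesis
        by (simp add: leray_def P_def vec_eq_iff)
    qed
    show "A k = (1 / heat_symbol \<omega> k) *s F k" if "snd k = 0"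
      by (subst fp) (simp add: that conv_zero leray_def)
    show "P k = 0" if "snd k = 0"
      by (simp add: P_def that)
    show "cmod (P k) * norm (real_vec (snd k)) \<le> norm (F k) + norm (conv A A k)"
    proof (cases "snd k = 0")
      case False
      then have n: "norm (real_vec (snd k)) > 0" by simp
      have "cmod (P k) * norm (real_vec (snd k)) = cmod (xi_dot (snd k) (F k - \<i> *s conv A A k)) / norm (real_vec (snd k))"
        using n by (simp add: P_def norm_divide norm_mult norm_power) (simp add: power2_eq_square)
      also have "\<dots> \<le> norm (F k - \<i> *s conv A A k)"
        using norm_xi_dot[of "snd k" "F k - \<i> *s conv A A k"] n by (simp add: divide_le_eq mult.commute)
      also have "\<dots> \<le> norm (F k) + norm (conv A A k)"
        using norm_triangle_ineq4[of "F k" "\<i> *s conv A A k"] by (simp add: norm_smult_vec)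
      finally show ?thesis .
    qed (simp add: P_def)
  qed (rule A)
qed

end

subsection \<open>Absolutely convergent Fourier series\<close>

text \<open>The frequency map \<open>\<kappa>\<close> need not be injective: on the product torus it
  is \<open>lat\<close>, while for fixed \<phi> on the space torus it is
  \<open>real_vec (snd k)\<close>, which forgets the angular frequency.\<close>

definition series :: "('k \<Rightarrow> 'a::euclidean_space) \<Rightarrow> ('k \<Rightarrow> complex) \<Rightarrow> 'a \<Rightarrow> complex" where
  "series \<kappa> c x = (\<Sum>\<^sub>\<infinity>k. c k * cis (\<kappa> k \<bullet> x))"

lemma series_summable:
  assumes "(\<lambda>k. cmod (c k)) summable_on UNIV"
  shows "(\<lambda>k. c k * cis (\<kappa> k \<bullet> x)) summable_on UNIV"
  by (rule abs_summable_summable) (use assms in \<open>simp add: norm_mult\<close>)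

lemma series_uniform_limit:
  assumes c: "(\<lambda>k. cmod (c k)) summable_on UNIV"
  shows "uniform_limit UNIV (\<lambda>F x. \<Sum>k\<in>F. c k * cis (\<kappa> k \<bullet> x)) (series \<kappa> c) (finite_subsets_at_top UNIV)"
  unfolding series_def[abs_def]
  by (rule Weierstrass_m_test_general[OF _ c]) (simp add: norm_mult)

lemma continuous_on_series:
  assumes c: "(\<lambda>k. cmod (c k)) summable_on UNIV"
  shows "continuous_on A (series \<kappa> c)"
  by (rule continuous_on_subset[OF uniform_limit_theorem[OF _ series_uniform_limit[OF c]]])
     (auto intro!: always_eventually continuous_intros)

lemma periodic_series:
  assumes "range \<kappa> \<subseteq> lattice" shows "periodic (series \<kappa> c)"
proof -
  have "cis (\<kappa> k \<bullet> (x + (2 * pi) *\<^sub>R b)) = cis (\<kappa> k \<bullet> x)" if "b \<in> Basis" for k x b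
    using periodic_cis[of "\<kappa> k"] assms that by (auto simp: periodic_def)
  then show ?thesis by (simp add: periodic_def series_def)
qed

text \<open>The factor \<open>g\<close> is bounded on the compact cell, so the Weierstrass test
  still gives uniform convergence, and the sum and the integral may be exchanged.\<close>

lemma integral_series_mult:
  fixes \<kappa> :: "'k \<Rightarrow> 'a::euclidean_space"
  assumes c: "(\<lambda>k. cmod (c k)) summable_on UNIV" and g: "continuous_on cell g"
  shows "((\<lambda>k. c k * integral cell (\<lambda>x. cis (\<kappa> k \<bullet> x) * g x)) has_sum integral cell (\<lambda>x. series \<kappa> c x * g x)) UNIV"
proof -
  obtain B where B: "\<And>x. x \<in> cell \<Longrightarrow> cmod (g x) \<le> B"
    using compact_imp_bounded[OF compact_continuous_image[OF g compact_cbox]] by (auto simp: bounded_iff)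
  have lim: "uniform_limit cell (\<lambda>F x. \<Sum>k\<in>F. c k * cis (\<kappa> k \<bullet> x) * g x) (\<lambda>x. \<Sum>\<^sub>\<infinity>k. c k * cis (\<kappa> k \<bullet> x) * g x)
      (finite_subsets_at_top UNIV)"
  proof (rule Weierstrass_m_test_general)
    show "(\<lambda>k. cmod (c k) * B) summable_on UNIV"
      by (rule summable_on_cmult_left[OF c])
  qed (auto simp: norm_mult intro: mult_left_mono B)
  also have "(\<lambda>x. \<Sum>\<^sub>\<infinity>k. c k * cis (\<kappa> k \<bullet> x) * g x) = (\<lambda>x. series \<kappa> c x * g x)"
    by (simp add: series_def infsum_cmult_left')
  finally have lim: "uniform_limit cell (\<lambda>F x. \<Sum>k\<in>F. c k * cis (\<kappa> k \<bullet> x) * g x) (\<lambda>x. series \<kappa> c x * g x)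
      (finite_subsets_at_top UNIV)" .
  obtain I J where IJ: "\<And>F. ((\<lambda>x. \<Sum>k\<in>F. c k * cis (\<kappa> k \<bullet> x) * g x) has_integral I F) cell"
      "((\<lambda>x. series \<kappa> c x * g x) has_integral J) cell" "(I \<longlongrightarrow> J) (finite_subsets_at_top UNIV)"
    by (rule uniform_limit_integral_cbox[OF lim]) (auto intro!: continuous_intros g)
  have "I F = (\<Sum>k\<in>F. c k * integral cell (\<lambda>x. cis (\<kappa> k \<bullet> x) * g x))" if "finite F" for F
  proof -
    have "I F = integral cell (\<lambda>x. \<Sum>k\<in>F. c k * (cis (\<kappa> k \<bullet> x) * g x))"
      using IJ(1)[of F] by (simp add: integral_unique mult.assoc)
    also have "\<dots> = (\<Sum>k\<in>F. integral cell (\<lambda>x. c k * (cis (\<kappa> k \<bullet> x) * g x)))"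
      by (intro integral_sum that integrable_continuous continuous_intros g)
    finally show ?thesis by simp
  qed
  then have "\<forall>\<^sub>F F in finite_subsets_at_top UNIV. I F = (\<Sum>k\<in>F. c k * integral cell (\<lambda>x. cis (\<kappa> k \<bullet> x) * g x))"
    by (auto intro!: eventually_finite_subsets_at_top_weakI)
  from Lim_transform_eventually[OF IJ(3) this] show ?thesis
    unfolding has_sum_def integral_unique[OF IJ(2)] .
qed

text \<open>Orthogonality selects the indices lying over \<open>z\<close>. There may be infinitely
  many of them, because \<open>\<kappa>\<close> need not be injective.\<close>

lemma fcoef_series:
  fixes \<kappa> :: "'k \<Rightarrow> 'a::euclidean_space"
  assumes c: "(\<lambda>k. cmod (c k)) summable_on UNIV" and \<kappa>: "range \<kappa> \<subseteq> lattice" and z: "z \<in> lattice"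
  shows "fcoef (series \<kappa> c) z = (\<Sum>\<^sub>\<infinity>k\<in>{k. \<kappa> k = z}. c k)"
proof -
  let ?L = "(2 * pi) ^ DIM('a) :: complex"
  have int: "integral cell (\<lambda>x. cis (\<kappa> k \<bullet> x) * cis (- (z \<bullet> x))) = (if \<kappa> k = z then ?L else 0)" for k
  proof -
    have "\<kappa> k - z \<in> lattice" using \<kappa> z by (intro lattice_diff) auto
    then have "integral cell (\<lambda>x. cis ((\<kappa> k - z) \<bullet> x)) = (if \<kappa> k = z then ?L else 0)"
      by (subst integral_cis) auto
    then show ?thesis by (simp add: cis_mult inner_diff_left)
  qed
  have "integral cell (\<lambda>x. series \<kappa> c x * cis (- (z \<bullet> x))) = (\<Sum>\<^sub>\<infinity>k. c k * (if \<kappa> k = z then ?L else 0))"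
    using integral_series_mult[OF c, of "\<lambda>x. cis (- (z \<bullet> x))" \<kappa>]
    by (simp add: int infsumI continuous_intros)
  also have "\<dots> = (\<Sum>\<^sub>\<infinity>k\<in>{k. \<kappa> k = z}. c k * ?L)"
    by (rule infsum_cong_neutral) auto
  finally show ?thesis
    by (simp add: fcoef_def infsum_cmult_left')
qed

text \<open>The double series converges absolutely and is regrouped along the bijection
  \<open>T\<close>, which sends (k, j) to (j, k - j). The exponentials combine because
  \<open>\<kappa>\<close> respects differences.\<close>

lemma series_mult:
  fixes \<kappa> :: "'k::ab_group_add \<Rightarrow> 'a::euclidean_space"
  assumes \<kappa>: "\<And>j k. \<kappa> (k - j) = \<kappa> k - \<kappa> j"
    and a: "(\<lambda>k. cmod (a k)) summable_on UNIV" and b: "(\<lambda>k. cmod (b k)) summable_on UNIV"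
  shows "(\<lambda>k. cmod (\<Sum>\<^sub>\<infinity>j. a j * b (k - j))) summable_on UNIV"
    and "series \<kappa> a x * series \<kappa> b x = series \<kappa> (\<lambda>k. \<Sum>\<^sub>\<infinity>j. a j * b (k - j)) x"
    and "(\<lambda>j. a j * b (k - j)) summable_on UNIV"
proof -
  define T where "T = (\<lambda>(k, j). (j, k - j) :: 'k \<times> 'k)"
  have T: "bij T"
    by (rule o_bij[of "\<lambda>(i, j). (i + j, i)"]) (auto simp: T_def fun_eq_iff)
  have shift: "(\<lambda>(k, j). h (j, k - j)) = (\<lambda>p. h (T p))" for h :: "'k \<times> 'k \<Rightarrow> 'c"
    by (auto simp: T_def)
  have prod: "(\<lambda>(i, j). cmod (a i * b j)) summable_on UNIV \<times> UNIV"
  proof (rule summable_on_SigmaI)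
    show "((\<lambda>j. case (i, j) of (i, j) \<Rightarrow> cmod (a i * b j)) has_sum cmod (a i) * (\<Sum>\<^sub>\<infinity>j. cmod (b j))) UNIV" for i
      using has_sum_cmult_right[OF has_sum_infsum[OF b], of "cmod (a i)"] by (simp add: norm_mult)
    show "(\<lambda>i. cmod (a i) * (\<Sum>\<^sub>\<infinity>j. cmod (b j))) summable_on UNIV"
      by (rule summable_on_cmult_left[OF a])
  qed auto
  then have "(\<lambda>p. (\<lambda>(i, j). cmod (a i * b j)) (T p)) summable_on UNIV"
    by (subst summable_on_reindex_bij_betw[OF T]) simp
  then have summ: "(\<lambda>(k, j). cmod (a j * b (k - j))) summable_on UNIV \<times> UNIV"
    using shift[of "\<lambda>(i, j). cmod (a i * b j)"] by simp
  have row: "(\<lambda>j. cmod (a j * b (k - j))) summable_on UNIV" for k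
    using summable_on_SigmaD1[OF summ, of k] by simp
  then show "(\<lambda>j. a j * b (k - j)) summable_on UNIV"
    by (rule abs_summable_summable)
  have rows: "(\<lambda>k. \<Sum>\<^sub>\<infinity>j. cmod (a j * b (k - j))) summable_on UNIV"
    using summable_on_Sigma_banach[OF summ] by simp
  show "(\<lambda>k. cmod (\<Sum>\<^sub>\<infinity>j. a j * b (k - j))) summable_on UNIV"
    by (rule Infinite_Sum.abs_summable_on_comparison_test'[OF rows]) (rule norm_infsum_bound[OF row])
  let ?e = "\<lambda>k. cis (\<kappa> k \<bullet> x)"
  have e: "?e j * ?e (k - j) = ?e k" for j k
    by (simp add: cis_mult \<kappa> inner_diff_left)
  have abs: "(\<lambda>(k, j). cmod (a j * b (k - j) * ?e k)) summable_on UNIV \<times> UNIV"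
    using summ by (simp add: norm_mult)
  have abs': "(\<lambda>(k, j). a j * b (k - j) * ?e k) summable_on UNIV \<times> UNIV"
    by (rule abs_summable_summable) (use abs in \<open>simp add: case_prod_unfold\<close>)
  have abs2: "(\<lambda>(i, j). (a i * ?e i) * (b j * ?e j)) summable_on UNIV \<times> UNIV"
    by (rule abs_summable_summable) (use prod in \<open>simp add: case_prod_unfold norm_mult\<close>)
  have "series \<kappa> a x * series \<kappa> b x = (\<Sum>\<^sub>\<infinity>i. (a i * ?e i) * (\<Sum>\<^sub>\<infinity>j. b j * ?e j))"
    by (simp add: series_def infsum_cmult_left')
  also have "\<dots> = (\<Sum>\<^sub>\<infinity>i. \<Sum>\<^sub>\<infinity>j. (a i * ?e i) * (b j * ?e j))"
    by (simp add: infsum_cmult_right')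
  also have "\<dots> = (\<Sum>\<^sub>\<infinity>(i, j)\<in>UNIV \<times> UNIV. (a i * ?e i) * (b j * ?e j))"
    by (rule infsum_Sigma'_banach[OF abs2])
  also have "\<dots> = (\<Sum>\<^sub>\<infinity>p. (\<lambda>(i, j). (a i * ?e i) * (b j * ?e j)) (T p))"
    by (subst infsum_reindex_bij_betw[OF T]) simp
  also have "\<dots> = (\<Sum>\<^sub>\<infinity>(k, j)\<in>UNIV \<times> UNIV. a j * b (k - j) * ?e k)"
  proof (subst UNIV_Times_UNIV, rule infsum_cong, clarify)
    fix k j
    have "(a j * ?e j) * (b (k - j) * ?e (k - j)) = a j * b (k - j) * (?e j * ?e (k - j))"
      by (simp only: mult_ac)
    then show "(case T (k, j) of (i, j) \<Rightarrow> (a i * ?e i) * (b j * ?e j)) = a j * b (k - j) * ?e k"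
      unfolding e by (simp add: T_def)
  qed
  also have "\<dots> = (\<Sum>\<^sub>\<infinity>k. \<Sum>\<^sub>\<infinity>j. a j * b (k - j) * ?e k)"
    by (rule infsum_Sigma'_banach[OF abs', symmetric])
  also have "\<dots> = series \<kappa> (\<lambda>k. \<Sum>\<^sub>\<infinity>j. a j * b (k - j)) x"
    by (simp add: series_def infsum_cmult_left')
  finally show "series \<kappa> a x * series \<kappa> b x = series \<kappa> (\<lambda>k. \<Sum>\<^sub>\<infinity>j. a j * b (k - j)) x" .
qed

lemma cnj_series:
  fixes \<kappa> :: "'k::ab_group_add \<Rightarrow> 'a::euclidean_space"
  assumes "\<And>k. \<kappa> (- k) = - \<kappa> k" "\<And>k. c (- k) = cnj (c k)"
  shows "cnj (series \<kappa> c x) = series \<kappa> c x"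
proof -
  have "cnj (series \<kappa> c x) = (\<Sum>\<^sub>\<infinity>k. c (- k) * cis (\<kappa> (- k) \<bullet> x))"
    by (simp add: series_def assms cis_cnj flip: infsum_cnj)
  also have "\<dots> = series \<kappa> c x"
    unfolding series_def by (rule infsum_reindex_bij_betw) (rule bij_uminus)
  finally show ?thesis .
qed

lemma of_real_Re_series:
  fixes \<kappa> :: "'k::ab_group_add \<Rightarrow> 'a::euclidean_space"
  assumes "\<And>k. \<kappa> (- k) = - \<kappa> k" "\<And>k. c (- k) = cnj (c k)"
  shows "complex_of_real (Re (series \<kappa> c x)) = series \<kappa> c x"
  using cnj_series[of \<kappa> c x] assms by (simp add: complex_eq_iff)

subsection \<open>The torus\<close>

text \<open>The passage from the Lebesgue integrals of the statement to the gauge integrals in which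
  all computations take place.\<close>

lemma integral_eq_LINT:
  fixes g :: "'a::euclidean_space \<Rightarrow> 'b::euclidean_space"
  assumes "continuous_on UNIV g"
  shows "set_integrable lborel cell g" and "(LINT x:cell|lborel. g x) = integral cell g"
proof -
  show "set_integrable lborel cell g"
    unfolding set_integrable_def
    by (intro borel_integrable_compact compact_cbox continuous_on_subset[OF assms]) auto
  then show "(LINT x:cell|lborel. g x) = integral cell g"
    by (rule set_borel_integral_eq_integral(2))
qed

lemma torus_periodic_eq_periodic: "torus_periodic u \<longleftrightarrow> periodic u"
  by (auto simp: torus_periodic_def periodic_def Basis_vec_def)

lemma torus_cell_eq_cell: "torus_cell = (cell :: (real ^ 'd) set)"
proof -
  have "(\<chi> i. 2 * pi) = (2 * pi) *\<^sub>R (One :: real ^ 'd)"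
  proof (rule euclidean_eqI)
    fix b :: "real ^ 'd" assume b: "b \<in> Basis"
    then have "(\<chi> i. 2 * pi) \<bullet> b = 2 * pi" by (auto simp: Basis_vec_def inner_axis)
    then show "(\<chi> i. 2 * pi) \<bullet> b = ((2 * pi) *\<^sub>R (One :: real ^ 'd)) \<bullet> b" using b by simp
  qed
  then show ?thesis by (simp add: torus_cell_def)
qed

lemma cell_Times: "cell \<times> cell = (cell :: ('a::euclidean_space \<times> 'b::euclidean_space) set)"
proof -
  have "(2 * pi) *\<^sub>R (One :: 'a \<times> 'b) = ((2 * pi) *\<^sub>R One, (2 * pi) *\<^sub>R One)"
  proof (rule euclidean_eqI)
    fix b :: "'a \<times> 'b" assume b: "b \<in> Basis"
    then have "((2 * pi) *\<^sub>R One, (2 * pi) *\<^sub>R One) \<bullet> b = 2 * pi" by (auto simp: Basis_prod_def)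
    then show "((2 * pi) *\<^sub>R (One :: 'a \<times> 'b)) \<bullet> b = ((2 * pi) *\<^sub>R One, (2 * pi) *\<^sub>R One) \<bullet> b" using b by simp
  qed
  then show ?thesis by (simp only: cbox_Pair_eq zero_prod_def)
qed

lemma real_vec_lattice: "real_vec k \<in> lattice"
  by (auto simp: lattice_def Basis_vec_def inner_axis)

lemma exp_eq_cis: "exp (- \<i> * complex_of_real (x \<bullet> k)) = cis (- (k \<bullet> x))"
  by (simp add: cis_conv_exp inner_commute)

lemma fourier_coeff_continuous:
  assumes "continuous_on UNIV v"
  shows "fourier_coeff v \<xi> = fcoef (\<lambda>x. complex_of_real (v x)) (real_vec \<xi>)"
  unfolding fourier_coeff_def fcoef_def exp_eq_cis torus_cell_eq_cell
  by (subst integral_eq_LINT) (auto intro!: continuous_intros assms)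

lemma fcoef_of_real_uminus:
  assumes "continuous_on UNIV g"
  shows "fcoef (\<lambda>x. complex_of_real (g x)) (- k) = cnj (fcoef (\<lambda>x. complex_of_real (g x)) k)"
proof -
  have "(\<lambda>x. complex_of_real (g x) * cis (- (k \<bullet> x))) integrable_on cell"
    by (intro integrable_continuous continuous_intros continuous_on_subset[OF assms]) auto
  from integral_linear[OF this bounded_linear_cnj] show ?thesis
    by (simp add: fcoef_def o_def cis_cnj)
qed

definition lat :: "('v::finite, 'd::finite) freq \<Rightarrow> (real ^ 'v) \<times> (real ^ 'd)" where
  "lat k = (real_vec (fst k), real_vec (snd k))"

lemma range_lat: "range lat = (lattice :: ((real ^ 'v::finite) \<times> (real ^ 'd::finite)) set)"
proof (intro equalityI subsetI)
  fix z :: "(real ^ 'v) \<times> (real ^ 'd)" assume z: "z \<in> lattice"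
  have "fst z $ i \<in> \<int>" for i
  proof -
    have "(axis i 1, 0) \<in> (Basis :: ((real ^ 'v) \<times> (real ^ 'd)) set)" by (auto simp: Basis_prod_def Basis_vec_def)
    then have "z \<bullet> (axis i 1, 0) \<in> \<int>" using z by (simp only: lattice_def mem_Collect_eq)
    then show ?thesis by (simp add: inner_prod_def inner_axis)
  qed
  moreover have "snd z $ i \<in> \<int>" for i
  proof -
    have "(0, axis i 1) \<in> (Basis :: ((real ^ 'v) \<times> (real ^ 'd)) set)" by (auto simp: Basis_prod_def Basis_vec_def)
    then have "z \<bullet> (0, axis i 1) \<in> \<int>" using z by (simp only: lattice_def mem_Collect_eq)
    then show ?thesis by (simp add: inner_prod_def inner_axis)
  qed
  ultimately have "z = lat ((\<chi> i. \<lfloor>fst z $ i\<rfloor>), (\<chi> i. \<lfloor>snd z $ i\<rfloor>))"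
    by (simp add: lat_def prod_eq_iff vec_eq_iff)
  then show "z \<in> range lat" by blast
next
  fix z :: "(real ^ 'v) \<times> (real ^ 'd)" assume "z \<in> range lat"
  moreover have "real_vec l \<in> lattice" "real_vec k \<in> lattice" for l :: "int ^ 'v" and k :: "int ^ 'd"
    by (rule real_vec_lattice)+
  ultimately show "z \<in> lattice"
    by (auto simp: lattice_def lat_def Basis_prod_def)
qed

lemma inj_lat: "inj lat"
  by (auto simp: inj_on_def lat_def vec_eq_iff prod_eq_iff)

lemma lat_diff: "lat (k - j) = lat k - lat j"
  by (simp only: lat_def fst_diff snd_diff real_vec_simps diff_Pair)

lemma lat_uminus: "lat (- k) = - lat k"
  by (simp only: lat_def fst_uminus snd_uminus real_vec_simps uminus_Pair)

text \<open>The difference between \<open>g\<close> and its series is continuous and periodic with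
  all coefficients 0, so it vanishes by completeness.\<close>

theorem Fourier_inversion:
  fixes g :: "(real ^ 'v::finite) \<times> (real ^ 'd::finite) \<Rightarrow> real"
  assumes cont: "continuous_on UNIV g" and per: "periodic g"
    and summ: "(\<lambda>k. cmod (fcoef (\<lambda>z. complex_of_real (g z)) (lat k))) summable_on UNIV"
  shows "complex_of_real (g z) = series lat (\<lambda>k. fcoef (\<lambda>z. complex_of_real (g z)) (lat k)) z"
proof -
  define c where "c k = fcoef (\<lambda>z. complex_of_real (g z)) (lat k)" for k :: "('v, 'd) freq"
  have range_lat: "range lat = (lattice :: ((real ^ 'v) \<times> (real ^ 'd)) set)"
    and inj_lat: "inj (lat :: ('v, 'd) freq \<Rightarrow> _)"
    by (rule range_lat, rule inj_lat)
  have c: "(\<lambda>k. cmod (c k)) summable_on UNIV" using summ by (simp add: c_def)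
  have int: "(\<lambda>z. h z * cis (- (k \<bullet> z))) integrable_on cell" if "continuous_on UNIV h" for h :: "(real ^ 'v) \<times> (real ^ 'd) \<Rightarrow> complex" and k
    by (intro integrable_continuous continuous_intros continuous_on_subset[OF that]) auto
  have "c (- k) = cnj (c k)" for k
    by (simp add: c_def lat_uminus fcoef_of_real_uminus[OF cont])
  \<comment> \<open>Completeness was proved for real functions, so the series is first shown to be
    real.\<close>
  then have real: "complex_of_real (Re (series lat c z)) = series lat c z" for z
    by (intro of_real_Re_series lat_uminus)
  have contS: "continuous_on UNIV (series lat c)" by (rule continuous_on_series[OF c])
  have "g z - Re (series lat c z) = 0"
  proof (rule fcoef_eq_0_imp_zero[where g = "\<lambda>z. g z - Re (series lat c z)"])
    show "continuous_on UNIV (\<lambda>z. g z - Re (series lat c z))"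
      by (intro continuous_intros cont contS)
    show "periodic (\<lambda>z. g z - Re (series lat c z))"
      using per periodic_series[of lat c] range_lat by (simp add: periodic_def del: split_paired_All)
    fix k :: "(real ^ 'v) \<times> (real ^ 'd)" assume "k \<in> lattice"
    then obtain k' :: "('v, 'd) freq" where k': "k = lat k'" using range_lat by (metis imageE)
    have "{j. lat j = k} = {k'}" unfolding k' inj_eq[OF inj_lat] by simp
    then have "fcoef (series lat c) k = c k'"
      using fcoef_series[OF c, of lat k] range_lat \<open>k \<in> lattice\<close> by simp
    moreover have "fcoef (\<lambda>z. complex_of_real (g z - Re (series lat c z))) k = fcoef (\<lambda>z. complex_of_real (g z)) k - fcoef (series lat c) k"
    proof -
      have "(\<lambda>z. complex_of_real (g z) * cis (- (k \<bullet> z))) integrable_on cell"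
        and "(\<lambda>z. series lat c z * cis (- (k \<bullet> z))) integrable_on cell"
        by (intro int contS continuous_intros cont)+
      from integral_diff[OF this] show ?thesis
        unfolding fcoef_def of_real_diff real left_diff_distrib by (simp only: diff_divide_distrib)
    qed
    ultimately show "fcoef (\<lambda>z. complex_of_real (g z - Re (series lat c z))) k = 0"
      by (simp add: c_def k')
  qed
  then have "complex_of_real (g z) = complex_of_real (Re (series lat c z))" by simp
  then show ?thesis using real unfolding c_def by simp
qed

subsection \<open>Sobolev spaces\<close>

text \<open>The inequality t \<le> 1 + t^2 turns square integrability into integrability on the
  cell, whose measure is finite; this makes Fourier coefficients linear on
  \<open>sobolev s\<close>.\<close>

lemma sobolev_integrable:
  fixes u :: "real ^ 'd \<Rightarrow> 'b::euclidean_space"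
  assumes "u \<in> sobolev s"
  shows "set_integrable lborel torus_cell
    (\<lambda>x. complex_of_real (u x \<bullet> b) * exp (- \<i> * complex_of_real (x \<bullet> real_vec \<xi>)))"
proof -
  have meas: "u \<in> borel_measurable borel" and int: "set_integrable lborel torus_cell (\<lambda>x. (norm (u x))\<^sup>2)"
    using assms by (auto simp: sobolev_def)
  have one: "set_integrable lborel torus_cell (\<lambda>x. 1 :: real)"
    unfolding torus_cell_eq_cell by (rule integral_eq_LINT) simp
  have "set_integrable lborel torus_cell (\<lambda>x. norm b * (1 + (norm (u x))\<^sup>2))"
    by (intro set_integrable_mult_right set_integral_add one int)
  then show ?thesis
  proof (rule set_integrable_bound)
    have [measurable]: "u \<in> borel_measurable lborel" using meas by simp
    have [measurable]: "(\<lambda>x. exp (- \<i> * complex_of_real (x \<bullet> real_vec \<xi>))) \<in> borel_measurable borel"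
      by (intro borel_measurable_continuous_onI continuous_intros)
    have [measurable]: "torus_cell \<in> sets borel" by (simp add: torus_cell_def)
    show "set_borel_measurable lborel torus_cell
        (\<lambda>x. complex_of_real (u x \<bullet> b) * exp (- \<i> * complex_of_real (x \<bullet> real_vec \<xi>)))"
      unfolding set_borel_measurable_def by measurable
    show "AE x in lborel. x \<in> torus_cell \<longrightarrow>
        norm (complex_of_real (u x \<bullet> b) * exp (- \<i> * complex_of_real (x \<bullet> real_vec \<xi>)))
        \<le> norm (norm b * (1 + (norm (u x))\<^sup>2))"
    proof (intro AE_I2 impI)
      fix x
      have "norm (complex_of_real (u x \<bullet> b) * exp (- \<i> * complex_of_real (x \<bullet> real_vec \<xi>))) = \<bar>u x \<bullet> b\<bar>"
        by (simp add: norm_mult exp_eq_cis)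
      also have "\<dots> \<le> norm (u x) * norm b" by (rule Cauchy_Schwarz_ineq2)
      also have "\<dots> \<le> (1 + (norm (u x))\<^sup>2) * norm b"
        using sum_squares_bound[of 1 "norm (u x)"] by (intro mult_right_mono) (auto intro: order_trans[rotated])
      finally show "norm (complex_of_real (u x \<bullet> b) * exp (- \<i> * complex_of_real (x \<bullet> real_vec \<xi>)))
          \<le> norm (norm b * (1 + (norm (u x))\<^sup>2))"
        by (simp add: mult.commute)
    qed
  qed
qed

lemma fourier_coeff_diff:
  fixes u v :: "real ^ 'd \<Rightarrow> 'b::euclidean_space"
  assumes "u \<in> sobolev s" "v \<in> sobolev s"
  shows "fourier_coeff (\<lambda>x. (u x - v x) \<bullet> b) \<xi> = fourier_coeff (\<lambda>x. u x \<bullet> b) \<xi> - fourier_coeff (\<lambda>x. v x \<bullet> b) \<xi>"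
  using set_integral_diff(2)[OF sobolev_integrable[OF assms(1)] sobolev_integrable[OF assms(2)], of b \<xi> b \<xi>]
  by (simp add: fourier_coeff_def inner_diff_left left_diff_distrib diff_divide_distrib)

lemma fourier_coeff_scaleR:
  "fourier_coeff (\<lambda>x. (c *\<^sub>R u x) \<bullet> b) \<xi> = of_real c * fourier_coeff (\<lambda>x. u x \<bullet> b) \<xi>"
  by (simp add: fourier_coeff_def mult.assoc)

lemma sobolev_density_nonneg: "0 \<le> sobolev_density s u \<xi>"
  unfolding sobolev_density_def by (intro mult_nonneg_nonneg sum_nonneg) auto

lemma sobolev_norm_nonneg: "0 \<le> sobolev_norm s u"
  unfolding sobolev_norm_def by (simp add: infsum_nonneg sobolev_density_nonneg)

text \<open>Serves to exchange representatives: equality of coefficients is all that can be said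
  about a derivative obtained from \<open>SOME\<close>.\<close>

lemma sobolev_norm_cong:
  assumes "\<And>b \<xi>. b \<in> Basis \<Longrightarrow> fourier_coeff (\<lambda>x. u x \<bullet> b) \<xi> = fourier_coeff (\<lambda>x. v x \<bullet> b) \<xi>"
  shows "sobolev_norm s u = sobolev_norm s v"
  unfolding sobolev_norm_def sobolev_density_def[abs_def] using assms by simp

lemma sobolev_diff:
  fixes u v :: "real ^ 'd \<Rightarrow> 'b::euclidean_space"
  assumes u: "u \<in> sobolev s" and v: "v \<in> sobolev s"
  shows "(\<lambda>x. u x - v x) \<in> sobolev s"
proof -
  have norm_diff: "(norm (a - b))\<^sup>2 \<le> 2 * (norm a)\<^sup>2 + 2 * (norm b)\<^sup>2" for a b :: "'z::real_normed_vector"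
  proof -
    have "(norm (a - b))\<^sup>2 \<le> (norm a + norm b)\<^sup>2"
      by (intro power_mono norm_triangle_ineq4) auto
    also have "\<dots> \<le> 2 * (norm a)\<^sup>2 + 2 * (norm b)\<^sup>2"
      using sum_squares_bound[of "norm a" "norm b"] by (simp add: power2_sum)
    finally show ?thesis .
  qed
  have meas [measurable]: "u \<in> borel_measurable borel" "v \<in> borel_measurable borel"
    and int: "set_integrable lborel torus_cell (\<lambda>x. (norm (u x))\<^sup>2)" "set_integrable lborel torus_cell (\<lambda>x. (norm (v x))\<^sup>2)"
    using u v by (auto simp: sobolev_def)
  have "set_integrable lborel torus_cell (\<lambda>x. (norm (u x - v x))\<^sup>2)"
  proof (rule set_integrable_bound)
    show "set_integrable lborel torus_cell (\<lambda>x. 2 * (norm (u x))\<^sup>2 + 2 * (norm (v x))\<^sup>2)"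
      by (intro set_integral_add set_integrable_mult_right int)
    have [measurable]: "torus_cell \<in> sets borel" by (simp add: torus_cell_def)
    show "set_borel_measurable lborel torus_cell (\<lambda>x. (norm (u x - v x))\<^sup>2)"
      unfolding set_borel_measurable_def measurable_lborel1 by measurable
  qed (use norm_diff in auto)
  moreover have "sobolev_density s (\<lambda>x. u x - v x) summable_on UNIV"
  proof (rule summable_on_comparison_test)
    show "(\<lambda>\<xi>. 2 * sobolev_density s u \<xi> + 2 * sobolev_density s v \<xi>) summable_on UNIV"
      using u v by (intro summable_on_add summable_on_cmult_right) (auto simp: sobolev_def)
    show "sobolev_density s (\<lambda>x. u x - v x) \<xi> \<le> 2 * sobolev_density s u \<xi> + 2 * sobolev_density s v \<xi>" for \<xi>
    proof -
      have "sobolev_density s (\<lambda>x. u x - v x) \<xi> \<le> japanese \<xi> powr (2 * s) *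
          (\<Sum>b\<in>Basis. 2 * (cmod (fourier_coeff (\<lambda>x. u x \<bullet> b) \<xi>))\<^sup>2 + 2 * (cmod (fourier_coeff (\<lambda>x. v x \<bullet> b) \<xi>))\<^sup>2)"
        unfolding sobolev_density_def fourier_coeff_diff[OF u v]
        by (intro mult_left_mono sum_mono norm_diff) auto
      then show ?thesis
        by (simp add: sobolev_density_def sum.distrib sum_distrib_left distrib_left mult_ac)
    qed
  qed (rule sobolev_density_nonneg)
  ultimately show ?thesis
    using u v by (auto simp: sobolev_def torus_periodic_def)
qed

lemma sobolev_scaleR:
  fixes u :: "real ^ 'd \<Rightarrow> 'b::euclidean_space"
  assumes u: "u \<in> sobolev s"
  shows "(\<lambda>x. c *\<^sub>R u x) \<in> sobolev s"
proof -
  have "sobolev_density s (\<lambda>x. c *\<^sub>R u x) = (\<lambda>\<xi>. c\<^sup>2 * sobolev_density s u \<xi>)"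
    by (simp add: sobolev_density_def fun_eq_iff fourier_coeff_scaleR norm_mult power_mult_distrib sum_distrib_left mult_ac del: inner_scaleR_left)
  then show ?thesis
    using u by (auto simp: sobolev_def torus_periodic_def power_mult_distrib intro!: set_integrable_mult_right summable_on_cmult_right)
qed

lemma fourier_coeff_le_sobolev_norm:
  assumes u: "u \<in> sobolev s" and b: "b \<in> Basis" and s: "0 \<le> s"
  shows "cmod (fourier_coeff (\<lambda>x. u x \<bullet> b) \<xi>) \<le> sobolev_norm s u"
proof -
  have "1 powr (2 * s) \<le> japanese \<xi> powr (2 * s)"
    using s japanese_ge_1 by (intro powr_mono2) auto
  then have "1 * (cmod (fourier_coeff (\<lambda>x. u x \<bullet> b) \<xi>))\<^sup>2 \<le> sobolev_density s u \<xi>"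
    unfolding sobolev_density_def using b
    by (intro mult_mono member_le_sum[where f = "\<lambda>b. (cmod (fourier_coeff (\<lambda>x. u x \<bullet> b) \<xi>))\<^sup>2"] sum_nonneg) auto
  also have "\<dots> \<le> (\<Sum>\<^sub>\<infinity>\<xi>. sobolev_density s u \<xi>)"
    using finite_sum_le_infsum[of "sobolev_density s u" UNIV "{\<xi>}"] u sobolev_density_nonneg by (auto simp: sobolev_def)
  finally show ?thesis
    unfolding sobolev_norm_def by (intro real_le_rsqrt) simp
qed

text \<open>A single coefficient is bounded by the Sobolev norm because s \<ge> 0. Hence the
  coefficient of any derivative is the limit of the coefficients of the difference
  quotients.\<close>

lemma sobolev_deriv_coeff_unique:
  fixes w :: "real \<Rightarrow> real ^ 'd \<Rightarrow> 'b::euclidean_space"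
  assumes w: "\<And>t. w t \<in> sobolev s" and s: "0 \<le> s" and b: "b \<in> Basis"
    and V: "has_sobolev_deriv s w V t" and V': "has_sobolev_deriv s w V' t"
  shows "fourier_coeff (\<lambda>x. V x \<bullet> b) \<xi> = fourier_coeff (\<lambda>x. V' x \<bullet> b) \<xi>"
proof -
  define q where "q h = (\<lambda>x. (w (t + h) x - w t x) /\<^sub>R h)" for h
  have q: "q h \<in> sobolev s" for h
    unfolding q_def by (intro sobolev_scaleR sobolev_diff w)
  have lim: "((\<lambda>h. fourier_coeff (\<lambda>x. q h x \<bullet> b) \<xi>) \<longlongrightarrow> fourier_coeff (\<lambda>x. Z x \<bullet> b) \<xi>) (at 0)"
    if "has_sobolev_deriv s w Z t" for Z
  proof -
    have Z: "Z \<in> sobolev s" and lim: "((\<lambda>h. sobolev_norm s (\<lambda>x. q h x - Z x)) \<longlongrightarrow> 0) (at 0)"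
      using that by (auto simp: has_sobolev_deriv_def q_def)
    have le: "norm (fourier_coeff (\<lambda>x. q h x \<bullet> b) \<xi> - fourier_coeff (\<lambda>x. Z x \<bullet> b) \<xi>) \<le> sobolev_norm s (\<lambda>x. q h x - Z x)" for h
      using fourier_coeff_le_sobolev_norm[OF sobolev_diff[OF q Z] b s, of h \<xi>] by (simp only: fourier_coeff_diff[OF q Z])
    show ?thesis
      by (rule LIM_zero_cancel, rule Lim_null_comparison[OF always_eventually[OF allI[OF le]] lim])
  qed
  show ?thesis
    using tendsto_unique[OF _ lim[OF V] lim[OF V']] by simp
qed

subsection \<open>Fourier series as maps into a Sobolev space\<close>

lemma cis_Lipschitz: "cmod (cis a - cis b) \<le> \<bar>a - b\<bar>"
proof -
  have "cis a - cis b = cis b * (cis (a - b) - 1)"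
    by (simp add: cis_mult right_diff_distrib)
  then have "cmod (cis a - cis b) = 2 * \<bar>sin ((a - b) / 2)\<bar>"
    using dist_exp_i_1[of "a - b", folded cis_conv_exp] by (simp add: norm_mult)
  also have "\<dots> \<le> 2 * \<bar>(a - b) / 2\<bar>"
    by (intro mult_left_mono abs_sin_x_le_abs_x) auto
  finally show ?thesis by simp
qed

text \<open>After factoring out \<open>cis a\<close>, the mean value inequality applies to cis t - 1
  - i t, whose derivative is at most |y| on the interval from -|y| to |y|.\<close>

lemma cis_second_order: "cmod (cis (a + y) - cis a - \<i> * y * cis a) \<le> y\<^sup>2"
proof -
  define g where "g t = cis t - 1 - \<i> * of_real t" for t
  have "norm (g y - g 0) \<le> \<bar>y\<bar> * norm (y - 0)"
  proof (rule differentiable_bound[where S = "{- \<bar>y\<bar> .. \<bar>y\<bar>}" and f' = "\<lambda>t h. h *\<^sub>R (\<i> * (cis t - 1))"])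
    fix t assume t: "t \<in> {- \<bar>y\<bar> .. \<bar>y\<bar>}"
    show "(g has_derivative (\<lambda>h. h *\<^sub>R (\<i> * (cis t - 1)))) (at t within {- \<bar>y\<bar> .. \<bar>y\<bar>})"
      unfolding g_def by (auto intro!: derivative_eq_intros simp: scaleR_conv_of_real algebra_simps)
    have "norm (\<i> * (cis t - 1)) \<le> \<bar>y\<bar>"
      using cis_Lipschitz[of t 0] t by (auto simp: norm_mult)
    then show "onorm (\<lambda>h. h *\<^sub>R (\<i> * (cis t - 1))) \<le> \<bar>y\<bar>"
      by (intro onorm_bound) (auto simp: mult.commute mult_left_mono)
  qed auto
  moreover have "cis (a + y) - cis a - \<i> * y * cis a = cis a * g y"
    by (simp add: g_def algebra_simps cis_mult)
  ultimately show ?thesis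
    by (simp add: norm_mult g_def power2_eq_square)
qed

text \<open>\<open>m\<close> acts on the angular frequency only. Phases give the field at an angle
  \<phi>; their derivatives, differences and difference quotients give those of the field. One
  estimate in terms of \<open>m\<close> therefore serves all of them.\<close>

definition mode_sum :: "(int ^ 'v \<Rightarrow> complex) \<Rightarrow> (('v::finite, 'd::finite) freq \<Rightarrow> complex) \<Rightarrow> real ^ 'd \<Rightarrow> complex" where
  "mode_sum m c = series (\<lambda>k. real_vec (snd k)) (\<lambda>k. m (fst k) * c k)"

definition field_of :: "(int ^ 'v \<Rightarrow> complex) \<Rightarrow> ('b \<Rightarrow> ('v::finite, 'd::finite) freq \<Rightarrow> complex) \<Rightarrow> real ^ 'd \<Rightarrow> 'b::euclidean_space" where
  "field_of m c x = (\<Sum>b\<in>Basis. Re (mode_sum m (c b) x) *\<^sub>R b)"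

text \<open>Quadratic growth is what a second-order remainder in \<phi> costs and what the choice of
  \<open>\<rho>\<close> affords. The symmetry makes the mode sums real, so that \<open>Re\<close> in
  \<open>field_of\<close> loses nothing.\<close>

definition multiplier :: "(int ^ 'v \<Rightarrow> complex) \<Rightarrow> real \<Rightarrow> bool" where
  "multiplier m \<delta> \<longleftrightarrow> (\<forall>l. cmod (m l) \<le> \<delta> * (japanese l)\<^sup>2 \<and> m (- l) = cnj (m l))"

lemma field_of_inner: "b \<in> Basis \<Longrightarrow> field_of m c x \<bullet> b = Re (mode_sum m (c b) x)"
  unfolding field_of_def by (rule inner_sum_left_Basis)

lemma multiplier_nonneg:
  fixes m :: "int ^ 'v \<Rightarrow> complex"
  assumes "multiplier m \<delta>" shows "0 \<le> \<delta>"
proof -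
  have "0 \<le> \<delta> * (japanese (0 :: int ^ 'v))\<^sup>2"
    by (rule order_trans[OF norm_ge_zero[of "m 0"]]) (use assms in \<open>simp add: multiplier_def\<close>)
  then show ?thesis by (simp add: zero_le_mult_iff)
qed

lemma multiplier_scale:
  assumes "multiplier m \<delta>" shows "multiplier (\<lambda>l. of_real a * m l) (\<bar>a\<bar> * \<delta>)"
  using assms unfolding multiplier_def norm_mult norm_of_real by (simp add: mult.assoc mult_left_mono)

text \<open>\<open>D\<close> is for the sum over \<open>l\<close> at fixed \<xi>, which gives
  Sobolev bounds; \<open>E\<close> is for the sum over all frequencies, which gives absolute
  convergence. The exponent 2 - \<rho> leaves room for a multiplier.\<close>

locale sobolev_coefficients =
  fixes \<rho> s D E :: real and c :: "'b::euclidean_space \<Rightarrow> ('v::finite, 'd::finite) freq \<Rightarrow> complex" and R :: real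
  assumes D: "l2_bound (\<lambda>l :: int ^ 'v. japanese l powr (2 - \<rho>)) D"
    and E: "l2_bound (weight (2 - \<rho>) (- s) :: ('v, 'd) freq \<Rightarrow> real) E"
    and s: "0 \<le> s"
    and c: "\<And>b. b \<in> Basis \<Longrightarrow> l2_bound (\<lambda>k. weight \<rho> s k * cmod (c b k)) R"
    and real: "\<And>b k. b \<in> Basis \<Longrightarrow> c b (- k) = cnj (c b k)"
begin

lemma summable_modes:
  assumes m: "multiplier m \<delta>" and b: "b \<in> Basis"
  shows "(\<lambda>k. cmod (m (fst k) * c b k)) summable_on UNIV"
proof (rule l2_Cauchy_Schwarz(1)[OF E l2_bound_scale[OF c[OF b], of \<delta>]])
  fix k
  have "cmod (m (fst k) * c b k) \<le> (\<delta> * (japanese (fst k))\<^sup>2) * cmod (c b k)"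
    using m unfolding norm_mult multiplier_def by (intro mult_right_mono) auto
  also have "(japanese (fst k))\<^sup>2 = weight (2 - \<rho>) (- s) k * weight \<rho> s k"
    by (simp only: weight_add) (simp add: weight_def powr_numeral)
  finally show "cmod (m (fst k) * c b k) \<le> \<bar>weight (2 - \<rho>) (- s) k\<bar> * \<bar>\<delta> * (weight \<rho> s k * cmod (c b k))\<bar>"
    using multiplier_nonneg[OF m] by (simp add: abs_mult abs_of_pos mult_ac)
qed simp

lemma mode_sum_real:
  assumes m: "multiplier m \<delta>" and b: "b \<in> Basis"
  shows "complex_of_real (Re (mode_sum m (c b) x)) = mode_sum m (c b) x"
  unfolding mode_sum_def
proof (rule of_real_Re_series)
  show "real_vec (snd (- k)) = - real_vec (snd k)" for k :: "('v, 'd) freq"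
    by (simp only: snd_uminus real_vec_simps)
qed (use m real[OF b] in \<open>simp add: multiplier_def\<close>)

lemma continuous_on_field_of: assumes m: "multiplier m \<delta>" shows "continuous_on A (field_of m c)"
  unfolding field_of_def[abs_def] mode_sum_def
  by (intro continuous_intros continuous_on_series summable_modes[OF m])

lemma periodic_field_of: "torus_periodic (field_of m c)"
proof -
  have "periodic (mode_sum m (c b))" for b
    unfolding mode_sum_def using real_vec_lattice by (intro periodic_series) auto
  then show ?thesis
    by (auto simp: torus_periodic_eq_periodic periodic_def field_of_def)
qed

lemma fourier_coeff_field_of:
  assumes m: "multiplier m \<delta>" and b: "b \<in> Basis"
  shows "fourier_coeff (\<lambda>x. field_of m c x \<bullet> b) \<xi> = (\<Sum>\<^sub>\<infinity>l. m l * c b (l, \<xi>))"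
proof -
  have "{k :: ('v, 'd) freq. real_vec (snd k) = real_vec \<xi>} = range (\<lambda>l. (l, \<xi>))"
    by (auto simp: vec_eq_iff prod_eq_iff)
  moreover have "fourier_coeff (\<lambda>x. field_of m c x \<bullet> b) \<xi> = fcoef (mode_sum m (c b)) (real_vec \<xi>)"
  proof -
    have "fourier_coeff (\<lambda>x. field_of m c x \<bullet> b) \<xi> = fcoef (\<lambda>x. complex_of_real (field_of m c x \<bullet> b)) (real_vec \<xi>)"
      by (intro fourier_coeff_continuous continuous_intros continuous_on_field_of[OF m])
    then show ?thesis by (simp only: field_of_inner[OF b] mode_sum_real[OF m b])
  qed
  moreover have "fcoef (mode_sum m (c b)) (real_vec \<xi>) = (\<Sum>\<^sub>\<infinity>k\<in>{k. real_vec (snd k) = real_vec \<xi>}. m (fst k) * c b k)"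
    unfolding mode_sum_def using real_vec_lattice by (intro fcoef_series summable_modes[OF m b]) auto
  moreover have "infsum (\<lambda>k. m (fst k) * c b k) (range (\<lambda>l. (l, \<xi>))) = (\<Sum>\<^sub>\<infinity>l. m l * c b (l, \<xi>))"
    by (subst infsum_reindex) (auto simp: inj_on_def o_def)
  ultimately show ?thesis by simp
qed

text \<open>Cauchy-Schwarz in \<open>l\<close> for each \<xi>: after the multiplier has used up two
  powers, the weight in \<open>l\<close> is still square-summable. Then the squares are summed over
  \<xi>.\<close>

lemma coefficients_bound:
  assumes m: "multiplier m \<delta>" and b: "b \<in> Basis"
  shows "l2_bound (\<lambda>\<xi>. japanese \<xi> powr s * cmod (\<Sum>\<^sub>\<infinity>l. m l * c b (l, \<xi>))) (\<delta> * D * R)"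
proof (rule l2_boundI)
  fix F :: "(int ^ 'd) set" assume F: "finite F"
  define a where "a \<xi> l = weight \<rho> s (l, \<xi>) * cmod (c b (l, \<xi>))" for \<xi> :: "int ^ 'd" and l :: "int ^ 'v"
  have \<delta>: "0 \<le> \<delta>" using multiplier_nonneg[OF m] .
  have D0: "0 \<le> D" using l2_bound_nonneg[OF D] .
  have R0: "0 \<le> R" using l2_bound_nonneg[OF c[OF b]] .
  have row: "l2_bound (a \<xi>) R" for \<xi>
    unfolding a_def using l2_bound_inj[OF c[OF b], of "\<lambda>l. (l, \<xi>)"] by (simp add: inj_on_def)
  have sq: "(\<lambda>l. (a \<xi> l)\<^sup>2) summable_on UNIV" for \<xi>
    by (rule l2_bound_square_summable(1)[OF row])
  \<comment> \<open>The norm of the row itself rather than the common bound \<open>R\<close>, since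
    the squares of these norms must be summable over \<xi>.\<close>
  have row': "l2_bound (a \<xi>) (sqrt (\<Sum>\<^sub>\<infinity>l. (a \<xi> l)\<^sup>2))" for \<xi>
    unfolding l2_bound_def L2_set_def using sq by (auto intro!: finite_sum_le_infsum)
  have le: "(japanese \<xi> powr s * cmod (\<Sum>\<^sub>\<infinity>l. m l * c b (l, \<xi>)))\<^sup>2 \<le> \<delta>\<^sup>2 * D\<^sup>2 * (\<Sum>\<^sub>\<infinity>l. (a \<xi> l)\<^sup>2)" for \<xi>
  proof -
    have pt: "japanese \<xi> powr s * cmod (m l * c b (l, \<xi>)) \<le> \<bar>japanese l powr (2 - \<rho>)\<bar> * \<bar>\<delta> * a \<xi> l\<bar>" for l
    proof -
      have "cmod (m l * c b (l, \<xi>)) \<le> (\<delta> * (japanese l)\<^sup>2) * cmod (c b (l, \<xi>))"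
        using m unfolding norm_mult multiplier_def by (intro mult_right_mono) auto
      also have "(japanese l)\<^sup>2 = japanese l powr (2 - \<rho>) * japanese l powr \<rho>"
        by (simp add: powr_numeral flip: powr_add)
      finally have "japanese \<xi> powr s * cmod (m l * c b (l, \<xi>)) \<le>
          japanese \<xi> powr s * (\<delta> * (japanese l powr (2 - \<rho>) * japanese l powr \<rho>) * cmod (c b (l, \<xi>)))"
        by (rule mult_left_mono) simp
      then show ?thesis
        using \<delta> by (simp add: a_def weight_def abs_mult mult_ac)
    qed
    note CS = l2_Cauchy_Schwarz[OF D l2_bound_scale[OF row', of \<delta> \<xi>] _ pt]
    have summ: "(\<lambda>l. cmod (m l * c b (l, \<xi>))) summable_on UNIV"
      using CS(1) by (simp add: summable_on_cmult_right')
    have "japanese \<xi> powr s * cmod (\<Sum>\<^sub>\<infinity>l. m l * c b (l, \<xi>)) \<le> japanese \<xi> powr s * (\<Sum>\<^sub>\<infinity>l. cmod (m l * c b (l, \<xi>)))"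
      by (intro mult_left_mono norm_infsum_bound summ) auto
    also have "\<dots> \<le> D * (\<delta> * sqrt (\<Sum>\<^sub>\<infinity>l. (a \<xi> l)\<^sup>2))"
      using CS(2) \<delta> by (simp add: infsum_cmult_right')
    finally have "(japanese \<xi> powr s * cmod (\<Sum>\<^sub>\<infinity>l. m l * c b (l, \<xi>)))\<^sup>2 \<le> (D * (\<delta> * sqrt (\<Sum>\<^sub>\<infinity>l. (a \<xi> l)\<^sup>2)))\<^sup>2"
      by (rule power_mono) auto
    then show ?thesis
      by (simp add: power_mult_distrib infsum_nonneg mult_ac)
  qed
  have "(\<Sum>\<xi>\<in>F. \<Sum>\<^sub>\<infinity>l. (a \<xi> l)\<^sup>2) = (\<Sum>\<^sub>\<infinity>l. \<Sum>\<xi>\<in>F. (a \<xi> l)\<^sup>2)"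
    by (rule summable_on_finite_sum(2)[OF F sq, symmetric])
  also have "\<dots> \<le> R\<^sup>2"
  proof (rule nonneg_summable_infsum_le(2))
    fix F' :: "(int ^ 'v) set" assume F': "finite F'"
    have "(\<Sum>l\<in>F'. \<Sum>\<xi>\<in>F. (a \<xi> l)\<^sup>2) = (\<Sum>k\<in>F' \<times> F. (weight \<rho> s k * cmod (c b k))\<^sup>2)"
      by (simp add: sum.cartesian_product a_def case_prod_unfold)
    also have "\<dots> \<le> R\<^sup>2"
      using l2_boundD[OF c[OF b]] F F' by (simp add: sum_square_le_iff_L2_set[OF R0])
    finally show "(\<Sum>l\<in>F'. \<Sum>\<xi>\<in>F. (a \<xi> l)\<^sup>2) \<le> R\<^sup>2" .
  qed (simp add: sum_nonneg)
  finally have "\<delta>\<^sup>2 * D\<^sup>2 * (\<Sum>\<xi>\<in>F. \<Sum>\<^sub>\<infinity>l. (a \<xi> l)\<^sup>2) \<le> \<delta>\<^sup>2 * D\<^sup>2 * R\<^sup>2"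
    by (intro mult_left_mono) auto
  moreover have "(\<Sum>\<xi>\<in>F. (japanese \<xi> powr s * cmod (\<Sum>\<^sub>\<infinity>l. m l * c b (l, \<xi>)))\<^sup>2) \<le>
      (\<Sum>\<xi>\<in>F. \<delta>\<^sup>2 * D\<^sup>2 * (\<Sum>\<^sub>\<infinity>l. (a \<xi> l)\<^sup>2))"
    by (intro sum_mono le)
  ultimately have "(\<Sum>\<xi>\<in>F. (japanese \<xi> powr s * cmod (\<Sum>\<^sub>\<infinity>l. m l * c b (l, \<xi>)))\<^sup>2) \<le> (\<delta> * D * R)\<^sup>2"
    by (simp add: sum_distrib_left[symmetric] power_mult_distrib)
  then show "L2_set (\<lambda>\<xi>. japanese \<xi> powr s * cmod (\<Sum>\<^sub>\<infinity>l. m l * c b (l, \<xi>))) F \<le> \<delta> * D * R"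
    by (subst (asm) sum_square_le_iff_L2_set) (use \<delta> D0 R0 in auto)
qed

definition "K = sqrt DIM('b) * D * R"

lemma
  assumes m: "multiplier m \<delta>"
  shows field_of_sobolev: "field_of m c \<in> sobolev s"
    and sobolev_norm_field_of: "sobolev_norm s (field_of m c) \<le> \<delta> * K"
proof -
  let ?q = "\<delta> * D * R"
  have q: "0 \<le> ?q" using l2_bound_nonneg[OF coefficients_bound[OF m SOME_Basis]] .
  have dens: "sobolev_density s (field_of m c) \<xi> = (\<Sum>b\<in>Basis. (japanese \<xi> powr s * cmod (\<Sum>\<^sub>\<infinity>l. m l * c b (l, \<xi>)))\<^sup>2)" for \<xi>
    by (simp add: sobolev_density_def fourier_coeff_field_of[OF m] sum_distrib_left power_mult_distrib powr_power mult.commute)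
  have "(\<Sum>\<xi>\<in>F. sobolev_density s (field_of m c) \<xi>) \<le> DIM('b) * ?q\<^sup>2" if F: "finite F" for F
  proof -
    have "(\<Sum>\<xi>\<in>F. sobolev_density s (field_of m c) \<xi>) =
        (\<Sum>b\<in>Basis. \<Sum>\<xi>\<in>F. (japanese \<xi> powr s * cmod (\<Sum>\<^sub>\<infinity>l. m l * c b (l, \<xi>)))\<^sup>2)"
      unfolding dens by (rule sum.swap)
    also have "\<dots> \<le> (\<Sum>b\<in>(Basis :: 'b set). ?q\<^sup>2)"
      using l2_boundD[OF coefficients_bound[OF m] F] q by (intro sum_mono) (simp add: sum_square_le_iff_L2_set)
    finally show ?thesis by simp
  qed
  note bound = nonneg_summable_infsum_le[OF sobolev_density_nonneg this]
  have cont: "continuous_on UNIV (field_of m c)" by (rule continuous_on_field_of[OF m])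
  have "set_integrable lborel torus_cell (\<lambda>x. (norm (field_of m c x))\<^sup>2)"
    unfolding torus_cell_eq_cell by (intro integral_eq_LINT continuous_intros cont)
  then show "field_of m c \<in> sobolev s"
    using bound(1) periodic_field_of borel_measurable_continuous_onI[OF cont] by (simp add: sobolev_def)
  have "sobolev_norm s (field_of m c) \<le> sqrt (DIM('b) * ?q\<^sup>2)"
    unfolding sobolev_norm_def using bound(2) by (rule real_sqrt_le_mono)
  also have "\<dots> = \<delta> * K" using q by (simp add: real_sqrt_mult K_def)
  finally show "sobolev_norm s (field_of m c) \<le> \<delta> * K" .
qed

lemma field_of_diff:
  assumes m: "multiplier m \<delta>" "multiplier m' \<delta>'"
  shows "field_of (\<lambda>l. m l - m' l) c x = field_of m c x - field_of m' c x"
proof -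
  have "mode_sum (\<lambda>l. m l - m' l) (c b) x = mode_sum m (c b) x - mode_sum m' (c b) x" if b: "b \<in> Basis" for b
  proof -
    have "mode_sum (\<lambda>l. m l - m' l) (c b) x + mode_sum m' (c b) x = mode_sum m (c b) x"
    proof -
      have "multiplier (\<lambda>l. m l - m' l) (\<delta> + \<delta>')"
        using m norm_triangle_le_diff unfolding multiplier_def by (fastforce simp: distrib_right intro: norm_triangle_le_diff add_mono)
      from series_summable[OF summable_modes[OF this b]] series_summable[OF summable_modes[OF m(2) b]]
      show ?thesis
        unfolding mode_sum_def series_def
        by (subst infsum_add[symmetric]) (auto simp: left_diff_distrib)
    qed
    then show ?thesis by (metis add_diff_cancel_right')
  qed
  then show ?thesis
    by (simp add: field_of_def scaleR_diff_left sum_subtractf)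
qed

lemma field_of_scaleR: "field_of (\<lambda>l. of_real a * m l) c x = a *\<^sub>R field_of m c x"
proof -
  have "mode_sum (\<lambda>l. of_real a * m l) (c b) x = of_real a * mode_sum m (c b) x" for b
    by (simp add: mode_sum_def series_def mult.assoc infsum_cmult_right')
  then show ?thesis
    by (simp add: field_of_def scaleR_sum_right)
qed

text \<open>The difference of two fields is the field of the difference multiplier, which
  \<open>Lip\<close> makes of size |\<psi> - \<phi>|. Continuity is thus Lipschitz
  continuity.\<close>

lemma C0_field_of:
  fixes m :: "real ^ 'v \<Rightarrow> int ^ 'v \<Rightarrow> complex"
  assumes m: "\<And>\<phi>. multiplier (m \<phi>) \<delta>" and per: "torus_periodic m"
    and Lip: "\<And>\<phi> \<psi> l. cmod (m \<psi> l - m \<phi> l) \<le> norm (\<psi> - \<phi>) * (japanese l)\<^sup>2"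
  shows "C0_sobolev s (\<lambda>\<phi>. field_of (m \<phi>) c)" and "C0_norm s (\<lambda>\<phi>. field_of (m \<phi>) c) \<le> \<delta> * K"
proof -
  have "((\<lambda>\<psi>. sobolev_norm s (\<lambda>x. field_of (m \<psi>) c x - field_of (m \<phi>) c x)) \<longlongrightarrow> 0) (at \<phi>)" for \<phi>
  proof (rule Lim_null_comparison)
    have "sobolev_norm s (\<lambda>x. field_of (m \<psi>) c x - field_of (m \<phi>) c x) \<le> norm (\<psi> - \<phi>) * K" for \<psi>
    proof -
      have "multiplier (\<lambda>l. m \<psi> l - m \<phi> l) (norm (\<psi> - \<phi>))"
        using Lip m by (simp add: multiplier_def)
      from sobolev_norm_field_of[OF this] show ?thesis
        unfolding field_of_diff[OF m m, abs_def] .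
    qed
    then show "\<forall>\<^sub>F \<psi> in at \<phi>. norm (sobolev_norm s (\<lambda>x. field_of (m \<psi>) c x - field_of (m \<phi>) c x)) \<le> norm (\<psi> - \<phi>) * K"
      by (simp add: sobolev_norm_nonneg)
    have "((\<lambda>\<psi>. norm (\<psi> - \<phi>) * K) \<longlongrightarrow> norm (\<phi> - \<phi>) * K) (at \<phi>)"
      by (intro tendsto_intros)
    then show "((\<lambda>\<psi>. norm (\<psi> - \<phi>) * K) \<longlongrightarrow> 0) (at \<phi>)" by simp
  qed
  then show "C0_sobolev s (\<lambda>\<phi>. field_of (m \<phi>) c)"
    using per field_of_sobolev[OF m] by (simp add: C0_sobolev_def torus_periodic_def)
  show "C0_norm s (\<lambda>\<phi>. field_of (m \<phi>) c) \<le> \<delta> * K"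
    unfolding C0_norm_def by (rule cSUP_least) (auto intro: sobolev_norm_field_of[OF m])
qed

end

section \<open>Translation and differentiation in the angles as multipliers\<close>

definition phase :: "real ^ 'v \<Rightarrow> int ^ 'v \<Rightarrow> complex" where
  "phase \<phi> l = cis (real_vec l \<bullet> \<phi>)"

definition phase_deriv :: "real ^ 'v \<Rightarrow> real ^ 'v \<Rightarrow> int ^ 'v \<Rightarrow> complex" where
  "phase_deriv v \<phi> l = \<i> * (real_vec l \<bullet> v) * phase \<phi> l"

lemma cmod_phase [simp]: "cmod (phase \<phi> l) = 1"
  by (simp add: phase_def)

lemma phase_uminus: "phase \<phi> (- l) = cnj (phase \<phi> l)"
  unfolding phase_def real_vec_simps by (simp add: cis_cnj)

lemma phase_deriv_uminus: "phase_deriv v \<phi> (- l) = cnj (phase_deriv v \<phi> l)"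
  unfolding phase_deriv_def phase_uminus real_vec_simps by simp

lemma one_le_japanese_square: "1 \<le> (japanese l)\<^sup>2"
  using japanese_ge_1[of l] by (simp add: one_le_power)

lemma japanese_le_square: "japanese l \<le> (japanese l)\<^sup>2"
  using japanese_ge_1[of l] by (simp add: power2_eq_square)

lemma abs_real_vec_inner_le: "\<bar>real_vec l \<bullet> v\<bar> \<le> norm v * japanese l"
proof -
  have "\<bar>real_vec l \<bullet> v\<bar> \<le> norm (real_vec l) * norm v" by (rule Cauchy_Schwarz_ineq2)
  also have "\<dots> \<le> japanese l * norm v" by (intro mult_right_mono) (auto simp: japanese_def)
  finally show ?thesis by (simp add: mult.commute)
qed

lemma multiplier_phase: "multiplier (phase \<phi>) 1"
  by (simp add: multiplier_def phase_uminus one_le_japanese_square)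

lemma multiplier_phase_deriv: "multiplier (phase_deriv v \<phi>) (norm v)"
proof -
  have "\<bar>real_vec l \<bullet> v\<bar> \<le> norm v * (japanese l)\<^sup>2" for l
    using order_trans[OF abs_real_vec_inner_le mult_left_mono[OF japanese_le_square norm_ge_zero]] .
  then show ?thesis
    by (simp add: multiplier_def phase_deriv_uminus) (simp add: phase_deriv_def norm_mult)
qed

lemma phase_diff_le: "cmod (phase \<psi> l - phase \<phi> l) \<le> norm (\<psi> - \<phi>) * japanese l"
proof -
  have "cmod (phase \<psi> l - phase \<phi> l) \<le> \<bar>real_vec l \<bullet> (\<psi> - \<phi>)\<bar>"
    unfolding phase_def inner_diff_right by (rule cis_Lipschitz)
  then show ?thesis using abs_real_vec_inner_le order_trans by blast
qed

lemma phase_deriv_diff_le: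
  assumes "norm v = 1"
  shows "cmod (phase_deriv v \<psi> l - phase_deriv v \<phi> l) \<le> norm (\<psi> - \<phi>) * (japanese l)\<^sup>2"
proof -
  have "phase_deriv v \<psi> l - phase_deriv v \<phi> l = \<i> * (real_vec l \<bullet> v) * (phase \<psi> l - phase \<phi> l)"
    by (simp add: phase_deriv_def right_diff_distrib)
  then have "cmod (phase_deriv v \<psi> l - phase_deriv v \<phi> l) = \<bar>real_vec l \<bullet> v\<bar> * cmod (phase \<psi> l - phase \<phi> l)"
    by (simp add: norm_mult)
  also have "\<dots> \<le> (norm v * japanese l) * (norm (\<psi> - \<phi>) * japanese l)"
    by (intro mult_mono abs_real_vec_inner_le phase_diff_le) auto
  finally show ?thesis using assms by (simp add: power2_eq_square mult_ac)
qed

text \<open>This is \<open>cis_second_order\<close> with y = h (l \<bullet> v), divided by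
  \<open>h\<close>: the square of l \<bullet> v is exactly the growth that a multiplier may
  have.\<close>

lemma phase_quotient_le:
  assumes "h \<noteq> 0"
  shows "cmod (of_real (1 / h) * (phase (\<phi> + h *\<^sub>R v) l - phase \<phi> l) - phase_deriv v \<phi> l) \<le> \<bar>h\<bar> * (norm v)\<^sup>2 * (japanese l)\<^sup>2"
proof -
  let ?a = "real_vec l \<bullet> \<phi>" and ?y = "h * (real_vec l \<bullet> v)"
  have "of_real (1 / h) * (phase (\<phi> + h *\<^sub>R v) l - phase \<phi> l) - phase_deriv v \<phi> l =
      of_real (1 / h) * (cis (?a + ?y) - cis ?a - \<i> * ?y * cis ?a)"
    using assms by (simp add: phase_deriv_def phase_def inner_add_right field_simps)
  then have "cmod (of_real (1 / h) * (phase (\<phi> + h *\<^sub>R v) l - phase \<phi> l) - phase_deriv v \<phi> l)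
      = 1 / \<bar>h\<bar> * cmod (cis (?a + ?y) - cis ?a - \<i> * ?y * cis ?a)"
    by (simp only: norm_mult norm_of_real abs_divide abs_one)
  also have "\<dots> \<le> 1 / \<bar>h\<bar> * ?y\<^sup>2"
    by (intro mult_left_mono cis_second_order) auto
  also have "\<dots> = \<bar>h\<bar> * \<bar>real_vec l \<bullet> v\<bar>\<^sup>2"
    using assms by (simp add: power_mult_distrib power2_eq_square field_simps)
  also have "\<dots> \<le> \<bar>h\<bar> * (norm v * japanese l)\<^sup>2"
    by (intro mult_left_mono power_mono abs_real_vec_inner_le) auto
  finally show ?thesis by (simp add: power_mult_distrib mult.assoc)
qed

lemma phase_periodic: "phase (\<phi> + (2 * pi) *\<^sub>R axis j 1) l = phase \<phi> l"
  using periodic_cis[OF real_vec_lattice[of l]]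
  by (simp add: phase_def torus_periodic_eq_periodic[symmetric] torus_periodic_def)

lemma torus_periodic_phase: "torus_periodic phase"
  by (simp add: torus_periodic_def fun_eq_iff phase_periodic)

lemma torus_periodic_phase_deriv: "torus_periodic (phase_deriv v)"
  by (simp add: torus_periodic_def fun_eq_iff phase_deriv_def phase_periodic)

context sobolev_coefficients
begin

abbreviation U :: "real ^ 'v \<Rightarrow> real ^ 'd \<Rightarrow> 'b" where
  "U \<phi> \<equiv> field_of (phase \<phi>) c"

text \<open>The difference quotient minus the candidate is the field of a multiplier of size |h|
  |v|^2. The direction is arbitrary: coordinate vectors give the partial derivatives, and \<omega>
  gives the time derivative.\<close>

lemma has_sobolev_deriv_field_of:
  "has_sobolev_deriv s (\<lambda>t. U (\<phi> + t *\<^sub>R v)) (field_of (phase_deriv v (\<phi> + t *\<^sub>R v)) c) t"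
  unfolding has_sobolev_deriv_def
proof
  let ?\<phi> = "\<phi> + t *\<^sub>R v"
  let ?V = "field_of (phase_deriv v ?\<phi>) c"
  show "?V \<in> sobolev s" by (rule field_of_sobolev[OF multiplier_phase_deriv])
  let ?q = "\<lambda>h x. (U (\<phi> + (t + h) *\<^sub>R v) x - U ?\<phi> x) /\<^sub>R h - ?V x"
  have le: "norm (sobolev_norm s (?q h)) \<le> (\<bar>h\<bar> * (norm v)\<^sup>2) * K" if h: "h \<noteq> 0" for h
  proof -
    let ?m = "\<lambda>l. of_real (1 / h) * (phase (?\<phi> + h *\<^sub>R v) l - phase ?\<phi> l)"
    have d: "multiplier (\<lambda>l. phase (?\<phi> + h *\<^sub>R v) l - phase ?\<phi> l) (norm (h *\<^sub>R v))"
    proof -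
      have "cmod (phase (?\<phi> + h *\<^sub>R v) l - phase ?\<phi> l) \<le> norm (h *\<^sub>R v) * (japanese l)\<^sup>2" for l
        using order_trans[OF phase_diff_le[of "?\<phi> + h *\<^sub>R v" l ?\<phi>] mult_left_mono[OF japanese_le_square norm_ge_zero]] by simp
      then show ?thesis by (simp add: multiplier_def phase_uminus)
    qed
    have m: "multiplier ?m (\<bar>1 / h\<bar> * norm (h *\<^sub>R v))"
      by (rule multiplier_scale[OF d])
    have "multiplier (\<lambda>l. ?m l - phase_deriv v ?\<phi> l) (\<bar>h\<bar> * (norm v)\<^sup>2)"
      using phase_quotient_le[OF h, of ?\<phi> v] by (simp only: multiplier_def) (simp add: phase_uminus phase_deriv_uminus)
    from sobolev_norm_field_of[OF this]
    have "sobolev_norm s (\<lambda>x. field_of ?m c x - ?V x) \<le> (\<bar>h\<bar> * (norm v)\<^sup>2) * K"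
      unfolding field_of_diff[OF m multiplier_phase_deriv, abs_def] .
    moreover have "field_of ?m c x - ?V x = ?q h x" for x
      unfolding field_of_scaleR field_of_diff[OF multiplier_phase multiplier_phase]
      by (simp add: algebra_simps inverse_eq_divide)
    ultimately show ?thesis by (simp add: sobolev_norm_nonneg)
  qed
  show "((\<lambda>h. sobolev_norm s (?q h)) \<longlongrightarrow> 0) (at 0)"
  proof (rule Lim_null_comparison)
    show "\<forall>\<^sub>F h in at 0. norm (sobolev_norm s (?q h)) \<le> (\<bar>h\<bar> * (norm v)\<^sup>2) * K"
      using eventually_neq_at_within[of 0 0 UNIV] by (rule eventually_mono) (rule le)
    have "((\<lambda>h. (\<bar>h\<bar> * (norm v)\<^sup>2) * K) \<longlongrightarrow> (\<bar>0\<bar> * (norm v)\<^sup>2) * K) (at 0)"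
      by (intro tendsto_intros)
    then show "((\<lambda>h. (\<bar>h\<bar> * (norm v)\<^sup>2) * K) \<longlongrightarrow> 0) (at 0)" by simp
  qed
qed

lemma C0_U: "C0_sobolev s U" and C0_norm_U: "C0_norm s U \<le> K"
proof -
  have Lip: "cmod (phase \<psi> l - phase \<phi> l) \<le> norm (\<psi> - \<phi>) * (japanese l)\<^sup>2" for \<psi> \<phi> and l :: "int ^ 'v"
    using order_trans[OF phase_diff_le mult_left_mono[OF japanese_le_square norm_ge_zero]] .
  show "C0_sobolev s U" "C0_norm s U \<le> K"
    using C0_field_of[OF multiplier_phase torus_periodic_phase Lip] by simp_all
qed

text \<open>The derivative \<open>?W\<close> chosen by \<open>SOME\<close> may differ from the
  explicit \<open>V\<close> as a function, but has the same Fourier coefficients, so continuity and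
  norm bounds carry over.\<close>

lemma C1_U: "C1_sobolev s U" and C1_norm_U: "C1_norm s U \<le> K"
proof -
  define V where "V j \<phi> = field_of (phase_deriv (axis j 1) \<phi>) c" for j \<phi>
  have C0_V: "C0_sobolev s (V j)" "C0_norm s (V j) \<le> K" for j
    unfolding V_def[abs_def]
    using C0_field_of[OF multiplier_phase_deriv[of "axis j 1"] torus_periodic_phase_deriv phase_deriv_diff_le] by simp_all
  have deriv: "has_sobolev_deriv s (\<lambda>h. U (\<phi> + h *\<^sub>R axis j 1)) (V j \<phi>) 0" for j \<phi>
    using has_sobolev_deriv_field_of[of \<phi> "axis j 1" 0] by (simp add: V_def)
  let ?W = "\<lambda>j. sobolev_pderiv s j U"
  have W: "has_sobolev_deriv s (\<lambda>h. U (\<phi> + h *\<^sub>R axis j 1)) (?W j \<phi>) 0" for j \<phi>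
    unfolding sobolev_pderiv_def by (rule someI[of _ "V j \<phi>"]) (rule deriv)
  have W_sobolev: "?W j \<phi> \<in> sobolev s" and V_sobolev: "V j \<phi> \<in> sobolev s" for j \<phi>
    using W deriv unfolding has_sobolev_deriv_def by blast+
  have coeff: "fourier_coeff (\<lambda>x. ?W j \<phi> x \<bullet> b) \<xi> = fourier_coeff (\<lambda>x. V j \<phi> x \<bullet> b) \<xi>" if "b \<in> Basis" for j \<phi> b \<xi>
    using field_of_sobolev[OF multiplier_phase] by (rule sobolev_deriv_coeff_unique[OF _ s that W deriv])
  \<comment> \<open>The choice is periodic because at angles that differ by a period it is made from
    the same predicate, \<open>U\<close> being periodic.\<close>
  have "torus_periodic (?W j)" for j
  proof -
    have "U (\<phi> + (2 * pi) *\<^sub>R axis i 1 + h *\<^sub>R axis j 1) = U (\<phi> + h *\<^sub>R axis j 1)" for \<phi> i h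
    proof -
      have eq: "\<phi> + (2 * pi) *\<^sub>R axis i 1 + h *\<^sub>R axis j 1 = (\<phi> + h *\<^sub>R axis j 1) + (2 * pi) *\<^sub>R axis i 1"
        by (simp only: ac_simps)
      show ?thesis
        unfolding eq using C0_U unfolding C0_sobolev_def torus_periodic_def by blast
    qed
    then show ?thesis by (simp add: torus_periodic_def sobolev_pderiv_def)
  qed
  moreover have "sobolev_norm s (\<lambda>x. ?W j \<psi> x - ?W j \<phi> x) = sobolev_norm s (\<lambda>x. V j \<psi> x - V j \<phi> x)" for j \<phi> \<psi>
    by (rule sobolev_norm_cong) (simp only: fourier_coeff_diff[OF W_sobolev W_sobolev] fourier_coeff_diff[OF V_sobolev V_sobolev] coeff)
  ultimately have C0_W: "C0_sobolev s (?W j)" for j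
    using C0_V(1)[of j] W_sobolev by (simp add: C0_sobolev_def)
  then show "C1_sobolev s U"
    unfolding C1_sobolev_def using C0_U deriv by blast
  have "sobolev_norm s (?W j \<phi>) = sobolev_norm s (V j \<phi>)" for j \<phi>
    by (rule sobolev_norm_cong) (rule coeff)
  then have "C0_norm s (?W j) \<le> K" for j
    using C0_V(2)[of j] by (simp add: C0_norm_def)
  then show "C1_norm s U \<le> K"
    unfolding C1_norm_def using C0_norm_U by (subst Max_le_iff) auto
qed

end

subsection \<open>Decay of the Fourier coefficients of a smooth function\<close>

lemma C_k_imp_continuous: "C_k k f \<Longrightarrow> continuous_on UNIV f"
  by (cases k) (auto intro: continuous_at_imp_continuous_on differentiable_imp_continuous_within)

lemma has_vector_derivative_frechet:
  assumes "f differentiable (at x)"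
  shows "((\<lambda>h. f (x + h *\<^sub>R b)) has_vector_derivative frechet_derivative f (at x) b) (at 0)"
proof -
  have f: "(f has_derivative frechet_derivative f (at x)) (at (x + 0 *\<^sub>R b))"
    using assms by (simp add: frechet_derivative_works)
  have "((\<lambda>h. x + h *\<^sub>R b) has_derivative (\<lambda>h. h *\<^sub>R b)) (at 0)"
    by (auto intro!: derivative_eq_intros)
  from diff_chain_at[OF this f]
  show ?thesis
    using linear_frechet_derivative[OF assms]
    by (simp add: has_vector_derivative_def o_def linear_scale)
qed

lemma periodic_frechet_derivative:
  assumes per: "periodic f" and diff: "\<And>x. f differentiable (at x)"
  shows "periodic (\<lambda>x. frechet_derivative f (at x) v)"
proof -
  have "frechet_derivative f (at (x + (2 * pi) *\<^sub>R b)) = frechet_derivative f (at x)" if b: "b \<in> Basis" for x b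
  proof -
    let ?p = "(2 * pi) *\<^sub>R b"
    have f: "(f has_derivative frechet_derivative f (at (x + ?p))) (at (x + ?p))"
      using diff by (simp add: frechet_derivative_works)
    have "((\<lambda>y. y + ?p) has_derivative (\<lambda>y. y)) (at x)"
      by (auto intro!: derivative_eq_intros)
    from diff_chain_at[OF this f]
    have "(f has_derivative frechet_derivative f (at (x + ?p))) (at x)"
      using per b by (simp add: o_def periodic_def)
    then show ?thesis by (rule frechet_derivative_at)
  qed
  then show ?thesis by (simp add: periodic_def)
qed

text \<open>Each derivative in direction \<open>b\<close> multiplies the coefficient by i (k
  \<bullet> b). After \<open>n\<close> of them Bessel's inequality applies, along the injective
  enumeration \<open>\<kappa>\<close>.\<close>

lemma C_k_fcoef_decay:
  fixes h :: "'a::euclidean_space \<Rightarrow> 'b::real_inner" and \<kappa> :: "'k \<Rightarrow> 'a"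
  assumes \<kappa>: "inj \<kappa>" "range \<kappa> \<subseteq> lattice" and b: "b \<in> Basis"
    and "C_k n h" "periodic h"
  shows "\<exists>B. l2_bound (\<lambda>k. \<bar>\<kappa> k \<bullet> b\<bar> ^ n * cmod (fcoef (\<lambda>x. complex_of_real (h x \<bullet> e)) (\<kappa> k))) B"
  using assms(4,5)
proof (induction n arbitrary: h)
  case 0
  let ?g = "\<lambda>x. complex_of_real (h x \<bullet> e)"
  have cont: "continuous_on UNIV ?g"
    using 0 by (auto intro!: continuous_intros)
  let ?B = "integral cell (\<lambda>x. (cmod (?g x))\<^sup>2) / (2 * pi) ^ DIM('a)"
  have "L2_set (\<lambda>k. cmod (fcoef ?g (\<kappa> k))) F \<le> sqrt ?B" if "finite F" for F
  proof -
    have "(\<Sum>k\<in>F. (cmod (fcoef ?g (\<kappa> k)))\<^sup>2) = (\<Sum>k\<in>\<kappa> ` F. (cmod (fcoef ?g k))\<^sup>2)"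
      using \<kappa>(1) by (subst sum.reindex) (auto intro: inj_on_subset)
    also have "\<dots> \<le> ?B"
      using that \<kappa>(2) by (intro Bessel[OF cont]) auto
    finally show ?thesis unfolding L2_set_def by (rule real_sqrt_le_mono)
  qed
  then show ?case by (auto simp: l2_bound_def)
next
  case (Suc n)
  let ?h' = "\<lambda>x. frechet_derivative h (at x) b"
  let ?g = "\<lambda>x. complex_of_real (h x \<bullet> e)" and ?g' = "\<lambda>x. complex_of_real (?h' x \<bullet> e)"
  have diff: "h differentiable (at x)" for x using Suc.prems by simp
  have C: "C_k n ?h'" using Suc.prems by simp
  obtain B where B: "l2_bound (\<lambda>k. \<bar>\<kappa> k \<bullet> b\<bar> ^ n * cmod (fcoef ?g' (\<kappa> k))) B"
    using Suc.IH[OF C periodic_frechet_derivative[OF Suc.prems(2) diff]] by blast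
  have "fcoef ?g' (\<kappa> k) = \<i> * (\<kappa> k \<bullet> b) * fcoef ?g (\<kappa> k)" for k
  proof (rule fcoef_derivative[OF _ _ _ b])
    show "continuous_on UNIV ?g" "continuous_on UNIV ?g'"
      by (intro continuous_intros C_k_imp_continuous[OF Suc.prems(1)] C_k_imp_continuous[OF C])+
    show "periodic ?g" using Suc.prems(2) by (simp add: periodic_def)
    show "\<kappa> k \<in> lattice" using \<kappa>(2) by auto
    show "((\<lambda>t. ?g (x + t *\<^sub>R b)) has_vector_derivative ?g' x) (at 0)" for x
    proof -
      have "bounded_linear (\<lambda>y. complex_of_real (y \<bullet> e))"
        by (rule bounded_linear_compose[OF bounded_linear_of_real bounded_linear_inner_left])
      from bounded_linear.has_vector_derivative[OF this has_vector_derivative_frechet[OF diff]]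
      show ?thesis .
    qed
  qed
  then have "\<bar>\<kappa> k \<bullet> b\<bar> ^ Suc n * cmod (fcoef ?g (\<kappa> k)) = \<bar>\<kappa> k \<bullet> b\<bar> ^ n * cmod (fcoef ?g' (\<kappa> k))" for k
    by (simp add: norm_mult)
  then show ?case using B by (intro exI[of _ B]) (simp only:)
qed

text \<open>With \<open>t\<close> the largest of 1 and the x_i, the left base is at most (1 + card
  I) t, and t^n is one of the terms on the right. It spares mixed derivatives below.\<close>

lemma sum_power_le:
  fixes x :: "'i \<Rightarrow> real"
  assumes I: "finite I" and x: "\<And>i. i \<in> I \<Longrightarrow> 0 \<le> x i"
  shows "(1 + (\<Sum>i\<in>I. x i)) ^ n \<le> (1 + real (card I)) ^ n * (1 + (\<Sum>i\<in>I. x i ^ n))"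
proof -
  define t where "t = Max (insert 1 (x ` I))"
  have t: "1 \<le> t" "\<And>i. i \<in> I \<Longrightarrow> x i \<le> t" using I by (auto simp: t_def)
  have "(\<Sum>i\<in>I. x i) \<le> real (card I) * t" using sum_bounded_above[of I x t] t by simp
  then have "1 + (\<Sum>i\<in>I. x i) \<le> (1 + real (card I)) * t" using t by (simp add: distrib_right)
  then have "(1 + (\<Sum>i\<in>I. x i)) ^ n \<le> (1 + real (card I)) ^ n * t ^ n"
    unfolding power_mult_distrib[symmetric] using x by (intro power_mono) (auto intro!: add_nonneg_nonneg sum_nonneg)
  moreover have "t ^ n \<le> 1 + (\<Sum>i\<in>I. x i ^ n)"
  proof -
    have "t \<in> insert 1 (x ` I)" unfolding t_def using I by (intro Max_in) auto
    then consider "t = 1" | i where "i \<in> I" "t = x i" by auto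
    then show ?thesis
    proof cases
      case 1
      then show ?thesis using x by (simp add: sum_nonneg)
    next
      case (2 i)
      then show ?thesis using member_le_sum[of i I "\<lambda>i. x i ^ n"] I x by simp
    qed
  qed
  ultimately show ?thesis
    by (meson mult_left_mono order_trans zero_le_power add_nonneg_nonneg of_nat_0_le_iff zero_le_one)
qed

text \<open>Both brackets are at most one plus the l1 norm of the joint frequency, so only the sum
  of the two real exponents has to be at most \<open>n\<close>.\<close>

lemma weight_le_power:
  assumes "0 \<le> a" "0 \<le> b" "a + b \<le> real n"
  shows "weight a b k \<le> (1 + (\<Sum>i\<in>Basis. \<bar>lat k \<bullet> i\<bar>)) ^ n"
proof -
  let ?S = "1 + (\<Sum>i\<in>Basis. \<bar>lat k \<bullet> i\<bar>)"
  have S1: "1 \<le> ?S" by (simp add: sum_nonneg)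
  have "norm (lat k) \<le> (\<Sum>i\<in>Basis. \<bar>lat k \<bullet> i\<bar>)" by (rule norm_le_l1)
  moreover have "norm (real_vec (fst k)) \<le> norm (lat k)" "norm (real_vec (snd k)) \<le> norm (lat k)"
    using norm_fst_le[of "real_vec (fst k)" "real_vec (snd k)"] norm_snd_le[of "real_vec (snd k)" "real_vec (fst k)"]
    by (simp_all add: lat_def)
  ultimately have "japanese (fst k) \<le> ?S" "japanese (snd k) \<le> ?S"
    using S1 by (auto simp: japanese_def)
  then have "weight a b k \<le> ?S powr a * ?S powr b"
    unfolding weight_def using assms by (intro mult_mono powr_mono2) auto
  also have "\<dots> = ?S powr (a + b)" by (simp add: powr_add)
  also have "\<dots> \<le> ?S powr real n" using assms S1 by (intro powr_mono) auto
  also have "\<dots> = ?S ^ n" using S1 by (intro powr_realpow) linarith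
  finally show ?thesis .
qed

text \<open>By \<open>weight_le_power\<close> and \<open>sum_power_le\<close> the weight is
  dominated by 1 and the n-th powers of the single coordinates, so pure derivatives along basis
  vectors suffice.\<close>

lemma C_k_weighted_decay:
  fixes h :: "(real ^ 'v::finite) \<times> (real ^ 'd::finite) \<Rightarrow> 'b::real_inner"
  assumes C: "C_k n h" and per: "periodic h" and ab: "0 \<le> a" "0 \<le> b" "a + b \<le> real n"
  shows "\<exists>B. l2_bound (\<lambda>k. weight a b k * cmod (fcoef (\<lambda>z. complex_of_real (h z \<bullet> e)) (lat k))) B"
proof -
  let ?B = "Basis :: ((real ^ 'v) \<times> (real ^ 'd)) set"
  define c where "c k = cmod (fcoef (\<lambda>z. complex_of_real (h z \<bullet> e)) (lat k))" for k :: "('v, 'd) freq"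
  have lat: "inj (lat :: ('v, 'd) freq \<Rightarrow> _)" "range (lat :: ('v, 'd) freq \<Rightarrow> _) \<subseteq> lattice"
    using inj_lat range_lat by auto
  have "\<forall>i\<in>?B. \<exists>B. l2_bound (\<lambda>k :: ('v, 'd) freq. \<bar>lat k \<bullet> i\<bar> ^ n * c k) B"
    unfolding c_def by (intro ballI C_k_fcoef_decay[OF lat _ C per])
  from bchoice[OF this] obtain B
    where B: "\<And>i. i \<in> ?B \<Longrightarrow> l2_bound (\<lambda>k :: ('v, 'd) freq. \<bar>lat k \<bullet> i\<bar> ^ n * c k) (B i)"
    by blast
  obtain i0 where i0: "i0 \<in> ?B" using nonempty_Basis by blast
  have "C_k 0 h" using C_k_imp_continuous[OF C] by simp
  then obtain B0 where B0: "l2_bound (\<lambda>k :: ('v, 'd) freq. c k) B0"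
    using C_k_fcoef_decay[OF lat i0 _ per, of 0 e] by (auto simp: c_def)
  let ?C = "(1 + real (card ?B)) ^ n"
  have "l2_bound (\<lambda>k. ?C * (c k + (\<Sum>i\<in>?B. \<bar>lat k \<bullet> i\<bar> ^ n * c k))) (\<bar>?C\<bar> * (B0 + (\<Sum>i\<in>?B. B i)))"
    by (intro l2_bound_scale l2_bound_add B0 l2_bound_sum B finite_Basis)
  then have "l2_bound (\<lambda>k. weight a b k * c k) (\<bar>?C\<bar> * (B0 + (\<Sum>i\<in>?B. B i)))"
  proof (rule l2_bound_mono)
    fix k :: "('v, 'd) freq"
    have "weight a b k \<le> ?C * (1 + (\<Sum>i\<in>?B. \<bar>lat k \<bullet> i\<bar> ^ n))"
      using weight_le_power[OF ab, of k] sum_power_le[of ?B "\<lambda>i. \<bar>lat k \<bullet> i\<bar>" n] by simp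
    then have "weight a b k * c k \<le> (?C * (1 + (\<Sum>i\<in>?B. \<bar>lat k \<bullet> i\<bar> ^ n))) * c k"
      by (rule mult_right_mono) (simp add: c_def)
    also have "\<dots> = ?C * (c k + (\<Sum>i\<in>?B. \<bar>lat k \<bullet> i\<bar> ^ n * c k))"
      by (simp add: distrib_right distrib_left sum_distrib_right mult.assoc)
    finally show "\<bar>weight a b k * c k\<bar> \<le> ?C * (c k + (\<Sum>i\<in>?B. \<bar>lat k \<bullet> i\<bar> ^ n * c k))"
      by (simp add: abs_mult abs_of_pos c_def)
  qed simp
  then show ?thesis unfolding c_def by blast
qed

subsection \<open>Weak derivatives of Fourier series\<close>

text \<open>Integrated against a test function, the series may be treated term by term, and each
  exponential is integrated by parts exactly. Absolute convergence of both series is enough.\<close>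

lemma has_weak_pderiv_series:
  fixes \<kappa> :: "'k \<Rightarrow> real ^ 'd"
  assumes c: "(\<lambda>k. cmod (c k)) summable_on UNIV" and c': "(\<lambda>k. cmod (\<i> * (\<kappa> k $ j) * c k)) summable_on UNIV"
    and \<kappa>: "range \<kappa> \<subseteq> lattice"
  shows "has_weak_pderiv j (\<lambda>x. Re (series \<kappa> c x)) (\<lambda>x. Re (series \<kappa> (\<lambda>k. \<i> * (\<kappa> k $ j) * c k) x))"
proof -
  let ?v = "series \<kappa> c" and ?w = "series \<kappa> (\<lambda>k. \<i> * (\<kappa> k $ j) * c k)"
  have cont: "continuous_on UNIV ?v" "continuous_on UNIV ?w"
    by (intro continuous_on_series c c')+
  have ok: "torus_periodic (\<lambda>x. Re (q x)) \<and> (\<lambda>x. Re (q x)) \<in> borel_measurable borel \<and> set_integrable lborel torus_cell (\<lambda>x. Re (q x))"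
    if "continuous_on UNIV q" "periodic q" for q :: "real ^ 'd \<Rightarrow> complex"
  proof (intro conjI)
    have cont: "continuous_on UNIV (\<lambda>x. Re (q x))" using that(1) by (intro continuous_intros)
    show "torus_periodic (\<lambda>x. Re (q x))" using that(2) by (simp add: torus_periodic_eq_periodic periodic_def)
    show "(\<lambda>x. Re (q x)) \<in> borel_measurable borel" by (rule borel_measurable_continuous_onI[OF cont])
    show "set_integrable lborel torus_cell (\<lambda>x. Re (q x))"
      unfolding torus_cell_eq_cell by (rule integral_eq_LINT(1)[OF cont])
  qed
  have "(LINT x:torus_cell|lborel. Re (?v x) * frechet_derivative \<theta> (at x) (axis j 1)) =
      - (LINT x:torus_cell|lborel. Re (?w x) * \<theta> x)"
    if \<theta>: "torus_periodic \<theta>" "\<And>k. C_k k \<theta>" for \<theta> :: "real ^ 'd \<Rightarrow> real"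
  proof -
    let ?\<theta>' = "\<lambda>x. frechet_derivative \<theta> (at x) (axis j 1)"
    have diff: "\<theta> differentiable (at x)" for x using \<theta>(2)[of 1] by simp
    have c\<theta>: "continuous_on UNIV \<theta>" by (rule C_k_imp_continuous[OF \<theta>(2)])
    have c\<theta>': "continuous_on UNIV ?\<theta>'" using \<theta>(2)[of "Suc 0"] by simp
    have b: "axis j 1 \<in> (Basis :: (real ^ 'd) set)" by simp
    have Re_integral: "integral cell (\<lambda>x. Re (q x) * r x) = Re (integral cell (\<lambda>x. q x * complex_of_real (r x)))"
      if "continuous_on UNIV q" "continuous_on UNIV r" for q :: "real ^ 'd \<Rightarrow> complex" and r
    proof -
      have "(\<lambda>x. q x * complex_of_real (r x)) integrable_on cell"
        by (intro integrable_continuous continuous_intros continuous_on_subset[OF that(1)] continuous_on_subset[OF that(2)]) auto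
      from integral_linear[OF this bounded_linear_Re] show ?thesis by (simp add: o_def)
    qed
    have parts: "integral cell (\<lambda>x. cis (\<kappa> k \<bullet> x) * complex_of_real (?\<theta>' x)) =
        - (\<i> * (\<kappa> k $ j)) * integral cell (\<lambda>x. cis (\<kappa> k \<bullet> x) * complex_of_real (\<theta> x))" for k
    proof -
      have "integral cell (\<lambda>x. complex_of_real (?\<theta>' x) * cis (\<kappa> k \<bullet> x)) =
          - \<i> * (\<kappa> k \<bullet> axis j 1) * integral cell (\<lambda>x. complex_of_real (\<theta> x) * cis (\<kappa> k \<bullet> x))"
      proof (rule integral_cell_by_parts[OF _ _ _ b])
        show "((\<lambda>h. complex_of_real (\<theta> (x + h *\<^sub>R axis j 1))) has_vector_derivative complex_of_real (?\<theta>' x)) (at 0)" for x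
          using bounded_linear.has_vector_derivative[OF bounded_linear_of_real has_vector_derivative_frechet[OF diff]] .
        show "periodic (\<lambda>x. complex_of_real (\<theta> x))"
          using \<theta>(1) by (simp add: torus_periodic_eq_periodic periodic_def)
        show "\<kappa> k \<in> lattice" using \<kappa> by auto
      qed (intro continuous_intros c\<theta> c\<theta>')+
      then show ?thesis by (simp add: inner_axis mult.commute)
    qed
    have "integral cell (\<lambda>x. ?v x * complex_of_real (?\<theta>' x)) =
        (\<Sum>\<^sub>\<infinity>k. c k * (- (\<i> * (\<kappa> k $ j)) * integral cell (\<lambda>x. cis (\<kappa> k \<bullet> x) * complex_of_real (\<theta> x))))"
      unfolding parts[symmetric]
      by (rule infsumI[symmetric], rule integral_series_mult[OF c])
         (intro continuous_intros continuous_on_subset[OF c\<theta>'] subset_UNIV)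
    also have "\<dots> = - (\<Sum>\<^sub>\<infinity>k. (\<i> * (\<kappa> k $ j) * c k) * integral cell (\<lambda>x. cis (\<kappa> k \<bullet> x) * complex_of_real (\<theta> x)))"
      by (simp add: mult_ac flip: infsum_uminus)
    also have "(\<Sum>\<^sub>\<infinity>k. (\<i> * (\<kappa> k $ j) * c k) * integral cell (\<lambda>x. cis (\<kappa> k \<bullet> x) * complex_of_real (\<theta> x))) =
        integral cell (\<lambda>x. ?w x * complex_of_real (\<theta> x))"
      by (rule infsumI, rule integral_series_mult[OF c'])
         (intro continuous_intros continuous_on_subset[OF c\<theta>] subset_UNIV)
    finally have "integral cell (\<lambda>x. Re (?v x) * ?\<theta>' x) = - integral cell (\<lambda>x. Re (?w x) * \<theta> x)"
      by (simp add: Re_integral cont c\<theta> c\<theta>')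
    moreover have "(LINT x:torus_cell|lborel. Re (?v x) * ?\<theta>' x) = integral cell (\<lambda>x. Re (?v x) * ?\<theta>' x)"
      "(LINT x:torus_cell|lborel. Re (?w x) * \<theta> x) = integral cell (\<lambda>x. Re (?w x) * \<theta> x)"
      unfolding torus_cell_eq_cell by (intro integral_eq_LINT(2) continuous_intros cont c\<theta> c\<theta>')+
    ultimately show ?thesis by simp
  qed
  then show ?thesis
    using ok[OF cont(1) periodic_series[OF \<kappa>]] ok[OF cont(2) periodic_series[OF \<kappa>]]
    unfolding has_weak_pderiv_def by blast
qed

subsection \<open>From the coefficients to the solution\<close>

lemma series_lat: "series lat c (\<phi>, x) = mode_sum (phase \<phi>) c x"
  by (simp add: series_def mode_sum_def lat_def phase_def mult_ac cis_mult)

lemma series_add: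
  assumes "(\<lambda>k. cmod (a k)) summable_on UNIV" "(\<lambda>k. cmod (b k)) summable_on UNIV"
  shows "series \<kappa> (\<lambda>k. a k + b k) x = series \<kappa> a x + series \<kappa> b x"
  unfolding series_def distrib_right
  by (rule infsum_add[OF series_summable[OF assms(1)] series_summable[OF assms(2)]])

lemma abs_summable_add:
  fixes a b :: "'k \<Rightarrow> 'b::real_normed_vector"
  assumes "(\<lambda>k. norm (a k)) summable_on A" "(\<lambda>k. norm (b k)) summable_on A"
  shows "(\<lambda>k. norm (a k + b k)) summable_on A"
  by (rule Infinite_Sum.abs_summable_on_comparison_test'[OF summable_on_add[OF assms]]) (rule norm_triangle_ineq)

lemma abs_summable_sum:
  fixes a :: "'i \<Rightarrow> 'k \<Rightarrow> 'b::real_normed_vector"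
  assumes "finite I" "\<And>i. i \<in> I \<Longrightarrow> (\<lambda>k. norm (a i k)) summable_on A"
  shows "(\<lambda>k. norm (\<Sum>i\<in>I. a i k)) summable_on A"
  by (rule Infinite_Sum.abs_summable_on_comparison_test'[OF summable_on_finite_sum(1)[of I "\<lambda>i k. norm (a i k)", OF assms]]) (auto intro: norm_sum)

lemma series_sum:
  assumes "finite I" "\<And>i. i \<in> I \<Longrightarrow> (\<lambda>k. cmod (a i k)) summable_on UNIV"
  shows "series \<kappa> (\<lambda>k. \<Sum>i\<in>I. a i k) x = (\<Sum>i\<in>I. series \<kappa> (a i) x)"
  unfolding series_def sum_distrib_right
  by (rule summable_on_finite_sum(2)[OF assms(1) series_summable[OF assms(2)]])

lemma series_uminus: "series \<kappa> (\<lambda>k. - a k) x = - series \<kappa> a x"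
  by (simp add: series_def infsum_uminus)

lemma has_weak_pderiv_series_lat:
  fixes c :: "('v::finite, 'd::finite) freq \<Rightarrow> complex"
  assumes c: "(\<lambda>k. cmod (c k)) summable_on UNIV" and c': "(\<lambda>k. cmod (\<i> * of_int (snd k $ j) * c k)) summable_on UNIV"
  shows "has_weak_pderiv j (\<lambda>x. Re (series lat c (\<phi>, x))) (\<lambda>x. Re (series lat (\<lambda>k. \<i> * of_int (snd k $ j) * c k) (\<phi>, x)))"
proof -
  have "has_weak_pderiv j (\<lambda>x. Re (series (\<lambda>k. real_vec (snd k)) (\<lambda>k. phase \<phi> (fst k) * c k) x))
      (\<lambda>x. Re (series (\<lambda>k. real_vec (snd k)) (\<lambda>k. \<i> * (real_vec (snd k) $ j) * (phase \<phi> (fst k) * c k)) x))"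
    using c c' real_vec_lattice by (intro has_weak_pderiv_series) (auto simp: norm_mult)
  also have "(\<lambda>k. \<i> * (real_vec (snd k) $ j) * (phase \<phi> (fst k) * c k)) =
      (\<lambda>k. phase \<phi> (fst k) * (\<i> * of_int (snd k $ j) * c k))"
    by (simp add: fun_eq_iff)
  finally show ?thesis
    unfolding series_lat mode_sum_def .
qed

text \<open>The weight \<open>weight 1 2\<close> pays for one time derivative and two space
  derivatives of \<open>u\<close>, and \<open>weight 0 1\<close> for one space derivative of
  \<open>p\<close>. All series then converge absolutely, and summing the coefficient identity gives
  the equation at every point.\<close>

lemma navier_stokes_of_coefficients:
  fixes A G :: "('v::finite, 'd::finite) freq \<Rightarrow> complex ^ 'd" and P :: "('v, 'd) freq \<Rightarrow> complex"
    and \<omega> :: "real ^ 'v" and u g :: "real \<Rightarrow> real ^ 'd \<Rightarrow> real ^ 'd" and p :: "real \<Rightarrow> real ^ 'd \<Rightarrow> real"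
  assumes A: "(\<lambda>k. weight 1 2 k * norm (A k)) summable_on UNIV"
    and P: "(\<lambda>k. weight 0 1 k * cmod (P k)) summable_on UNIV"
    and AA: "\<And>k. (\<lambda>j. xi_dot (snd k) (A j) *s A (k - j)) summable_on UNIV"
    and sym: "\<And>k. A (- k) = vcnj (A k)"
    and div: "\<And>k. xi_dot (snd k) (A k) = 0"
    and eqn: "\<And>k. heat_symbol \<omega> k *s A k + \<i> *s conv A A k + (\<i> * P k) *s cvec (snd k) = G k"
    and u: "\<And>t x i. u t x $ i = Re (series lat (\<lambda>k. A k $ i) (t *\<^sub>R \<omega>, x))"
    and p: "\<And>t x. p t x = Re (series lat P (t *\<^sub>R \<omega>, x))"
    and g: "\<And>t x i. g t x $ i = Re (series lat (\<lambda>k. G k $ i) (t *\<^sub>R \<omega>, x))"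
    and ut: "\<And>t. has_sobolev_deriv s u (ut t) t"
      "\<And>t x i. ut t x $ i = Re (series lat (\<lambda>k. \<i> * (\<omega> \<bullet> real_vec (fst k)) * A k $ i) (t *\<^sub>R \<omega>, x))"
  shows "navier_stokes_solution s u p g"
proof -
  have dom: "(\<lambda>k. cmod (a k)) summable_on UNIV" if "\<And>k. cmod (a k) \<le> B * (weight 1 2 k * norm (A k))"
    for a :: "('v, 'd) freq \<Rightarrow> complex" and B
    by (rule Infinite_Sum.abs_summable_on_comparison_test'[OF summable_on_cmult_right[OF A]]) (rule that)
  have w1: "1 \<le> weight 1 2 k" "\<bar>real_of_int (snd k $ j)\<bar> \<le> weight 1 2 k" "\<bar>real_of_int (snd k $ j)\<bar>\<^sup>2 \<le> weight 1 2 k"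
      "japanese (fst k) \<le> weight 1 2 k" for k :: "('v, 'd) freq" and j
  proof -
    have J: "1 \<le> japanese (fst k)" "1 \<le> japanese (snd k)" by (rule japanese_ge_1)+
    have w: "weight 1 2 k = japanese (fst k) * (japanese (snd k))\<^sup>2"
      by (simp add: weight_def powr_numeral)
    have n: "\<bar>real_of_int (snd k $ j)\<bar> \<le> japanese (snd k)"
      using component_le_norm_cart[of "real_vec (snd k)" j] by (simp add: japanese_def)
    have sq: "(japanese (snd k))\<^sup>2 \<le> weight 1 2 k"
      using mult_right_mono[OF J(1), of "(japanese (snd k))\<^sup>2"] by (simp add: w)
    show "japanese (fst k) \<le> weight 1 2 k"
      using mult_left_mono[OF one_le_power[OF J(2)], of "japanese (fst k)" 2] by (simp add: w)
    then show "1 \<le> weight 1 2 k" using J(1) by linarith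
    show "\<bar>real_of_int (snd k $ j)\<bar>\<^sup>2 \<le> weight 1 2 k"
      using power_mono[OF n, of 2] sq by simp
    show "\<bar>real_of_int (snd k $ j)\<bar> \<le> weight 1 2 k"
      using n japanese_le_square[of "snd k"] sq by linarith
  qed
  have Ai: "cmod (A k $ i) \<le> norm (A k)" for k i
    by (rule Finite_Cartesian_Product.norm_nth_le)
  have S0: "(\<lambda>k. cmod (A k $ i)) summable_on UNIV" for i
    using mult_mono[OF w1(1) Ai] by (intro dom[of _ 1]) (simp add: less_imp_le)
  have S1: "(\<lambda>k. cmod (\<i> * of_int (snd k $ j) * A k $ i)) summable_on UNIV" for i j
    using mult_mono[OF w1(2) Ai] by (intro dom[of _ 1]) (simp add: norm_mult less_imp_le)
  have S2: "(\<lambda>k. cmod (\<i> * of_int (snd k $ j) * (\<i> * of_int (snd k $ j) * A k $ i))) summable_on UNIV" for i j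
    using mult_mono[OF w1(3) Ai]
    by (intro dom[of _ 1]) (simp add: norm_mult less_imp_le power2_eq_square mult.assoc[symmetric])
  have St: "(\<lambda>k. cmod (\<i> * (\<omega> \<bullet> real_vec (fst k)) * A k $ i)) summable_on UNIV" for i
  proof (rule dom[of _ "norm \<omega>"])
    fix k :: "('v, 'd) freq"
    have "\<bar>\<omega> \<bullet> real_vec (fst k)\<bar> \<le> norm \<omega> * weight 1 2 k"
      using abs_real_vec_inner_le[of "fst k" \<omega>] mult_left_mono[OF w1(4)[of k] norm_ge_zero[of \<omega>]] by (simp add: inner_commute)
    then show "cmod (\<i> * (\<omega> \<bullet> real_vec (fst k)) * A k $ i) \<le> norm \<omega> * (weight 1 2 k * norm (A k))"
      using Ai[of k i] mult_mono by (fastforce simp: norm_mult mult.assoc[symmetric])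
  qed
  have Pw: "1 \<le> weight 0 1 k" "\<bar>real_of_int (snd k $ j)\<bar> \<le> weight 0 1 k" for k :: "('v, 'd) freq" and j
    using japanese_ge_1[of "snd k"] component_le_norm_cart[of "real_vec (snd k)" j]
    by (auto simp: weight_def japanese_def)
  have P0: "(\<lambda>k. cmod (P k)) summable_on UNIV"
    using mult_right_mono[OF Pw(1), of "cmod (P _)"] by (intro Infinite_Sum.abs_summable_on_comparison_test'[OF P]) simp
  have P1: "(\<lambda>k. cmod (\<i> * of_int (snd k $ j) * P k)) summable_on UNIV" for j
    using mult_right_mono[OF Pw(2), of "cmod (P _)"] by (intro Infinite_Sum.abs_summable_on_comparison_test'[OF P]) (simp add: norm_mult)
  \<comment> \<open>Without imaginary parts, the real part of a product with \<open>u\<close> is the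
    product of the real parts; the transport term needs this.\<close>
  have real: "Im (series lat (\<lambda>k. A k $ i) z) = 0" for i z
    using cnj_series[of lat "\<lambda>k. A k $ i" z] by (simp add: lat_uminus sym vcnj_def complex_eq_iff)
  let ?B = "\<lambda>i j k. \<i> * of_int (snd k $ j) * A k $ i"
  let ?N = "\<lambda>i j k. \<Sum>\<^sub>\<infinity>l. A l $ j * ?B i j (k - l)"
  note mult = series_mult[OF lat_diff S0 S1]
  have N: "(\<Sum>j\<in>UNIV. ?N i j k) = \<i> * conv A A k $ i" for i k
  proof -
    have "(\<Sum>j\<in>UNIV. ?N i j k) = (\<Sum>\<^sub>\<infinity>l. \<Sum>j\<in>UNIV. A l $ j * ?B i j (k - l))"
      by (rule summable_on_finite_sum(2)[symmetric]) (use mult(3) in auto)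
    also have "\<dots> = (\<Sum>\<^sub>\<infinity>l. \<i> * ((xi_dot (snd k) (A l) *s A (k - l)) $ i))"
    proof (rule infsum_cong)
      fix l
      \<comment> \<open>The derivative falls on the second factor, with frequency k - l. The
        contribution of \<open>l\<close> is the divergence of the first factor, hence 0, and the
        frequency \<open>k\<close> of \<open>conv\<close> remains.\<close>
      have "(\<Sum>j\<in>UNIV. A l $ j * ?B i j (k - l)) = \<i> * (xi_dot (snd k) (A l) - xi_dot (snd l) (A l)) * A (k - l) $ i"
        by (simp add: xi_dot_def sum_distrib_left sum_distrib_right sum_subtractf[symmetric] algebra_simps)
      then show "(\<Sum>j\<in>UNIV. A l $ j * ?B i j (k - l)) = \<i> * ((xi_dot (snd k) (A l) *s A (k - l)) $ i)"
        by (simp add: div)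
    qed
    also have "\<dots> = \<i> * conv A A k $ i"
      using infsumI[OF has_sum_bounded_linear[OF bounded_linear_vec_nth has_sum_infsum[OF AA[of k]], of i]]
      by (simp add: o_def infsum_cmult_right' conv_def)
    finally show ?thesis .
  qed
  \<comment> \<open>The symbol is expanded into products of the factors i \<xi>_j, so that each
    summand is the coefficient of one series in the pointwise equation.\<close>
  have G: "G k $ i = \<i> * (\<omega> \<bullet> real_vec (fst k)) * A k $ i + (\<Sum>j\<in>UNIV. - (\<i> * of_int (snd k $ j) * ?B i j k))
      + (\<Sum>j\<in>UNIV. ?N i j k) + \<i> * of_int (snd k $ i) * P k" for k i
  proof -
    have sq: "(norm (real_vec (snd k)))\<^sup>2 = (\<Sum>j\<in>UNIV. (real_of_int (snd k $ j))\<^sup>2)"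
      by (simp add: norm_vec_def L2_set_def sum_nonneg)
    have "complex_of_real ((norm (real_vec (snd k)))\<^sup>2) * A k $ i = (\<Sum>j\<in>UNIV. - (\<i> * of_int (snd k $ j) * ?B i j k))"
    proof -
      have "- (\<i> * of_int (snd k $ j) * ?B i j k) = complex_of_real ((real_of_int (snd k $ j))\<^sup>2) * A k $ i" for j
        by (simp add: complex_eq_iff power2_eq_square algebra_simps)
      then show ?thesis using sq by (simp add: sum_distrib_right)
    qed
    then show ?thesis
      unfolding N eqn[of k, symmetric] by (simp add: heat_symbol_def cvec_def distrib_right)
  qed
  show ?thesis
    unfolding navier_stokes_solution_def
  proof (rule allI)
    fix t
    let ?S = "\<lambda>c x. series lat c (t *\<^sub>R \<omega>, x)"
    let ?D = "\<lambda>i j x. Re (?S (?B i j) x)"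
    let ?D2 = "\<lambda>i j x. Re (?S (\<lambda>k. \<i> * of_int (snd k $ j) * ?B i j k) x)"
    let ?Dp = "\<lambda>i x. Re (?S (\<lambda>k. \<i> * of_int (snd k $ i) * P k) x)"
    have "ut t x $ i - (\<Sum>j\<in>UNIV. ?D2 i j x) + (\<Sum>j\<in>UNIV. u t x $ j * ?D i j x) + ?Dp i x = g t x $ i" for x i
    proof -
      have "?S (\<lambda>k. G k $ i) x = ?S (\<lambda>k. \<i> * (\<omega> \<bullet> real_vec (fst k)) * A k $ i) x
          + (\<Sum>j\<in>UNIV. - ?S (\<lambda>k. \<i> * of_int (snd k $ j) * ?B i j k) x)
          + (\<Sum>j\<in>UNIV. ?S (?N i j) x) + ?S (\<lambda>k. \<i> * of_int (snd k $ i) * P k) x"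
      proof -
        have s2: "(\<lambda>k. cmod (\<Sum>j\<in>UNIV. - (\<i> * of_int (snd k $ j) * ?B i j k))) summable_on UNIV"
          by (rule abs_summable_sum) (simp_all only: finite norm_minus_cancel S2)
        have sN: "(\<lambda>k. cmod (\<Sum>j\<in>UNIV. ?N i j k)) summable_on UNIV"
          by (rule abs_summable_sum[OF finite mult(1)])
        show ?thesis
          unfolding G
          by (simp only: series_add St s2 sN P1 abs_summable_add series_sum[OF finite] series_uminus norm_minus_cancel S2 mult(1))
      qed
      moreover have "Re (?S (?N i j) x) = u t x $ j * ?D i j x" for j
        unfolding mult(2)[symmetric] u times_complex.sel real by simp
      ultimately show ?thesis
        by (simp add: g ut(2) sum_negf)
    qed
    moreover have "(\<Sum>i\<in>UNIV. ?D i i x) = 0" for x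
    proof -
      have "(\<Sum>i\<in>UNIV. ?B i i k) = 0" for k
        using div[of k] by (simp add: xi_dot_def mult.assoc flip: sum_distrib_left)
      then have "?S (\<lambda>k. \<Sum>i\<in>UNIV. ?B i i k) x = 0" by (simp add: series_def)
      then show ?thesis by (simp only: series_sum[OF finite S1] Re_sum[symmetric] zero_complex.sel)
    qed
    moreover have "has_weak_pderiv j (\<lambda>x. u t x $ i) (?D i j)" "has_weak_pderiv j (?D i j) (?D2 i j)" for i j
      unfolding u by (intro has_weak_pderiv_series_lat S0 S1 S2)+
    moreover have "has_weak_pderiv i (p t) (?Dp i)" for i
      unfolding p[abs_def] by (intro has_weak_pderiv_series_lat P0 P1)
    ultimately show "\<exists>ut Du D2u Dp. has_sobolev_deriv s u ut t \<and>
        (\<forall>i j. has_weak_pderiv j (\<lambda>x. u t x $ i) (Du i j)) \<and>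
        (\<forall>i j. has_weak_pderiv j (Du i j) (D2u i j)) \<and>
        (\<forall>i. has_weak_pderiv i (p t) (Dp i)) \<and>
        (AE x in lborel. \<forall>i. ut x $ i - (\<Sum>j\<in>UNIV. D2u i j x) + (\<Sum>j\<in>UNIV. u t x $ j * Du i j x) + Dp i x = g t x $ i) \<and>
        (AE x in lborel. (\<Sum>i\<in>UNIV. Du i i x) = 0)"
      by (intro exI[of _ "ut t"] exI[of _ ?D] exI[of _ ?D2] exI[of _ ?Dp] conjI allI AE_I2 ut(1)) blast+
  qed
qed

section \<open>Averages, and the solution for a forcing given by its coefficients\<close>

lemma integral_cell_eq_0_iff:
  fixes g :: "'a::euclidean_space \<Rightarrow> 'b::euclidean_space"
  assumes cont: "continuous_on UNIV g"
  shows "integral cell g = 0 \<longleftrightarrow> (\<forall>b\<in>Basis. fcoef (\<lambda>x. complex_of_real (g x \<bullet> b)) 0 = 0)"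
proof -
  have "g integrable_on cell" by (intro integrable_continuous continuous_on_subset[OF cont]) auto
  then have "integral cell (\<lambda>x. complex_of_real (g x \<bullet> b)) = complex_of_real (integral cell g \<bullet> b)" for b
    using integral_linear[of g cell "\<lambda>y. complex_of_real (y \<bullet> b)"]
      bounded_linear_compose[OF bounded_linear_of_real bounded_linear_inner_left] by (auto simp: o_def)
  then show ?thesis
    unfolding euclidean_eq_iff[of "integral cell g" 0] by (simp add: fcoef_def)
qed

lemma LINT_torus_cell_eq_0:
  fixes g :: "real ^ 'd \<Rightarrow> 'b::euclidean_space"
  assumes cont: "continuous_on UNIV g" and 0: "\<And>b. b \<in> Basis \<Longrightarrow> fourier_coeff (\<lambda>x. g x \<bullet> b) 0 = 0"
  shows "(LINT x:torus_cell|lborel. g x) = 0"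
proof -
  have "fourier_coeff (\<lambda>x. g x \<bullet> b) 0 = fcoef (\<lambda>x. complex_of_real (g x \<bullet> b)) (real_vec 0)" for b
    by (intro fourier_coeff_continuous continuous_intros cont)
  then have "fcoef (\<lambda>x. complex_of_real (g x \<bullet> b)) 0 = 0" if "b \<in> Basis" for b
    using 0[OF that] by (simp only: real_vec_simps)
  then show ?thesis
    using integral_cell_eq_0_iff[OF cont] by (simp add: torus_cell_eq_cell integral_eq_LINT(2)[OF cont])
qed

text \<open>Collects what both halves of the theorem require of \<open>U\<close> and
  \<open>P\<close>. The zero space average of \<open>U\<close> is kept apart, as it belongs to the
  second half only.\<close>

definition quasi_periodic_solution ::
    "(real ^ 'v \<Rightarrow> real ^ 'd \<Rightarrow> real ^ 'd) \<Rightarrow> real \<Rightarrow> real ^ 'v \<Rightarrow> real \<Rightarrow> real \<Rightarrow>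
     (real ^ 'v \<Rightarrow> real ^ 'd \<Rightarrow> real ^ 'd) \<Rightarrow> (real ^ 'v \<Rightarrow> real ^ 'd \<Rightarrow> real) \<Rightarrow> bool" where
  "quasi_periodic_solution f s \<omega> C \<epsilon> U P \<longleftrightarrow>
     C1_sobolev s U \<and> C0_sobolev s P \<and>
     set_integrable lborel (torus_cell \<times> torus_cell) (\<lambda>(\<phi>, x). U \<phi> x) \<and>
     (LINT (\<phi>, x):torus_cell \<times> torus_cell|lborel. U \<phi> x) = 0 \<and>
     (\<forall>\<phi>. (LINT x:torus_cell|lborel. P \<phi> x) = 0) \<and>
     navier_stokes_solution s (\<lambda>t. U (t *\<^sub>R \<omega>)) (\<lambda>t. P (t *\<^sub>R \<omega>)) (\<lambda>t x. \<epsilon> *\<^sub>R f (t *\<^sub>R \<omega>) x) \<and>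
     C1_norm s U \<le> C * \<epsilon> \<and> C0_norm s P \<le> C * \<epsilon>"

lemma weight_fst_only: "snd k = 0 \<Longrightarrow> weight a b k = weight a c k"
  by (simp add: weight_def japanese_def norm_vec_def L2_set_def)

lemma weight_div_japanese: "weight a b k / japanese (snd k) = weight a (b - 1) k"
  unfolding weight_def powr_diff by simp

text \<open>The Sobolev embedding on the side of the coefficients: by Cauchy-Schwarz, passing from
  l2 to l1 costs more than half the dimension in each variable.\<close>

lemma abs_summable_weighted:
  fixes X :: "('v::finite, 'd::finite) freq \<Rightarrow> 'b::real_normed_vector"
  assumes X: "l2_bound (\<lambda>k. weight a b k * norm (X k)) R"
    and "real CARD('v) < 2 * (a - a')" "real CARD('d) < 2 * (b - b')"
  shows "(\<lambda>k. weight a' b' k * norm (X k)) summable_on UNIV"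
proof -
  obtain H where H: "l2_bound (weight (- (a - a')) (- (b - b')) :: ('v, 'd) freq \<Rightarrow> real) H"
    by (rule l2_bound_weight[OF assms(2,3)])
  note * = l2_Cauchy_Schwarz(1)[OF H X]
  have eq: "weight a' b' k = weight (- (a - a')) (- (b - b')) k * weight a b k" for k :: "('v, 'd) freq"
      by (simp add: weight_add)
  have le: "weight a' b' k * norm (X k) \<le> \<bar>weight (- (a - a')) (- (b - b')) k\<bar> * \<bar>weight a b k * norm (X k)\<bar>" for k
    unfolding eq[of k] by (simp only: abs_mult abs_of_pos weight_pos abs_norm_cancel mult.assoc)
  have nn: "0 \<le> weight a' b' k * norm (X k)" for k by simp
  show ?thesis
  by (rule *[OF nn le])
qed

text \<open>\<open>B'\<close> bounds the linear solution at \<xi> = 0 and is the only quantity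
  through which \<omega> can influence the constants. It is given before \<omega>, and so are
  \<open>\<epsilon>0\<close> and \<open>C\<close>.\<close>

theorem quasi_periodic_solutions:
  fixes f :: "real ^ 'v \<Rightarrow> real ^ 'd \<Rightarrow> real ^ 'd" and F :: "('v, 'd) freq \<Rightarrow> complex ^ 'd"
  assumes s: "s > real CARD('d) / 2 + 1" and \<rho>: "\<rho> = real CARD('v) / 2 + 5 / 2"
    and F: "l2_bound (\<lambda>k. weight \<rho> (s - 1) k * norm (F k)) B"
    and inv: "\<And>\<phi> x i. complex_of_real (f \<phi> x $ i) = series lat (\<lambda>k. F k $ i) (\<phi>, x)"
    and sym: "\<And>k. F (- k) = vcnj (F k)" and F0: "F 0 = 0" and B': "0 \<le> B'"
  obtains \<epsilon>0 C where "0 < \<epsilon>0" "\<epsilon>0 < 1" "C > 0"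
    and "\<And>\<omega> \<epsilon>. l2_bound (\<lambda>k. if snd k = 0 then weight \<rho> 0 k * norm ((1 / heat_symbol \<omega> k) *s F k) else 0) B' \<Longrightarrow>
      (\<And>k. heat_symbol \<omega> k = 0 \<Longrightarrow> F k = 0) \<Longrightarrow> 0 < \<epsilon> \<Longrightarrow> \<epsilon> < \<epsilon>0 \<Longrightarrow>
      \<exists>U P. quasi_periodic_solution f s \<omega> C \<epsilon> U P \<and>
        ((\<forall>l. F (l, 0) = 0) \<longrightarrow> (\<forall>\<phi>. (LINT x:torus_cell|lborel. U \<phi> x) = 0))"
proof -
  have "0 \<le> real CARD('d) / 2" by simp
  with s have s0: "0 \<le> s" by linarith
  have dims: "real CARD('v) < 2 * \<rho>" "real CARD('v) < 2 * (\<rho> - 2)" "real CARD('d) < 2 * (s + 1)" "real CARD('d) < 2 * s"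
    using s \<rho> by auto
  obtain M where M: "\<And>k :: ('v, 'd) freq. l2_bound (\<lambda>j. weight \<rho> (s + 1) k / (weight \<rho> (s + 1) j * weight \<rho> (s + 1) (k - j))) M"
    using weight_kernel[OF dims(1,3)] by blast
  obtain D where "l2_bound (\<lambda>l :: int ^ 'v. japanese l powr (- (\<rho> - 2))) D"
    by (rule l2_bound_japanese[OF dims(2)])
  then have D: "l2_bound (\<lambda>l :: int ^ 'v. japanese l powr (2 - \<rho>)) D" by simp
  obtain E where "l2_bound (weight (- (\<rho> - 2)) (- s) :: ('v, 'd) freq \<Rightarrow> real) E"
    by (rule l2_bound_weight[OF dims(2,4)])
  then have E: "l2_bound (weight (2 - \<rho>) (- s) :: ('v, 'd) freq \<Rightarrow> real) E" by simp
  interpret convolution_algebra "weight \<rho> (s + 1) :: ('v, 'd) freq \<Rightarrow> real" M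
    by unfold_locales (rule weight_pos M)+
  \<comment> \<open>The linear solution has norm at most \<epsilon> R: \<open>2 * B\<close> from
    \<xi> \<noteq> 0, with the factor of \<open>norm_leray\<close>, and \<open>B'\<close> from \<xi>
    = 0.\<close>
  define R where "R = 2 * B + B'"
  have nonneg: "0 \<le> B" "0 \<le> M" "0 \<le> D" "0 \<le> R"
    using l2_bound_nonneg[OF F] l2_bound_nonneg[OF M] l2_bound_nonneg[OF D] B' by (auto simp: R_def)
  \<comment> \<open>The bounds \<open>K\<close> of the velocity, with coefficients of norm at most 2
    \<epsilon> R, and of the scalar pressure, without the factor \<epsilon>. The summand 1 makes
    \<open>C\<close> positive.\<close>
  define C where "C = sqrt DIM(real ^ 'd) * D * (2 * R) + D * (B + R) + 1"
  \<comment> \<open>The term 16 M R yields the smallness condition of the fixed point, and the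
    summand 2 yields \<open>\<epsilon>0 < 1\<close>.\<close>
  define \<epsilon>0 where "\<epsilon>0 = 1 / (2 + 16 * (M * R))"
  have C: "sqrt DIM(real ^ 'd) * D * (2 * R) \<le> C" "D * (B + R) \<le> C" "C > 0"
    unfolding C_def using nonneg by (auto intro!: add_nonneg_nonneg add_nonneg_pos)
  have \<epsilon>0: "0 < \<epsilon>0" "\<epsilon>0 < 1"
    unfolding \<epsilon>0_def using nonneg by (auto simp: add_pos_nonneg)
  show ?thesis
  proof (rule that[OF \<epsilon>0 C(3)])
    fix \<omega> :: "real ^ 'v" and \<epsilon> :: real
    assume mean: "l2_bound (\<lambda>k. if snd k = 0 then weight \<rho> 0 k * norm ((1 / heat_symbol \<omega> k) *s F k) else 0) B'"
      and res: "\<And>k. heat_symbol \<omega> k = 0 \<Longrightarrow> F k = 0" and \<epsilon>: "0 < \<epsilon>" "\<epsilon> < \<epsilon>0"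
    define G where "G k = complex_of_real \<epsilon> *s F k" for k
    have normG: "norm (G k) = \<epsilon> * norm (F k)" for k
      using \<epsilon> by (simp add: G_def norm_smult_vec)
    \<comment> \<open>Away from \<xi> = 0 the division by at least |\<xi>|^2 lifts the space weight
      of the forcing from s - 1 to s + 1. At \<xi> = 0 all space weights are 1 and
      \<open>mean\<close> applies.\<close>
    have lin: "bnd (\<lambda>k. (1 / heat_symbol \<omega> k) *s leray (snd k) (G k)) (\<epsilon> * R)"
    proof (rule l2_bound_mono[OF l2_bound_scale[OF l2_bound_add[OF l2_bound_scale[OF F, of 2] mean], of \<epsilon>]])
      fix k
      show "\<bar>weight \<rho> (s + 1) k * norm ((1 / heat_symbol \<omega> k) *s leray (snd k) (G k))\<bar> \<le>
        \<epsilon> * (2 * (weight \<rho> (s - 1) k * norm (F k)) +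
          (if snd k = 0 then weight \<rho> 0 k * norm ((1 / heat_symbol \<omega> k) *s F k) else 0))"
      proof (cases "snd k = 0")
        case True
        have "0 \<le> \<epsilon> * (norm (F k) * weight \<rho> (s - 1) k)" using \<epsilon> by simp
        with True show ?thesis
          using \<epsilon> weight_fst_only[OF True, of \<rho> "s + 1" 0]
          by (simp add: leray_def normG norm_smult_vec abs_mult abs_of_pos algebra_simps)
      next
        case False
        let ?J = "japanese (snd k)"
        have h: "?J\<^sup>2 \<le> cmod (heat_symbol \<omega> k)"
          using norm_heat_symbol[of k \<omega>] japanese_eq_norm[OF False] by simp
        have J: "0 < ?J\<^sup>2" by simp
        have "1 / cmod (heat_symbol \<omega> k) \<le> 1 / ?J\<^sup>2" by (rule frac_le[OF _ _ J h]) simp_all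
        then have "norm ((1 / heat_symbol \<omega> k) *s leray (snd k) (G k)) \<le> 1 / ?J\<^sup>2 * (2 * norm (G k))"
          unfolding norm_smult_vec norm_divide norm_one by (rule mult_mono[OF _ norm_leray]) simp_all
        then have "weight \<rho> (s + 1) k * norm ((1 / heat_symbol \<omega> k) *s leray (snd k) (G k)) \<le>
            weight \<rho> (s + 1) k * (1 / ?J\<^sup>2 * (2 * norm (G k)))"
          by (rule mult_left_mono) simp
        also have "\<dots> = (weight \<rho> (s + 1) k / ?J / ?J) * (2 * norm (G k))"
          by (simp add: power2_eq_square)
        also have "weight \<rho> (s + 1) k / ?J / ?J = weight \<rho> (s - 1) k"
          by (simp add: weight_div_japanese)
        finally show ?thesis using False by (simp add: normG abs_mult abs_of_pos mult_ac)
      qed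
    qed (use \<epsilon> in \<open>simp add: R_def\<close>)
    have small: "16 * (M * (\<epsilon> * R)) \<le> 1"
    proof -
      have "\<epsilon> * (2 + 16 * (M * R)) \<le> 1"
        using \<epsilon> nonneg unfolding \<epsilon>0_def by (simp add: pos_less_divide_eq add_pos_nonneg less_imp_le)
      then show ?thesis using \<epsilon> by (simp add: algebra_simps)
    qed
    have symG: "G (- k) = vcnj (G k)" for k
      by (simp add: G_def sym) (simp add: vcnj_def vec_eq_iff)
    have resG: "G k = 0" if "heat_symbol \<omega> k = 0" for k
      using res[OF that] by (simp add: G_def)
    obtain A P where A: "bnd A (2 * (\<epsilon> * R))" "\<And>k. A (- k) = vcnj (A k)" and P_sym: "\<And>k. P (- k) = cnj (P k)"
      and div: "\<And>k. xi_dot (snd k) (A k) = 0"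
      and eqn: "\<And>k. heat_symbol \<omega> k *s A k + \<i> *s conv A A k + (\<i> * P k) *s cvec (snd k) = G k"
      and A0: "\<And>k. snd k = 0 \<Longrightarrow> A k = (1 / heat_symbol \<omega> k) *s G k" and P0: "\<And>k. snd k = 0 \<Longrightarrow> P k = 0"
      and P_le: "\<And>k. cmod (P k) * norm (real_vec (snd k)) \<le> norm (G k) + norm (conv A A k)"
      using stationary_coefficients[OF lin small symG resG] by blast
    \<comment> \<open>Dividing by |\<xi>| gains one derivative: the forcing passes from weight s - 1
      to s, while the quadratic term only loses its factor |\<xi>| and is controlled even with
      weight s + 1.\<close>
    have P_bound: "l2_bound (\<lambda>k. weight \<rho> s k * cmod (P k)) (\<epsilon> * (B + R))"
    proof (rule l2_bound_mono[OF l2_bound_add[OF l2_bound_scale[OF F, of \<epsilon>] norm_convolution(2)[OF A(1) A(1)]]])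
      fix k
      let ?S = "\<Sum>\<^sub>\<infinity>j. norm (A j) * norm (A (k - j))"
      have S: "0 \<le> ?S" by (intro infsum_nonneg) simp
      have "weight \<rho> s k * cmod (P k) \<le> \<epsilon> * (weight \<rho> (s - 1) k * norm (F k)) + weight \<rho> (s + 1) k * ?S"
      proof (cases "snd k = 0")
        case True
        then show ?thesis using S \<epsilon> by (simp add: P0 less_imp_le)
      next
        case False
        let ?J = "japanese (snd k)"
        have J: "norm (real_vec (snd k)) = ?J" using japanese_eq_norm[OF False] by simp
        have "cmod (P k) * ?J \<le> \<epsilon> * norm (F k) + ?J * ?S"
          using P_le[of k] norm_conv_le[OF A(1) A(1), of k] by (simp add: J normG)
        then have "weight \<rho> s k / ?J * (cmod (P k) * ?J) \<le> weight \<rho> s k / ?J * (\<epsilon> * norm (F k) + ?J * ?S)"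
          by (rule mult_left_mono) simp
        then have "weight \<rho> s k * cmod (P k) \<le> weight \<rho> s k / ?J * (\<epsilon> * norm (F k)) + weight \<rho> s k * ?S"
          by (simp add: distrib_left)
        also have "weight \<rho> s k * ?S \<le> weight \<rho> (s + 1) k * ?S"
          using S by (intro mult_right_mono weight_mono) auto
        finally show ?thesis by (simp add: weight_div_japanese mult_ac)
      qed
      then show "\<bar>weight \<rho> s k * cmod (P k)\<bar> \<le> \<epsilon> * (weight \<rho> (s - 1) k * norm (F k)) + weight \<rho> (s + 1) k * ?S"
        by (simp add: abs_mult abs_of_pos)
      \<comment> \<open>The smallness of \<epsilon> turns the quadratic contribution into one linear
        in \<epsilon>.\<close>
      have "M * (2 * (\<epsilon> * R)) * (2 * (\<epsilon> * R)) \<le> \<epsilon> * R"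
      proof -
        have \<epsilon>R: "0 \<le> \<epsilon> * R" using \<epsilon> nonneg by simp
        have "16 * (M * (\<epsilon> * R) * (\<epsilon> * R)) \<le> \<epsilon> * R"
          using mult_right_mono[OF small \<epsilon>R] by (simp add: mult.assoc)
        moreover have "M * (2 * (\<epsilon> * R)) * (2 * (\<epsilon> * R)) = 4 * (M * (\<epsilon> * R) * (\<epsilon> * R))" by simp
        ultimately show ?thesis using \<epsilon>R by linarith
      qed
      then show "\<bar>\<epsilon>\<bar> * B + M * (2 * (\<epsilon> * R)) * (2 * (\<epsilon> * R)) \<le> \<epsilon> * (B + R)"
        using \<epsilon> by (simp add: distrib_left)
    qed
    define c where "c b k = A k $ axis_index b" for b :: "real ^ 'd" and k
    have c_axis: "c (axis i 1) = (\<lambda>k. A k $ i)" for i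
      by (simp add: c_def fun_eq_iff)
    interpret SU: sobolev_coefficients \<rho> s D E c "2 * (\<epsilon> * R)"
    proof
      show "l2_bound (\<lambda>k. weight \<rho> s k * cmod (c b k)) (2 * (\<epsilon> * R))" for b
      proof (rule l2_bound_mono[OF A(1)])
        fix k
        have "weight \<rho> s k * cmod (c b k) \<le> weight \<rho> (s + 1) k * norm (A k)"
          unfolding c_def by (rule mult_mono[OF weight_mono Finite_Cartesian_Product.norm_nth_le]) simp_all
        then show "\<bar>weight \<rho> s k * cmod (c b k)\<bar> \<le> weight \<rho> (s + 1) k * norm (A k)"
          by (simp add: abs_mult abs_of_pos)
      qed simp
      show "c b (- k) = cnj (c b k)" for b k by (simp add: c_def A(2) vcnj_def)
    qed (rule D E s0)+
    \<comment> \<open>A scalar field has the single basis vector 1, so the family of coefficients is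
      constant in its index.\<close>
    interpret SP: sobolev_coefficients \<rho> s D E "\<lambda>b :: real. P" "\<epsilon> * (B + R)"
      by unfold_locales (rule D E s0 P_bound P_sym)+
    \<comment> \<open>The surplus exponents are \<rho> - 1 in the angles and (s + 1) - 2 = s - 1 in
      space; the latter exceeds d/2 by the hypothesis on \<open>s\<close>.\<close>
    have Asum: "(\<lambda>k. weight 1 2 k * norm (A k)) summable_on UNIV"
      by (rule abs_summable_weighted[OF A(1)]) (use s \<rho> in auto)
    have Psum: "(\<lambda>k. weight 0 1 k * norm (P k)) summable_on UNIV"
      by (rule abs_summable_weighted[OF P_bound]) (use s \<rho> in auto)
    have Usum: "(\<lambda>k. cmod (c b k)) summable_on UNIV" if "b \<in> Basis" for b
      using SU.summable_modes[OF multiplier_phase that, of 0] by (simp add: norm_mult)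
    have U_nth: "SU.U \<phi> x $ i = Re (series lat (\<lambda>k. A k $ i) (\<phi>, x))" for \<phi> x i
      using field_of_inner[of "axis i 1" "phase \<phi>" c x] by (simp add: inner_axis c_axis series_lat)
    have NS: "navier_stokes_solution s (\<lambda>t. SU.U (t *\<^sub>R \<omega>)) (\<lambda>t. SP.U (t *\<^sub>R \<omega>)) (\<lambda>t x. \<epsilon> *\<^sub>R f (t *\<^sub>R \<omega>) x)"
    proof (rule navier_stokes_of_coefficients[OF Asum Psum abs_summable_summable[OF conv_summable[OF A(1) A(1)]] A(2) div eqn])
      show "SP.U (t *\<^sub>R \<omega>) x = Re (series lat P (t *\<^sub>R \<omega>, x))" for t x
        by (simp add: field_of_def series_lat)
      show "(\<epsilon> *\<^sub>R f (t *\<^sub>R \<omega>) x) $ i = Re (series lat (\<lambda>k. G k $ i) (t *\<^sub>R \<omega>, x))" for t x i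
      proof -
        have "series lat (\<lambda>k. G k $ i) (t *\<^sub>R \<omega>, x) = complex_of_real \<epsilon> * series lat (\<lambda>k. F k $ i) (t *\<^sub>R \<omega>, x)"
          by (simp add: series_def G_def mult.assoc infsum_cmult_right')
        then show ?thesis by (simp flip: inv)
      qed
      show "has_sobolev_deriv s (\<lambda>t. SU.U (t *\<^sub>R \<omega>)) (field_of (phase_deriv \<omega> (t *\<^sub>R \<omega>)) c) t" for t
        using SU.has_sobolev_deriv_field_of[of 0 \<omega> t] by simp
      show "field_of (phase_deriv \<omega> (t *\<^sub>R \<omega>)) c x $ i =
          Re (series lat (\<lambda>k. \<i> * (\<omega> \<bullet> real_vec (fst k)) * A k $ i) (t *\<^sub>R \<omega>, x))" for t x i
      proof -
        have "mode_sum (phase_deriv \<omega> (t *\<^sub>R \<omega>)) (c (axis i 1)) x =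
            series lat (\<lambda>k. \<i> * (\<omega> \<bullet> real_vec (fst k)) * A k $ i) (t *\<^sub>R \<omega>, x)"
          by (simp add: c_axis series_lat mode_sum_def phase_deriv_def mult_ac inner_commute)
        then show ?thesis
          using field_of_inner[of "axis i 1" "phase_deriv \<omega> (t *\<^sub>R \<omega>)" c x] by (simp add: inner_axis)
      qed
    qed (rule U_nth)
    \<comment> \<open>The average over the product torus needs continuity in both variables
      together, which the series over all frequencies provides.\<close>
    have joint: "continuous_on UNIV (\<lambda>(\<phi>, x). SU.U \<phi> x)"
    proof -
      have "(\<lambda>(\<phi>, x). SU.U \<phi> x) = (\<lambda>z. \<Sum>b\<in>Basis. Re (series lat (c b) z) *\<^sub>R b)"
        by (rule ext) (simp add: field_of_def series_lat split: prod.split)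
      moreover have "continuous_on UNIV (\<lambda>z. \<Sum>b\<in>Basis. Re (series lat (c b) z) *\<^sub>R b)"
        by (intro continuous_on_sum continuous_on_scaleR continuous_on_Re continuous_on_series continuous_on_const Usum)
      ultimately show ?thesis by simp
    qed
    have A_0: "A 0 = 0" using A0[of 0] by (simp add: G_def F0)
    have zero: "fcoef (\<lambda>z. complex_of_real ((case z of (\<phi>, x) \<Rightarrow> SU.U \<phi> x) \<bullet> b)) 0 = 0" if b: "b \<in> Basis" for b
    proof -
      have "(\<lambda>z. complex_of_real ((case z of (\<phi>, x) \<Rightarrow> SU.U \<phi> x) \<bullet> b)) = series lat (c b)"
        by (rule ext) (simp add: field_of_inner[OF b] SU.mode_sum_real[OF multiplier_phase b] series_lat split: prod.split)
      moreover have "{k :: ('v, 'd) freq. lat k = 0} = {0}"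
      proof -
        have "lat (0 :: ('v, 'd) freq) = 0"
          by (simp only: lat_def fst_zero snd_zero real_vec_simps) (simp add: zero_prod_def)
        then have "lat k = 0 \<longleftrightarrow> k = 0" for k :: "('v, 'd) freq"
          using inj_eq[OF inj_lat, of k 0] by simp
        then show ?thesis by simp
      qed
      moreover have "c b 0 = 0" by (simp add: c_def A_0)
      ultimately show ?thesis
        using fcoef_series[OF Usum[OF b] eq_refl[OF range_lat] lattice_0] \<open>c b 0 = 0\<close> by simp
    qed
    have "integral cell (\<lambda>(\<phi>, x). SU.U \<phi> x) = 0"
      by (rule iffD2[OF integral_cell_eq_0_iff[OF joint]], rule ballI, rule zero)
    then have total: "(LINT (\<phi>, x):torus_cell \<times> torus_cell|lborel. SU.U \<phi> x) = 0"
      unfolding torus_cell_eq_cell cell_Times integral_eq_LINT(2)[OF joint] .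
    have P_mean: "(LINT x:torus_cell|lborel. SP.U \<phi> x) = 0" for \<phi>
    proof (rule LINT_torus_cell_eq_0[OF SP.continuous_on_field_of[OF multiplier_phase]])
      show "fourier_coeff (\<lambda>x. SP.U \<phi> x \<bullet> b) 0 = 0" if "b \<in> Basis" for b
        unfolding SP.fourier_coeff_field_of[OF multiplier_phase that] by (simp add: P0)
    qed
    have U_mean: "(LINT x:torus_cell|lborel. SU.U \<phi> x) = 0" if "\<forall>l. F (l, 0) = 0" for \<phi>
    proof (rule LINT_torus_cell_eq_0[OF SU.continuous_on_field_of[OF multiplier_phase]])
      show "fourier_coeff (\<lambda>x. SU.U \<phi> x \<bullet> b) 0 = 0" if "b \<in> Basis" for b
        unfolding SU.fourier_coeff_field_of[OF multiplier_phase that]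
        using \<open>\<forall>l. F (l, 0) = 0\<close> by (simp add: c_def A0 G_def)
    qed
    have "C1_norm s SU.U \<le> sqrt DIM(real ^ 'd) * D * (2 * R) * \<epsilon>"
      using SU.C1_norm_U unfolding SU.K_def by (simp add: mult_ac)
    also have "\<dots> \<le> C * \<epsilon>" using C(1) \<epsilon> by (intro mult_right_mono) auto
    finally have U_norm: "C1_norm s SU.U \<le> C * \<epsilon>" .
    have "C0_norm s SP.U \<le> D * (B + R) * \<epsilon>"
      using SP.C0_norm_U unfolding SP.K_def by (simp add: mult_ac)
    also have "\<dots> \<le> C * \<epsilon>" using C(2) \<epsilon> by (intro mult_right_mono) auto
    finally have P_norm: "C0_norm s SP.U \<le> C * \<epsilon>" .
    have int: "set_integrable lborel (torus_cell \<times> torus_cell) (\<lambda>(\<phi>, x). SU.U \<phi> x)"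
      unfolding torus_cell_eq_cell cell_Times by (rule integral_eq_LINT(1)[OF joint])
    have "quasi_periodic_solution f s \<omega> C \<epsilon> SU.U SP.U"
      unfolding quasi_periodic_solution_def
      by (intro conjI allI) (rule SU.C1_U SP.C0_U int total P_mean NS U_norm P_norm)+
    moreover have "(\<forall>l. F (l, 0) = 0) \<longrightarrow> (\<forall>\<phi>. (LINT x:torus_cell|lborel. SU.U \<phi> x) = 0)"
      using U_mean by blast
    ultimately show "\<exists>U P. quasi_periodic_solution f s \<omega> C \<epsilon> U P \<and>
        ((\<forall>l. F (l, 0) = 0) \<longrightarrow> (\<forall>\<phi>. (LINT x:torus_cell|lborel. U \<phi> x) = 0))"
      by (intro exI[of _ SU.U] exI[of _ SP.U] conjI)
  qed
qed

subsection \<open>The Fourier coefficients of the forcing term\<close>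

definition forcing_coeff :: "(real ^ 'v::finite \<Rightarrow> real ^ 'd::finite \<Rightarrow> real ^ 'd) \<Rightarrow> ('v, 'd) freq \<Rightarrow> complex ^ 'd" where
  "forcing_coeff f k = (\<chi> i. fcoef (\<lambda>z. complex_of_real (f (fst z) (snd z) $ i)) (lat k))"

locale forcing =
  fixes f :: "real ^ 'v::finite \<Rightarrow> real ^ 'd::finite \<Rightarrow> real ^ 'd" and N :: nat
  assumes per: "torus_periodic f" "\<And>\<phi>. torus_periodic (f \<phi>)"
    and smooth: "C_k N (\<lambda>(\<phi>, x). f \<phi> x)"
begin

abbreviation F :: "('v, 'd) freq \<Rightarrow> complex ^ 'd" where "F \<equiv> forcing_coeff f"

lemma cont: "continuous_on UNIV (\<lambda>(\<phi>, x). f \<phi> x)"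
  by (rule C_k_imp_continuous[OF smooth])

lemma cont_component: "continuous_on UNIV (\<lambda>z. f (fst z) (snd z) $ i)"
  using cont by (intro continuous_intros) (simp add: case_prod_unfold)

lemma cont_space: "continuous_on UNIV (f \<phi>)"
  using continuous_on_compose2[OF cont, of UNIV "\<lambda>x. (\<phi>, x)"] by (simp add: continuous_on_Pair)

lemma periodic_forcing: "periodic (\<lambda>(\<phi>, x). f \<phi> x)"
  using per by (auto simp: torus_periodic_def periodic_def Basis_prod_def Basis_vec_def)

lemma norm_F_le: "norm (F k) \<le> (\<Sum>i\<in>UNIV. cmod (F k $ i))"
  unfolding norm_vec_def by (rule L2_set_le_sum) simp

lemma F_decay:
  assumes "0 \<le> a" "0 \<le> b" "a + b \<le> real N"
  obtains B where "l2_bound (\<lambda>k. weight a b k * norm (F k)) B"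
proof -
  have "\<exists>B. l2_bound (\<lambda>k. weight a b k * cmod (F k $ i)) B" for i
    using C_k_weighted_decay[OF smooth periodic_forcing assms, of "axis i 1"]
    by (simp add: forcing_coeff_def inner_axis case_prod_unfold)
  then obtain B where B: "\<And>i. l2_bound (\<lambda>k. weight a b k * cmod (F k $ i)) (B i)"
    by metis
  have "l2_bound (\<lambda>k. weight a b k * norm (F k)) (\<Sum>i\<in>UNIV. B i)"
  proof (rule l2_bound_mono[OF l2_bound_sum[OF finite B]])
    fix k
    show "\<bar>weight a b k * norm (F k)\<bar> \<le> (\<Sum>i\<in>UNIV. weight a b k * cmod (F k $ i))"
      using mult_left_mono[OF norm_F_le weight_nonneg] by (simp add: abs_mult sum_distrib_left)
  qed simp
  then show ?thesis by (rule that)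
qed

lemma F_uminus: "F (- k) = vcnj (F k)"
  by (simp add: forcing_coeff_def vcnj_def vec_eq_iff lat_uminus fcoef_of_real_uminus[OF cont_component])

text \<open>The exponents \<open>a\<close> and s - 1 exceed half of the respective dimensions, so
  the coefficients are absolutely summable and Fourier inversion applies.\<close>

lemma F_inversion:
  assumes s: "s > real CARD('d) / 2 + 1" and a: "real CARD('v) < 2 * a" "a + (s - 1) \<le> real N"
  shows "complex_of_real (f \<phi> x $ i) = series lat (\<lambda>k. F k $ i) (\<phi>, x)"
proof -
  have "0 \<le> a" using order_le_less_trans[OF of_nat_0_le_iff a(1)] by simp
  moreover have "0 \<le> s - 1" using s order_trans[of 0 "real CARD('d) / 2" "s - 1"] by simp
  ultimately obtain B where B: "l2_bound (\<lambda>k. weight a (s - 1) k * norm (F k)) B"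
    using F_decay a(2) by blast
  have "(\<lambda>k. weight 0 0 k * norm (F k)) summable_on UNIV"
    by (rule abs_summable_weighted[OF B]) (use s a in auto)
  then have "(\<lambda>k. norm (F k)) summable_on UNIV"
    by (simp add: weight_def)
  then have "(\<lambda>k. cmod (F k $ i)) summable_on UNIV"
    by (rule Infinite_Sum.abs_summable_on_comparison_test') (rule Finite_Cartesian_Product.norm_nth_le)
  moreover have "periodic (\<lambda>z. f (fst z) (snd z) $ i)"
    using periodic_forcing by (simp add: periodic_def case_prod_unfold)
  ultimately show ?thesis
    using Fourier_inversion[OF cont_component, of i "(\<phi>, x)"] by (simp add: forcing_coeff_def)
qed

lemma F_0_eq_0:
  assumes "(LINT (\<phi>, x):torus_cell \<times> torus_cell|lborel. f \<phi> x) = 0"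
  shows "F 0 = 0"
proof -
  have "integral cell (\<lambda>(\<phi>, x). f \<phi> x) = 0"
    using assms unfolding torus_cell_eq_cell cell_Times integral_eq_LINT(2)[OF cont] .
  then have "fcoef (\<lambda>z. complex_of_real ((case z of (\<phi>, x) \<Rightarrow> f \<phi> x) \<bullet> axis i 1)) 0 = 0" for i
    using integral_cell_eq_0_iff[OF cont] by simp
  moreover have "lat (0 :: ('v, 'd) freq) = 0"
    by (simp only: lat_def fst_zero snd_zero real_vec_simps) (simp add: zero_prod_def)
  ultimately show ?thesis
    by (simp add: forcing_coeff_def vec_eq_iff inner_axis case_prod_unfold)
qed

text \<open>At frequency (l, 0) the exponential does not depend on \<open>x\<close>. By Fubini the
  inner integral is the space average at a fixed angle.\<close>

lemma F_zero_space_average: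
  assumes "\<And>\<phi>. (LINT x:torus_cell|lborel. f \<phi> x) = 0"
  shows "F (l, 0) = 0"
proof -
  have inner: "integral cell (\<lambda>x. complex_of_real (f \<phi> x $ i)) = 0" for \<phi> i
  proof -
    have "integral cell (f \<phi>) = 0"
      using assms[of \<phi>] unfolding torus_cell_eq_cell integral_eq_LINT(2)[OF cont_space] .
    then have "fcoef (\<lambda>x. complex_of_real (f \<phi> x \<bullet> axis i 1)) 0 = 0"
      using integral_cell_eq_0_iff[OF cont_space] by simp
    then show ?thesis by (simp add: fcoef_def inner_axis)
  qed
  have "integral cell (\<lambda>z. complex_of_real (f (fst z) (snd z) $ i) * cis (- (lat (l, 0) \<bullet> z))) = 0" for i
  proof -
    let ?g = "\<lambda>z. complex_of_real (f (fst z) (snd z) $ i) * cis (- (lat (l, 0 :: int ^ 'd) \<bullet> z))"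
    have "continuous_on UNIV ?g"
      by (intro continuous_intros cont_component)
    then have "integral (cbox (0, 0) ((2 * pi) *\<^sub>R One, (2 * pi) *\<^sub>R One)) ?g =
        integral cell (\<lambda>\<phi>. integral cell (\<lambda>x. ?g (\<phi>, x)))"
      by (intro integral_prod_continuous) (rule continuous_on_subset, auto)
    moreover have "?g (\<phi>, x) = complex_of_real (f \<phi> x $ i) * cis (- (real_vec l \<bullet> \<phi>))" for \<phi> x
    proof -
      have "lat (l, 0 :: int ^ 'd) = (real_vec l, 0)"
        by (simp only: lat_def fst_conv snd_conv real_vec_simps)
      then show ?thesis by simp
    qed
    ultimately show ?thesis
      unfolding cell_Times[symmetric] cbox_Pair_eq[symmetric] by (simp only: integral_mult_left inner mult_zero_left integral_0)
  qed
  then show ?thesis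
    by (simp add: forcing_coeff_def vec_eq_iff fcoef_def)
qed

end

text \<open>At \<xi> = 0 the symbol is i \<omega> \<bullet> l. Since l \<noteq> 0,
  \<open>japanese l\<close> is the norm in the diophantine condition, and inverting the symbol costs
  \<nu> powers of it.\<close>

lemma diophantine_symbol:
  fixes k :: "('v::finite, 'd::finite) freq"
  assumes \<gamma>: "0 < \<gamma>" and dio: "diophantine \<gamma> \<omega>" and k: "snd k = 0" "k \<noteq> 0"
  shows "heat_symbol \<omega> k \<noteq> 0" and "1 / cmod (heat_symbol \<omega> k) \<le> 1 / \<gamma> * japanese (fst k) powr real CARD('v)"
proof -
  have l: "fst k \<noteq> 0" using k by (simp add: prod_eq_iff)
  let ?J = "japanese (fst k)" and ?n = "real CARD('v)"
  have h: "cmod (heat_symbol \<omega> k) = \<bar>\<omega> \<bullet> real_vec (fst k)\<bar>"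
  proof -
    have n: "norm (real_vec (snd k)) = 0" unfolding k(1) real_vec_simps by simp
    show ?thesis unfolding heat_symbol_def n by (simp add: norm_mult)
  qed
  have le: "\<gamma> * ?J powr (- ?n) \<le> cmod (heat_symbol \<omega> k)"
    using dio l unfolding h japanese_eq_norm[OF l] diophantine_def by blast
  have pos: "0 < \<gamma> * ?J powr (- ?n)" using \<gamma> by simp
  then show "heat_symbol \<omega> k \<noteq> 0" using le by auto
  have "1 / cmod (heat_symbol \<omega> k) \<le> 1 / (\<gamma> * ?J powr (- ?n))"
    by (rule frac_le[OF _ _ pos le]) simp_all
  then show "1 / cmod (heat_symbol \<omega> k) \<le> 1 / \<gamma> * ?J powr ?n"
    by (simp add: powr_minus field_simps)
qed

theorem theorem1p1:
  fixes f :: "real ^ 'v \<Rightarrow> real ^ 'd \<Rightarrow> real ^ 'd"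
    and s :: real and N :: nat
  assumes "CARD('d) \<ge> 2"
    and "s > real CARD('d) / 2 + 1"
    and "real N > 3 * real CARD('v) / 2 + s + 2"
    and "torus_periodic f" and "\<And>\<phi>. torus_periodic (f \<phi>)"
    and "C_k N (\<lambda>(\<phi>, x). f \<phi> x)"
    and "(LINT (\<phi>, x):torus_cell \<times> torus_cell|lborel. f \<phi> x) = 0"
  shows
    "(\<forall>\<gamma>. 0 < \<gamma> \<and> \<gamma> < 1 \<longrightarrow>
       (\<exists>\<epsilon>0 C. 0 < \<epsilon>0 \<and> \<epsilon>0 < 1 \<and> C > 0 \<and>
         (\<forall>\<omega> :: real ^ 'v. diophantine \<gamma> \<omega> \<longrightarrow>
           (\<forall>\<epsilon>. 0 < \<epsilon> \<and> \<epsilon> < \<epsilon>0 \<longrightarrow>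
             (\<exists>(U :: real ^ 'v \<Rightarrow> real ^ 'd \<Rightarrow> real ^ 'd) (P :: real ^ 'v \<Rightarrow> real ^ 'd \<Rightarrow> real).
               C1_sobolev s U \<and> C0_sobolev s P \<and>
               set_integrable lborel (torus_cell \<times> torus_cell) (\<lambda>(\<phi>, x). U \<phi> x) \<and>
               (LINT (\<phi>, x):torus_cell \<times> torus_cell|lborel. U \<phi> x) = 0 \<and>
               (\<forall>\<phi>. (LINT x:torus_cell|lborel. P \<phi> x) = 0) \<and>
               navier_stokes_solution s (\<lambda>t. U (t *\<^sub>R \<omega>)) (\<lambda>t. P (t *\<^sub>R \<omega>))
                 (\<lambda>t x. \<epsilon> *\<^sub>R f (t *\<^sub>R \<omega>) x) \<and>
               C1_norm s U \<le> C * \<epsilon> \<and> C0_norm s P \<le> C * \<epsilon>)))))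
     \<and>
     ((\<forall>\<phi>. (LINT x:torus_cell|lborel. f \<phi> x) = 0) \<longrightarrow>
       (\<exists>\<epsilon>0 C. 0 < \<epsilon>0 \<and> \<epsilon>0 < 1 \<and> C > 0 \<and>
         (\<forall>\<omega> :: real ^ 'v.
           (\<forall>\<epsilon>. 0 < \<epsilon> \<and> \<epsilon> < \<epsilon>0 \<longrightarrow>
             (\<exists>(U :: real ^ 'v \<Rightarrow> real ^ 'd \<Rightarrow> real ^ 'd) (P :: real ^ 'v \<Rightarrow> real ^ 'd \<Rightarrow> real).
               C1_sobolev s U \<and> C0_sobolev s P \<and>
               set_integrable lborel (torus_cell \<times> torus_cell) (\<lambda>(\<phi>, x). U \<phi> x) \<and>
               (LINT (\<phi>, x):torus_cell \<times> torus_cell|lborel. U \<phi> x) = 0 \<and>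
               (\<forall>\<phi>. (LINT x:torus_cell|lborel. U \<phi> x) = 0) \<and>
               (\<forall>\<phi>. (LINT x:torus_cell|lborel. P \<phi> x) = 0) \<and>
               navier_stokes_solution s (\<lambda>t. U (t *\<^sub>R \<omega>)) (\<lambda>t. P (t *\<^sub>R \<omega>))
                 (\<lambda>t x. \<epsilon> *\<^sub>R f (t *\<^sub>R \<omega>) x) \<and>
               C1_norm s U \<le> C * \<epsilon> \<and> C0_norm s P \<le> C * \<epsilon>)))))"
proof -
  interpret forcing f N
    by unfold_locales (rule assms)+
  define \<rho> where "\<rho> = real CARD('v) / 2 + 5 / 2"
  have d: "0 \<le> real CARD('d) / 2" "0 \<le> real CARD('v) / 2" by simp_all
  then have s: "1 \<le> s" using assms(2) by linarith
  \<comment> \<open>The linear estimate takes \<rho> + s - 1 = \<nu>/2 + s + 3/2 derivatives of the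
    forcing, and the small divisors take \<rho> + \<nu> = 3\<nu>/2 + 5/2. Both are below
    \<open>N\<close> because s \<ge> 1.\<close>
  have exps: "0 \<le> \<rho>" "0 \<le> s - 1" "\<rho> + (s - 1) \<le> real N" "0 \<le> \<rho> + real CARD('v)" "\<rho> + real CARD('v) + 0 \<le> real N"
      "real CARD('v) < 2 * \<rho>"
    using s d assms(3) by (auto simp: \<rho>_def)
  obtain B where B: "l2_bound (\<lambda>k. weight \<rho> (s - 1) k * norm (F k)) B"
    by (rule F_decay[OF exps(1-3)])
  obtain B2 where B2: "l2_bound (\<lambda>k. weight (\<rho> + real CARD('v)) 0 k * norm (F k)) B2"
    by (rule F_decay[OF exps(4) order_refl exps(5)])
  note inversion = F_inversion[OF assms(2) exps(6,3)]
  have F0: "F 0 = 0" by (rule F_0_eq_0[OF assms(7)])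
  note solutions = quasi_periodic_solutions[OF assms(2) \<rho>_def B inversion F_uminus F0]
  have heat_0: "snd k = 0" if "heat_symbol \<omega> k = 0" for \<omega> :: "real ^ 'v" and k :: "('v, 'd) freq"
    using norm_heat_symbol[of k \<omega>] that by simp
  show ?thesis
  proof (intro conjI allI impI, goal_cases)
    case (1 \<gamma>)
    then have \<gamma>: "0 < \<gamma>" by simp
    \<comment> \<open>The bound at \<xi> = 0: it depends on \<gamma> but is common to all \<omega>
      that are diophantine with this \<gamma>.\<close>
    have "0 \<le> \<bar>1 / \<gamma>\<bar> * B2" using l2_bound_nonneg[OF B2] by simp
    then obtain \<epsilon>0 C where pos: "0 < \<epsilon>0" "\<epsilon>0 < 1" "C > 0"
      and sol: "\<And>\<omega> \<epsilon>. l2_bound (\<lambda>k. if snd k = 0 then weight \<rho> 0 k * norm ((1 / heat_symbol \<omega> k) *s F k) else 0) (\<bar>1 / \<gamma>\<bar> * B2) \<Longrightarrow>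
        (\<And>k. heat_symbol \<omega> k = 0 \<Longrightarrow> F k = 0) \<Longrightarrow> 0 < \<epsilon> \<Longrightarrow> \<epsilon> < \<epsilon>0 \<Longrightarrow>
        \<exists>U P. quasi_periodic_solution f s \<omega> C \<epsilon> U P \<and>
          ((\<forall>l. F (l, 0) = 0) \<longrightarrow> (\<forall>\<phi>. (LINT x:torus_cell|lborel. U \<phi> x) = 0))"
      by (rule solutions) blast
    show ?case
    proof (rule exI[of _ \<epsilon>0], rule exI[of _ C], intro conjI allI impI pos)
      fix \<omega> :: "real ^ 'v" and \<epsilon> :: real
      assume dio: "diophantine \<gamma> \<omega>" and \<epsilon>: "0 < \<epsilon> \<and> \<epsilon> < \<epsilon>0"
      \<comment> \<open>A zero of the symbol has \<xi> = 0, where the diophantine condition leaves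
        only k = 0; there the total average of the forcing vanishes.\<close>
      have res: "F k = 0" if "heat_symbol \<omega> k = 0" for k
        using diophantine_symbol(1)[OF \<gamma> dio heat_0[OF that]] that F0 by blast
      have "l2_bound (\<lambda>k. if snd k = 0 then weight \<rho> 0 k * norm ((1 / heat_symbol \<omega> k) *s F k) else 0) (\<bar>1 / \<gamma>\<bar> * B2)"
      proof (rule l2_bound_mono[OF l2_bound_scale[OF B2, of "1 / \<gamma>"]])
        fix k
        show "\<bar>if snd k = 0 then weight \<rho> 0 k * norm ((1 / heat_symbol \<omega> k) *s F k) else 0\<bar> \<le>
            1 / \<gamma> * (weight (\<rho> + real CARD('v)) 0 k * norm (F k))"
        proof (cases "snd k = 0 \<and> k \<noteq> 0")
          case True
          have "weight \<rho> 0 k * norm ((1 / heat_symbol \<omega> k) *s F k) = weight \<rho> 0 k * norm (F k) * (1 / cmod (heat_symbol \<omega> k))"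
            by (simp add: norm_smult_vec norm_divide)
          also have "\<dots> \<le> weight \<rho> 0 k * norm (F k) * (1 / \<gamma> * japanese (fst k) powr real CARD('v))"
            using True by (intro mult_left_mono diophantine_symbol(2)[OF \<gamma> dio]) simp_all
          also have "\<dots> = 1 / \<gamma> * (weight (\<rho> + real CARD('v)) 0 k * norm (F k))"
            by (simp add: weight_def powr_add)
          finally show ?thesis using True by (simp add: abs_mult)
        next
          case False
          then show ?thesis using \<gamma> by (auto simp: F0 norm_smult_vec)
        qed
      qed simp
      with sol[OF _ res] \<epsilon> obtain U P where "quasi_periodic_solution f s \<omega> C \<epsilon> U P" by blast
      then show "\<exists>U P. C1_sobolev s U \<and> C0_sobolev s P \<and>
          set_integrable lborel (torus_cell \<times> torus_cell) (\<lambda>(\<phi>, x). U \<phi> x) \<and>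
          (LINT (\<phi>, x):torus_cell \<times> torus_cell|lborel. U \<phi> x) = 0 \<and>
          (\<forall>\<phi>. (LINT x:torus_cell|lborel. P \<phi> x) = 0) \<and>
          navier_stokes_solution s (\<lambda>t. U (t *\<^sub>R \<omega>)) (\<lambda>t. P (t *\<^sub>R \<omega>)) (\<lambda>t x. \<epsilon> *\<^sub>R f (t *\<^sub>R \<omega>) x) \<and>
          C1_norm s U \<le> C * \<epsilon> \<and> C0_norm s P \<le> C * \<epsilon>"
        unfolding quasi_periodic_solution_def by (rule exI[of _ U, OF exI[of _ P]])
    qed
  next
    case 2
    then have F_mean: "F (l, 0) = 0" for l
      by (intro F_zero_space_average) blast
    \<comment> \<open>Here the linear solution vanishes at \<xi> = 0, so the bound 0 serves for
      every \<omega>.\<close>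
    obtain \<epsilon>0 C where pos: "0 < \<epsilon>0" "\<epsilon>0 < 1" "C > 0"
      and sol: "\<And>\<omega> \<epsilon>. l2_bound (\<lambda>k. if snd k = 0 then weight \<rho> 0 k * norm ((1 / heat_symbol \<omega> k) *s F k) else 0) 0 \<Longrightarrow>
        (\<And>k. heat_symbol \<omega> k = 0 \<Longrightarrow> F k = 0) \<Longrightarrow> 0 < \<epsilon> \<Longrightarrow> \<epsilon> < \<epsilon>0 \<Longrightarrow>
        \<exists>U P. quasi_periodic_solution f s \<omega> C \<epsilon> U P \<and>
          ((\<forall>l. F (l, 0) = 0) \<longrightarrow> (\<forall>\<phi>. (LINT x:torus_cell|lborel. U \<phi> x) = 0))"
      by (rule solutions[OF order_refl]) blast
    have F_mean': "F k = 0" if "snd k = 0" for k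
      using F_mean[of "fst k"] by (simp flip: that)
    show ?case
    proof (rule exI[of _ \<epsilon>0], rule exI[of _ C], intro conjI allI impI pos)
      fix \<omega> :: "real ^ 'v" and \<epsilon> :: real
      assume \<epsilon>: "0 < \<epsilon> \<and> \<epsilon> < \<epsilon>0"
      have "(\<lambda>k. if snd k = 0 then weight \<rho> 0 k * norm ((1 / heat_symbol \<omega> k) *s F k) else 0) = (\<lambda>k. 0)"
        by (simp add: fun_eq_iff F_mean norm_smult_vec)
      then have "l2_bound (\<lambda>k. if snd k = 0 then weight \<rho> 0 k * norm ((1 / heat_symbol \<omega> k) *s F k) else 0) 0"
        by (simp only: l2_bound_zero order_refl)
      \<comment> \<open>A rationally dependent \<omega> makes the symbol vanish also at some k
        \<noteq> 0, but only with \<xi> = 0, where the forcing has no coefficient.\<close>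
      moreover have "F k = 0" if "heat_symbol \<omega> k = 0" for k
        by (rule F_mean'[OF heat_0[OF that]])
      ultimately have "\<exists>U P. quasi_periodic_solution f s \<omega> C \<epsilon> U P \<and>
          ((\<forall>l. F (l, 0) = 0) \<longrightarrow> (\<forall>\<phi>. (LINT x:torus_cell|lborel. U \<phi> x) = 0))"
        using \<epsilon> by (intro sol) simp_all
      with F_mean obtain U P
        where "quasi_periodic_solution f s \<omega> C \<epsilon> U P" "\<forall>\<phi>. (LINT x:torus_cell|lborel. U \<phi> x) = 0"
        by blast
      then show "\<exists>U P. C1_sobolev s U \<and> C0_sobolev s P \<and>
          set_integrable lborel (torus_cell \<times> torus_cell) (\<lambda>(\<phi>, x). U \<phi> x) \<and>
          (LINT (\<phi>, x):torus_cell \<times> torus_cell|lborel. U \<phi> x) = 0 \<and>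
          (\<forall>\<phi>. (LINT x:torus_cell|lborel. U \<phi> x) = 0) \<and>
          (\<forall>\<phi>. (LINT x:torus_cell|lborel. P \<phi> x) = 0) \<and>
          navier_stokes_solution s (\<lambda>t. U (t *\<^sub>R \<omega>)) (\<lambda>t. P (t *\<^sub>R \<omega>)) (\<lambda>t x. \<epsilon> *\<^sub>R f (t *\<^sub>R \<omega>) x) \<and>
          C1_norm s U \<le> C * \<epsilon> \<and> C0_norm s P \<le> C * \<epsilon>"
        unfolding quasi_periodic_solution_def by (intro exI[of _ U] exI[of _ P]) simp
    qed
  qed
qed

end
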